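(* Let $d\ge1$, $n\ge2$, $M>0$, and let $X_1,\dots,X_n$ be arbitrary points in $\mathbb{B}^d$. Let $\xi_1,\dots,\xi_n$ be independent random variables that are sub-Gaussian with parameter $\varsigma>0$, i.e. $\mathbb{E}[\exp(\lambda\xi_i)]\le\exp(\varsigma^2\lambda^2/2)$ for all $\lambda\in\mathbb{R}$. Then for every $0<\delta\le M$, \[ \mathcal{G}_n(\mathcal{F}_{\sigma}(M);\delta,\xi_{1:n}) \lesssim \frac{\varsigma\, \delta^{\frac{3}{d+3}} M^{\frac{d}{d+3}}}{\sqrt{n}} \sqrt{\log(nM/\delta)}, \] where the implied constant does not depend on $\xi_{1:n}$, on the points $X_{1:n}\in\mathbb{B}^d$, on $n$, $\delta$, $M$ or $\varsigma$. Moreover, for any constant $B>0$, the same bound holds with $\mathcal{F}_\sigma(M)$ replaced by $\mathrm{star}(\mathcal{T}_B\mathcal{F}_\sigma(M))$.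
   Context: $\sigma(t)=\max\{t,0\}$; $\mathbb{B}^d$ is the closed unit ball of $\mathbb{R}^d$ and $\mathbb{S}^d$ the unit sphere of $\mathbb{R}^{d+1}$. For a finite signed Borel measure $\mu$ on $\mathbb{S}^d$, $f_\mu(x)=\int_{\mathbb{S}^d}\sigma((x^\intercal,1)v)d\mu(v)$ for $x\in\mathbb{B}^d$; $\mathcal{F}_\sigma$ is the set of all such functions, $\gamma(f)=\inf\{|\mu|(\mathbb{S}^d):f=f_\mu\}$, and $\mathcal{F}_\sigma(M)=\{f\in\mathcal{F}_\sigma:\gamma(f)\le M\}$. For a class $\mathcal{F}$ of real functions on $\mathbb{B}^d$, points $X_{1:n}$ with empirical norm $\|f\|_{L^2(\mu_n)}^2=\frac1n\sum_{i=1}^nf(X_i)^2$, and independent zero-mean $\xi_{1:n}$, the local complexity is $\mathcal{G}_n(\mathcal{F};\delta,\xi_{1:n})=\mathbb{E}_{\xi_{1:n}}\big[\sup_{f\in\mathcal{F},\|f\|_{L^2(\mu_n)}\le\delta}|\frac1n\sum_{i=1}^n\xi_if(X_i)|\big]$. The truncation is $\mathcal{T}_Bf(x)=f(x)$ if $|f(x)|\le B$ and $\mathrm{sgn}(f(x))B$ otherwise, $\mathcal{T}_B\mathcal{F}=\{\mathcal{T}_Bf:f\in\mathcal{F}\}$, and $\mathrm{star}(\mathcal{F})=\{af:f\in\mathcal{F},a\in[0,1]\}$. $A\lesssim C$ means $A\le cC$ for a constant $c>0$ depending only on $d$ (and on $B$ for the truncated class). *)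

theory Defs
  imports "HOL-Probability.Probability"
begin

definition relu :: "real \<Rightarrow> real" where
  "relu t = max t 0"

text \<open>A finite (nonnegative) Borel measure on the unit sphere S^d of R^(d+1),
  where R^(d+1) is represented as the product type 'a \<times> real with d = DIM('a).\<close>
definition sphere_fin_measure :: "('a::euclidean_space \<times> real) measure \<Rightarrow> bool" where
  "sphere_fin_measure \<mu> \<longleftrightarrow> finite_measure \<mu> \<and>
     sets \<mu> = sets (restrict_space borel (sphere (0::'a \<times> real) 1))"

text \<open>x \<mapsto> \<integral> sigma((x^T,1) v) d\<mu>(v), with v = (w,b), so (x^T,1) v = w\<bullet>x + b.\<close>
definition relu_net :: "('a::euclidean_space \<times> real) measure \<Rightarrow> 'a \<Rightarrow> real" where
  "relu_net \<mu> x = (\<integral>v. relu (fst v \<bullet> x + snd v) \<partial>\<mu>)"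

text \<open>A finite signed Borel measure on S^d is written as \<mu>p - \<mu>n with \<mu>p, \<mu>n finite
  Borel measures; f = f_(\<mu>p - \<mu>n) on the closed unit ball.\<close>
definition represents ::
  "('a::euclidean_space \<times> real) measure \<Rightarrow> ('a \<times> real) measure \<Rightarrow> ('a \<Rightarrow> real) \<Rightarrow> bool" where
  "represents \<mu>p \<mu>n f \<longleftrightarrow> sphere_fin_measure \<mu>p \<and> sphere_fin_measure \<mu>n \<and>
     (\<forall>x\<in>cball 0 1. f x = relu_net \<mu>p x - relu_net \<mu>n x)"

definition F_sigma :: "('a::euclidean_space \<Rightarrow> real) set" where
  "F_sigma = {f. \<exists>\<mu>p \<mu>n. represents \<mu>p \<mu>n f}"

text \<open>gamma(f) = inf |\<mu>|(S^d); the total variation of \<mu>p - \<mu>n is the infimum of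
  \<mu>p(S^d) + \<mu>n(S^d) over such decompositions (attained by the Jordan decomposition).\<close>
definition gamma :: "('a::euclidean_space \<Rightarrow> real) \<Rightarrow> real" where
  "gamma f = Inf {measure \<mu>p (space \<mu>p) + measure \<mu>n (space \<mu>n) | \<mu>p \<mu>n. represents \<mu>p \<mu>n f}"

definition F_sigma_M :: "real \<Rightarrow> ('a::euclidean_space \<Rightarrow> real) set" where
  "F_sigma_M M = {f \<in> F_sigma. gamma f \<le> M}"

definition truncB :: "real \<Rightarrow> ('a \<Rightarrow> real) \<Rightarrow> 'a \<Rightarrow> real" where
  "truncB B f = (\<lambda>x. if \<bar>f x\<bar> \<le> B then f x else sgn (f x) * B)"

definition trunc_class :: "real \<Rightarrow> ('a \<Rightarrow> real) set \<Rightarrow> ('a \<Rightarrow> real) set" where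
  "trunc_class B F = truncB B ` F"

definition star :: "('a \<Rightarrow> real) set \<Rightarrow> ('a \<Rightarrow> real) set" where
  "star F = {(\<lambda>x. a * f x) | a f. a \<in> {0..1} \<and> f \<in> F}"

definition emp_norm :: "nat \<Rightarrow> (nat \<Rightarrow> 'a) \<Rightarrow> ('a \<Rightarrow> real) \<Rightarrow> real" where
  "emp_norm n X f = sqrt ((1 / real n) * (\<Sum>i<n. (f (X i))\<^sup>2))"

definition subgaussian_law :: "real \<Rightarrow> real measure \<Rightarrow> bool" where
  "subgaussian_law s Q \<longleftrightarrow> prob_space Q \<and> sets Q = sets borel \<and>
     (\<forall>l. integrable Q (\<lambda>t. exp (l * t)) \<and> (\<integral>t. exp (l * t) \<partial>Q) \<le> exp (s\<^sup>2 * l\<^sup>2 / 2))"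

text \<open>Local complexity G_n(F; delta, xi_{1:n}) for independent xi_i with laws Q i:
  the joint law is the product measure and xi_i is the i-th coordinate.\<close>
definition local_complexity ::
  "nat \<Rightarrow> (nat \<Rightarrow> 'a) \<Rightarrow> ('a \<Rightarrow> real) set \<Rightarrow> real \<Rightarrow> (nat \<Rightarrow> real measure) \<Rightarrow> ennreal" where
  "local_complexity n X F \<delta> Q =
     (\<integral>\<^sup>+ \<omega>. (SUP f \<in> {f \<in> F. emp_norm n X f \<le> \<delta>}.
                 ennreal \<bar>(1 / real n) * (\<Sum>i<n. \<omega> i * f (X i))\<bar>) \<partial>(PiM {..<n} Q))"

definition rate :: "nat \<Rightarrow> nat \<Rightarrow> real \<Rightarrow> real \<Rightarrow> real \<Rightarrow> real" where
  "rate d n s \<delta> M = s * \<delta> powr (3 / (real d + 3)) * M powr (real d / (real d + 3)) / sqrt (real n)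
       * sqrt (ln (real n * M / \<delta>))"

end

theory Submission
  imports Defs
begin

text \<open>
  Fix an integer \<open>R\<close>. Haussler's packing lemma, applied to the hyperplanes \<open>{v. (X i, 1) \<bullet> v = 0}\<close>
  together with the hyperplanes of a grid of mesh \<open>1/R\<close>, splits the sphere of parameters \<open>v\<close> into
  \<open>O(R^d)\<close> cells of diameter \<open>O(1/R)\<close>, each crossed by a fraction at most \<open>1/R\<close> of the data
  hyperplanes. On a cell not crossed by the hyperplane of \<open>X i\<close> the map \<open>v \<mapsto> \<sigma>((X i, 1) \<bullet> v)\<close> is
  linear, so up to \<open>O(R^d)\<close> linear parameters a function of the class is a convex combination of
  residuals of empirical norm \<open>O(M R^(-3/2))\<close>. Maurey's argument with \<open>R^d\<close> terms then gives metric
  entropy \<open>O(R^d log R)\<close> at radius \<open>M R^(-(d+3)/2)\<close> for the empirical norm, uniformly in the data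
  points. The same entropy bound holds for the truncated star hull because truncation is
  1-Lipschitz, and chaining along \<open>R = R\<^sub>0 2^k\<close> gives a geometric sum of the stated order.
\<close>

section \<open>Packing numbers of set systems of bounded VC dimension\<close>

text \<open>The exponents come from three balances. A residual has size \<open>O(1/R)\<close> at a
  fraction \<open>1/R\<close> of the points, hence empirical norm of order \<open>R^(-3/2)\<close>.
  Sampling \<open>R^d\<close> terms gains a further \<open>R^(-d/2)\<close> and costs no more
  entropy than the linear parts of the \<open>O(R^d)\<close> cells. Finally \<open>R\<^sub>0\<close>
  is taken with radius about \<open>\<delta>\<close>, which makes
  \<open>\<delta> R\<^sub>0^(d/2)\<close> the claimed rate. Radius times root of entropy is
  \<open>M R^(-3/2)\<close> up to the logarithm, so under doubling of \<open>R\<close> the first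
  level dominates. The obstacle is that the data points are arbitrary: their hyperplanes may
  accumulate anywhere, so a fixed grid cannot supply the cells. Counting cells by Sauer's bound
  alone would cost powers of \<open>log R\<close> beyond the single logarithm of the rate;
  Haussler's lemma avoids this loss. The logarithm that remains pays for choosing parameters and
  coefficients from lattices of size polynomial in \<open>R\<close>. The chain stops when
  \<open>R\<close> exceeds \<open>R\<^sub>0\<close> by a factor of at least \<open>n\<close>, where
  Cauchy-Schwarz suffices; hence the \<open>n\<close> inside the logarithm.\<close>

definition shatters :: "'a set set \<Rightarrow> 'a set \<Rightarrow> bool" where
  "shatters F A \<longleftrightarrow> (\<forall>B\<subseteq>A. \<exists>S\<in>F. S \<inter> A = B)"

definition vc_at_most :: "'a set set \<Rightarrow> nat \<Rightarrow> bool" where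
  "vc_at_most F k \<longleftrightarrow> (\<forall>A. card A = Suc k \<longrightarrow> \<not> shatters F A)"

text \<open>The one-inclusion graph, a subgraph of the Boolean cube. An edge is stored as its
  direction and its lower end, so that each edge occurs once and the edges can be sorted by
  direction.\<close>

definition inclusion_edges :: "'a set set \<Rightarrow> ('a \<times> 'a set) set" where
  "inclusion_edges F = {(x, S). x \<notin> S \<and> S \<in> F \<and> insert x S \<in> F}"

lemma inclusion_edges_subset:
  assumes "F \<subseteq> Pow U"
  shows "inclusion_edges F \<subseteq> U \<times> F"
  using assms by (auto simp: inclusion_edges_def)

lemma finite_inclusion_edges:
  assumes "finite U" "F \<subseteq> Pow U"
  shows "finite (inclusion_edges F)"
  using inclusion_edges_subset[OF assms(2)] assms
  by (meson finite_Pow_iff finite_SigmaI finite_subset)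

lemma vc_at_most_mono: "vc_at_most F k \<Longrightarrow> G \<subseteq> F \<Longrightarrow> vc_at_most G k"
  unfolding vc_at_most_def shatters_def by (meson subsetD)

text \<open>Both bounds follow from one induction on the ground set. Split \<open>F\<close> at
  \<open>u\<close> into the members \<open>G\<close> avoiding \<open>u\<close> and the members
  \<open>H\<close> containing it, with \<open>u\<close> removed. Then \<open>F\<close> counts
  \<open>G \<union> H\<close> once and \<open>G \<inter> H\<close> once more, and
  \<open>G \<inter> H\<close> has smaller dimension because \<open>u\<close> can be added to any set
  that it shatters. Edges in direction \<open>u\<close> correspond to \<open>G \<inter> H\<close>;
  all others lie in \<open>G\<close> or in \<open>H\<close>, and an edge of both is an edge of
  \<open>G \<inter> H\<close>.\<close>

lemma sauer_and_edge_bound: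
  assumes "finite U" "F \<subseteq> Pow U" "vc_at_most F k"
  shows "card F \<le> (card U + 1) ^ k \<and> card (inclusion_edges F) \<le> k * card F"
  using assms
proof (induction U arbitrary: F k rule: finite_induct)
  case empty
  then have "F = {} \<or> F = {{}}" by auto
  then show ?case by (auto simp: inclusion_edges_def)
next
  case (insert u U)
  define G where "G = {S \<in> F. u \<notin> S}"
  define H where "H = (\<lambda>S. S - {u}) ` {S \<in> F. u \<in> S}"
  have finF: "finite F" using insert by (meson finite_Pow_iff finite_insert finite_subset)
  have fin: "finite G" "finite H" using finF by (auto simp: G_def H_def)
  have sub: "G \<subseteq> Pow U" "H \<subseteq> Pow U" using insert.prems by (auto simp: G_def H_def)
  have Hmem: "S \<in> H \<longleftrightarrow> u \<notin> S \<and> insert u S \<in> F" for S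
    unfolding H_def by (auto simp: image_iff insert_absorb intro!: bexI[of _ "insert u S"])
  have injH: "inj_on (\<lambda>S. S - {u}) {S \<in> F. u \<in> S}"
    by (auto simp: inj_on_def)
  have cardF: "card F = card (G \<union> H) + card (G \<inter> H)"
  proof -
    have "card F = card G + card {S \<in> F. u \<in> S}"
      unfolding G_def using finF by (subst card_Un_disjoint[symmetric]) (auto intro!: arg_cong[of _ _ card])
    also have "card {S \<in> F. u \<in> S} = card H"
      unfolding H_def using injH by (simp add: card_image)
    finally show ?thesis using card_Un_Int[OF fin] by simp
  qed
  have vcU: "vc_at_most (G \<union> H) k"
    unfolding vc_at_most_def
  proof (intro allI impI notI)
    fix A assume A: "card A = Suc k" "shatters (G \<union> H) A"
    have "u \<notin> A"
    proof
      assume "u \<in> A"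
      with A(2) obtain S where "S \<in> G \<union> H" "S \<inter> A = A" unfolding shatters_def by blast
      then show False using \<open>u \<in> A\<close> by (auto simp: G_def Hmem)
    qed
    have "shatters F A" unfolding shatters_def
    proof (intro allI impI)
      fix B assume "B \<subseteq> A"
      with A(2) obtain S where S: "S \<in> G \<union> H" "S \<inter> A = B" unfolding shatters_def by blast
      then show "\<exists>S\<in>F. S \<inter> A = B"
        using \<open>u \<notin> A\<close> by (auto simp: G_def Hmem intro: bexI[of _ "insert u S"])
    qed
    with A(1) insert.prems(2) show False by (auto simp: vc_at_most_def)
  qed
  have shI: "shatters F (insert u A)" if "shatters (G \<inter> H) A" "u \<notin> A" for A
    unfolding shatters_def
  proof (intro allI impI)
    fix B assume B: "B \<subseteq> insert u A"
    then have "B - {u} \<subseteq> A" by auto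
    with that obtain S where S: "S \<in> G \<inter> H" "S \<inter> A = B - {u}" unfolding shatters_def by blast
    have eq: "insert u S \<inter> insert u A = insert u (B - {u})" "S \<inter> insert u A = B - {u}"
      using S by (auto simp: G_def)
    show "\<exists>S\<in>F. S \<inter> insert u A = B"
    proof (cases "u \<in> B")
      case True
      then show ?thesis using S eq by (intro bexI[of _ "insert u S"]) (auto simp: Hmem)
    next
      case False
      then show ?thesis using S eq by (intro bexI[of _ S]) (auto simp: G_def)
    qed
  qed
  have notin: "u \<notin> A" if "shatters (G \<inter> H) A" for A
  proof
    assume "u \<in> A"
    with that obtain S where "S \<in> G \<inter> H" "S \<inter> A = A" unfolding shatters_def by blast
    then show False using \<open>u \<in> A\<close> by (auto simp: G_def)
  qed
  have zero: "G \<inter> H = {}" if "k = 0"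
  proof (rule ccontr)
    assume "G \<inter> H \<noteq> {}"
    then have "shatters (G \<inter> H) {}" unfolding shatters_def by auto
    then have "shatters F {u}" using shI[of "{}"] by simp
    then show False using insert.prems(2) that by (auto simp: vc_at_most_def)
  qed
  have vcI: "vc_at_most (G \<inter> H) (k - 1)" if "k > 0"
    unfolding vc_at_most_def
  proof (intro allI impI notI)
    fix A assume A: "card A = Suc (k - 1)" "shatters (G \<inter> H) A"
    have "finite A" using A(1) by (metis card.infinite nat.distinct(1))
    then have "card (insert u A) = Suc k" using A notin[OF A(2)] that by simp
    then show False using shI[OF A(2) notin[OF A(2)]] insert.prems(2) by (auto simp: vc_at_most_def)
  qed
  have subU: "G \<union> H \<subseteq> Pow U" "G \<inter> H \<subseteq> Pow U" using sub by auto
  note IHU = insert.IH[OF subU(1) vcU]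
  \<comment> \<open>The dimension drop leaves room for one extra edge per member of
    \<open>G \<inter> H\<close>, which pays for the edges in direction \<open>u\<close>. At
    \<open>k = 0\<close> there is no drop, but then \<open>G \<inter> H\<close> is empty.\<close>
  have IHI: "card (inclusion_edges (G \<inter> H)) + card (G \<inter> H) \<le> k * card (G \<inter> H)"
  proof (cases "k = 0")
    case True then show ?thesis using zero by (simp add: inclusion_edges_def)
  next
    case False
    then have "card (inclusion_edges (G \<inter> H)) \<le> (k - 1) * card (G \<inter> H)"
      using insert.IH[OF subU(2) vcI] by simp
    then show ?thesis using False by (cases k) auto
  qed
  have "inclusion_edges F \<subseteq> (\<lambda>S. (u, S)) ` (G \<inter> H) \<union> inclusion_edges G
      \<union> (\<lambda>(x, S). (x, insert u S)) ` inclusion_edges H" (is "_ \<subseteq> ?A \<union> ?B \<union> ?C")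
  proof clarify
    fix x S assume e: "(x, S) \<in> inclusion_edges F" "(x, S) \<notin> ?C" "(x, S) \<notin> inclusion_edges G"
    show "(x, S) \<in> ?A"
    proof (cases "x = u")
      case True
      then show ?thesis using e by (auto simp: inclusion_edges_def G_def Hmem)
    next
      case False
      then have "u \<in> S" using e by (auto simp: inclusion_edges_def G_def)
      then have "(x, S - {u}) \<in> inclusion_edges H"
        using e(1) False insert_commute[of u x "S - {u}"] unfolding inclusion_edges_def
        by (auto simp: Hmem insert_absorb)
      then have "(x, S) \<in> ?C" using \<open>u \<in> S\<close> by (force simp: insert_absorb)
      then show ?thesis using e by blast
    qed
  qed
  moreover have finE: "finite (inclusion_edges G)" "finite (inclusion_edges H)"
    "finite (inclusion_edges (G \<union> H))" "finite (inclusion_edges (G \<inter> H))"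
    using finite_inclusion_edges[OF insert.hyps(1)] sub subU by auto
  ultimately have "card (inclusion_edges F) \<le> card (?A \<union> ?B \<union> ?C)"
    using fin by (intro card_mono) auto
  also have "\<dots> \<le> card ?A + card ?B + card ?C"
    by (meson add_le_mono card_Un_le le_refl order_trans)
  also have "\<dots> \<le> card (G \<inter> H) + card (inclusion_edges G) + card (inclusion_edges H)"
    using finE fin by (intro add_mono card_image_le) auto
  also have "\<dots> = card (G \<inter> H) + (card (inclusion_edges G \<union> inclusion_edges H)
      + card (inclusion_edges G \<inter> inclusion_edges H))"
    using card_Un_Int[OF finE(1,2)] by simp
  also have "\<dots> \<le> card (G \<inter> H) + (card (inclusion_edges (G \<union> H)) + card (inclusion_edges (G \<inter> H)))"
    using finE by (intro add_left_mono add_mono card_mono) (auto simp: inclusion_edges_def)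
  also have "\<dots> \<le> k * card (G \<union> H) + k * card (G \<inter> H)" using IHU IHI by linarith
  also have "\<dots> = k * card F" by (simp add: cardF algebra_simps)
  finally have edges: "card (inclusion_edges F) \<le> k * card F" .
  have "card F \<le> (card (insert u U) + 1) ^ k"
  proof (cases "k = 0")
    case True
    then show ?thesis using zero cardF IHU by simp
  next
    case False
    then obtain l where l: "k = Suc l" by (cases k) auto
    have "card F \<le> (card U + 1) ^ Suc l + (card U + 1) ^ l"
      using cardF IHU insert.IH[OF subU(2) vcI] l by simp
    also have "\<dots> = (card U + 2) * (card U + 1) ^ l" by simp
    also have "\<dots> \<le> (card U + 2) * (card U + 2) ^ l"
      by (intro mult_left_mono power_mono) auto
    finally show ?thesis using l insert.hyps by simp
  qed
  with edges show ?case by simp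
qed

text \<open>A layer-cake argument: \<open>min\<close> of the two end weights counts the thresholds
  \<open>t\<close> at which both ends lie in the superlevel family \<open>L t\<close>. Each
  superlevel family inherits the dimension bound, so the unweighted edge bound holds at every
  \<open>t\<close>, and the sizes of the \<open>L t\<close> add up to the total weight.\<close>

lemma sum_min_edges_le:
  fixes b :: "'a set \<Rightarrow> nat"
  assumes "finite U" "F \<subseteq> Pow U" "vc_at_most F k"
  shows "(\<Sum>(x, S)\<in>inclusion_edges F. min (b S) (b (insert x S))) \<le> k * sum b F"
proof -
  have finF: "finite F" using assms by (meson finite_Pow_iff finite_subset)
  note finE = finite_inclusion_edges[OF assms(1,2)]
  define m where "m = sum b F"
  have bm: "b S \<le> m" if "S \<in> F" for S
    unfolding m_def using finF that by (simp add: member_le_sum)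
  define L where "L t = {S \<in> F. t \<le> b S}" for t
  have card_le: "(\<Sum>t\<in>{1..m}. of_bool (t \<le> a)) = a" if "a \<le> m" for a
  proof -
    have "{1..m} \<inter> {t. t \<le> a} = {1..a}" using that by auto
    then show ?thesis by simp
  qed
  have "(\<Sum>(x, S)\<in>inclusion_edges F. min (b S) (b (insert x S)))
      = (\<Sum>e\<in>inclusion_edges F. \<Sum>t\<in>{1..m}. of_bool (t \<le> min (b (snd e)) (b (insert (fst e) (snd e)))))"
  proof (rule sum.cong[OF refl])
    fix e assume e: "e \<in> inclusion_edges F"
    then have "min (b (snd e)) (b (insert (fst e) (snd e))) \<le> m"
      by (intro min.coboundedI1 bm) (auto simp: inclusion_edges_def)
    from card_le[OF this] show "(case e of (x, S) \<Rightarrow> min (b S) (b (insert x S)))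
       = (\<Sum>t\<in>{1..m}. of_bool (t \<le> min (b (snd e)) (b (insert (fst e) (snd e)))))"
      by (simp add: case_prod_beta)
  qed
  also have "\<dots> = (\<Sum>t\<in>{1..m}. \<Sum>e\<in>inclusion_edges F. of_bool (t \<le> min (b (snd e)) (b (insert (fst e) (snd e)))))"
    by (rule sum.swap)
  also have "\<dots> = (\<Sum>t\<in>{1..m}. card (inclusion_edges (L t)))"
    using finE by (intro sum.cong refl) (auto simp: L_def inclusion_edges_def intro!: arg_cong[of _ _ card])
  also have "\<dots> \<le> (\<Sum>t\<in>{1..m}. k * card (L t))"
  proof (rule sum_mono)
    fix t
    have "L t \<subseteq> F" by (auto simp: L_def)
    then show "card (inclusion_edges (L t)) \<le> k * card (L t)"
      using sauer_and_edge_bound[OF assms(1) _ vc_at_most_mono[OF assms(3)], of "L t"] assms(2) by auto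
  qed
  also have "\<dots> = k * (\<Sum>t\<in>{1..m}. \<Sum>S\<in>F. of_bool (t \<le> b S))"
    using finF by (simp add: sum_distrib_left L_def Int_def)
  also have "\<dots> = k * (\<Sum>S\<in>F. \<Sum>t\<in>{1..m}. of_bool (t \<le> b S))"
    by (subst sum.swap) simp
  also have "\<dots> = k * sum b F" using card_le bm by (intro arg_cong2[of _ _ _ _ "(*)"] sum.cong refl) blast
  finally show ?thesis .
qed

text \<open>Double counting of ordered pairs of distinct members with the tests that tell them
  apart. A test splitting \<open>W\<close> into parts of sizes \<open>p\<close> and \<open>q\<close>
  separates \<open>2 * p * q\<close> ordered pairs, at most \<open>2 * card W\<close> times the
  smaller part. The summand \<open>\<delta>\<close> on the right accounts for having
  \<open>card W - 1\<close> partners instead of \<open>card W\<close>, without natural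
  subtraction.\<close>

lemma separated_split_bound:
  fixes P :: "'v \<Rightarrow> 't \<Rightarrow> bool"
  assumes fin: "finite W" "finite T"
    and sep: "\<And>v w. v \<in> W \<Longrightarrow> w \<in> W \<Longrightarrow> v \<noteq> w \<Longrightarrow> \<delta> \<le> card {t \<in> T. P v t \<noteq> P w t}"
  shows "\<delta> * card W \<le> \<delta> + 2 * (\<Sum>t\<in>T. min (card {v \<in> W. \<not> P v t}) (card {v \<in> W. P v t}))"
proof (cases "W = {}")
  case False
  define p q where "p t = card {v \<in> W. P v t}" and "q t = card {v \<in> W. \<not> P v t}" for t
  have pq: "p t + q t = card W" for t
    unfolding p_def q_def using fin by (subst card_Un_disjoint[symmetric]) (auto intro!: arg_cong[of _ _ card])
  have mn: "p t * q t \<le> card W * min (q t) (p t)" for t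
    unfolding pq[of t, symmetric] by (simp add: min_def algebra_simps)
  have "card W * (card W - 1) * \<delta> = (\<Sum>v\<in>W. \<Sum>w\<in>W - {v}. \<delta>)"
    using fin by (simp add: card_Diff_singleton)
  also have "\<dots> \<le> (\<Sum>v\<in>W. \<Sum>w\<in>W - {v}. card {t \<in> T. P v t \<noteq> P w t})"
    using sep by (intro sum_mono) auto
  also have "\<dots> \<le> (\<Sum>v\<in>W. \<Sum>w\<in>W. card {t \<in> T. P v t \<noteq> P w t})"
    using fin by (intro sum_mono sum_mono2) auto
  also have "\<dots> = (\<Sum>v\<in>W. \<Sum>w\<in>W. \<Sum>t\<in>T. of_bool (P v t \<noteq> P w t))"
    using fin by (simp add: Int_def)
  also have "\<dots> = (\<Sum>t\<in>T. \<Sum>v\<in>W. \<Sum>w\<in>W. of_bool (P v t \<noteq> P w t))"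
    by (simp only: sum.swap[where B = T and A = W])
  also have "\<dots> = (\<Sum>t\<in>T. 2 * (p t * q t))"
  proof (rule sum.cong[OF refl])
    fix t
    have "(\<Sum>w\<in>W. of_bool (P v t \<noteq> P w t)) = (if P v t then q t else p t)" for v
      using fin by (simp add: p_def q_def Int_def)
    then have "(\<Sum>v\<in>W. \<Sum>w\<in>W. of_bool (P v t \<noteq> P w t)) = (\<Sum>v\<in>W. if P v t then q t else p t)" by simp
    also have "\<dots> = (\<Sum>v\<in>{v\<in>W. P v t}. q t) + (\<Sum>v\<in>{v\<in>W. \<not> P v t}. p t)"
      using fin by (simp add: sum.If_cases Int_def)
    also have "\<dots> = 2 * (p t * q t)" by (simp add: p_def[symmetric] q_def[symmetric])
    finally show "(\<Sum>v\<in>W. \<Sum>w\<in>W. of_bool (P v t \<noteq> P w t)) = 2 * (p t * q t)" .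
  qed
  also have "\<dots> \<le> (\<Sum>t\<in>T. 2 * (card W * min (q t) (p t)))"
    by (intro sum_mono mult_left_mono mn) auto
  also have "\<dots> = card W * (2 * (\<Sum>t\<in>T. min (q t) (p t)))"
    by (simp add: sum_distrib_left mult_ac)
  finally have "card W * ((card W - 1) * \<delta>) \<le> card W * (2 * (\<Sum>t\<in>T. min (q t) (p t)))"
    by (simp add: mult_ac)
  moreover have c: "card W > 0" using False fin by (simp add: card_gt_0_iff)
  ultimately have "(card W - 1) * \<delta> \<le> 2 * (\<Sum>t\<in>T. min (q t) (p t))" by simp
  moreover have "\<delta> * card W = \<delta> + (card W - 1) * \<delta>" using c by (cases "card W") auto
  ultimately show ?thesis by (simp add: p_def q_def)
qed simp

text \<open>The trace on a sample is recorded by sample positions and not by the sampled elements,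
  so a sample may repeat elements and all samples live on the same ground set
  \<open>J\<close>.\<close>

definition pattern :: "('v \<Rightarrow> 't \<Rightarrow> bool) \<Rightarrow> 'i set \<Rightarrow> ('i \<Rightarrow> 't) \<Rightarrow> 'v \<Rightarrow> 'i set" where
  "pattern P J a v = {j \<in> J. P v (a j)}"

text \<open>Positions holding the same element always receive the same answer, so a shattered set of
  positions carries distinct elements and maps to a shattered set of the same size.\<close>

lemma vc_at_most_pattern:
  assumes vc: "vc_at_most ((\<lambda>v. {t \<in> T. P v t}) ` V) k" and a: "\<And>j. j \<in> J \<Longrightarrow> a j \<in> T"
  shows "vc_at_most (pattern P J a ` V) k"
  unfolding vc_at_most_def
proof (intro allI impI notI)
  fix A assume A: "card A = Suc k" "shatters (pattern P J a ` V) A"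
  have ex: "\<exists>v\<in>V. {j \<in> J. P v (a j)} \<inter> A = B" if "B \<subseteq> A" for B
    using A(2) that unfolding shatters_def pattern_def by blast
  have AJ: "A \<subseteq> J" using ex[of A] by blast
  have inj: "inj_on a A"
  proof (rule inj_onI, rule ccontr)
    fix i j assume ij: "i \<in> A" "j \<in> A" "a i = a j" "i \<noteq> j"
    then obtain v where "{j \<in> J. P v (a j)} \<inter> A = {i}" using ex[of "{i}"] by auto
    then have "i \<in> {j \<in> J. P v (a j)}" "j \<notin> {j \<in> J. P v (a j)}" using ij(2,4) by auto
    then show False using ij AJ by auto
  qed
  have "shatters ((\<lambda>v. {t \<in> T. P v t}) ` V) (a ` A)" unfolding shatters_def
  proof (intro allI impI)
    fix B assume "B \<subseteq> a ` A"
    obtain v where v: "v \<in> V" "{j \<in> J. P v (a j)} \<inter> A = {j \<in> A. a j \<in> B}"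
      using ex[of "{j \<in> A. a j \<in> B}"] by auto
    have "{t \<in> T. P v t} \<inter> a ` A = B"
    proof (intro equalityI subsetI)
      fix t assume "t \<in> {t \<in> T. P v t} \<inter> a ` A"
      then show "t \<in> B" using v(2) AJ by blast
    next
      fix t assume "t \<in> B"
      then obtain j where "j \<in> A" "t = a j" using \<open>B \<subseteq> a ` A\<close> by auto
      then show "t \<in> {t \<in> T. P v t} \<inter> a ` A" using v(2) AJ a \<open>t \<in> B\<close> by blast
    qed
    then show "\<exists>S\<in>(\<lambda>v. {t \<in> T. P v t}) ` V. S \<inter> a ` A = B" using v(1) by auto
  qed
  then show False using vc A(1) card_image[OF inj] by (auto simp: vc_at_most_def)
qed

lemma sum_PiE_insert:
  assumes "j \<notin> J"
  shows "(\<Sum>a\<in>PiE (insert j J) (\<lambda>_. T). f a) = (\<Sum>a\<in>PiE J (\<lambda>_. T). \<Sum>t\<in>T. f (a(j := t)))"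
proof -
  have "(\<Sum>a\<in>PiE (insert j J) (\<lambda>_. T). f a) = (\<Sum>(t, a)\<in>T \<times> PiE J (\<lambda>_. T). f (a(j := t)))"
    unfolding PiE_insert_eq
    by (subst sum.reindex[OF inj_combinator[OF assms]]) (simp add: case_prod_beta)
  also have "\<dots> = (\<Sum>t\<in>T. \<Sum>a\<in>PiE J (\<lambda>_. T). f (a(j := t)))"
    by (simp add: sum.cartesian_product)
  also have "\<dots> = (\<Sum>a\<in>PiE J (\<lambda>_. T). \<Sum>t\<in>T. f (a(j := t)))" by (rule sum.swap)
  finally show ?thesis .
qed

text \<open>For a random sample \<open>a\<close> of \<open>s\<close> elements of \<open>T\<close>, weight each edge
  of the one-inclusion graph of the traces on \<open>a\<close> by the smaller of the numbers of members of
  \<open>V\<close> at its two ends. The total weight is at most \<open>k |V|\<close> by \<open>sum_min_edges_le\<close>. On the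
  other hand, once all sample points but the \<open>j\<close>-th are fixed, the \<open>j\<close>-th one splits the
  trace classes often because \<open>V\<close> is separated, unless there are many such classes.\<close>

lemma haussler_packing:
  fixes P :: "'v \<Rightarrow> 't \<Rightarrow> bool"
  assumes fin: "finite V" "finite T"
    and vc: "vc_at_most ((\<lambda>v. {t \<in> T. P v t}) ` V) k"
    and sep: "\<And>v w. v \<in> V \<Longrightarrow> w \<in> V \<Longrightarrow> v \<noteq> w \<Longrightarrow> \<delta> \<le> card {t \<in> T. P v t \<noteq> P w t}"
    and s: "4 * card T * k \<le> s * \<delta>" "0 < s * \<delta>" and T: "T \<noteq> {}"
  shows "card V \<le> 2 * s ^ k"
proof -
  define m where "m = card V"
  define N where "N = card T"
  have N: "N > 0" using T fin by (simp add: N_def card_gt_0_iff)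
  define J where "J = {..<s}"
  \<comment> \<open>Expectations over samples are replaced by sums over all \<open>N ^ s\<close>
    maps from \<open>J\<close> to \<open>T\<close>. The weight of a trace is the number of members
    of \<open>V\<close> that produce it, and \<open>w a j\<close> collects the edges in direction
    \<open>j\<close> only.\<close>
  define b where "b a S = card {v \<in> V. pattern P J a v = S}" for a S
  define w where "w a j = (\<Sum>S | (j, S) \<in> inclusion_edges (pattern P J a ` V).
      min (b a S) (b a (insert j S)))" for a j
  have finPi: "finite (PiE K (\<lambda>_. T))" if "finite K" for K :: "nat set"
    using fin that by (intro finite_PiE) auto
  have cardPi: "card (PiE K (\<lambda>_. T)) = N ^ card K" if "finite K" for K :: "nat set"
    using card_PiE[OF that, of "\<lambda>_. T"] by (simp add: N_def)
  have upper: "(\<Sum>j<s. w a j) \<le> k * m" if "a \<in> PiE J (\<lambda>_. T)" for a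
  proof -
    let ?F = "pattern P J a ` V"
    have F: "finite J" "?F \<subseteq> Pow J" by (auto simp: J_def pattern_def)
    have vc': "vc_at_most ?F k" using vc that by (intro vc_at_most_pattern) auto
    have finE: "finite (inclusion_edges ?F)" by (rule finite_inclusion_edges[OF F])
    have "(\<Sum>j<s. w a j) = (\<Sum>(j, S)\<in>(SIGMA j:{..<s}. {S. (j, S) \<in> inclusion_edges ?F}).
        min (b a S) (b a (insert j S)))"
    proof -
      have "finite {S. (j, S) \<in> inclusion_edges ?F}" for j
        by (rule finite_subset[OF _ finite_imageI[OF finE, of snd]]) force
      then show ?thesis unfolding w_def by (subst sum.Sigma) auto
    qed
    also have "(SIGMA j:{..<s}. {S. (j, S) \<in> inclusion_edges ?F}) = inclusion_edges ?F"
      using inclusion_edges_subset[OF F(2)] by (auto simp: J_def)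
    also have "(\<Sum>(j, S)\<in>inclusion_edges ?F. min (b a S) (b a (insert j S))) \<le> k * sum (b a) ?F"
      by (rule sum_min_edges_le[OF F vc'])
    also have "sum (b a) ?F = m"
      unfolding b_def m_def using fin sum.image_gen[of V "\<lambda>_. 1::nat" "pattern P J a"] by simp
    finally show ?thesis .
  qed
  \<comment> \<open>Coordinate \<open>j\<close> is left free: \<open>N ^ (s - 1)\<close> counts the
    choices of the other coordinates, and the value at \<open>j\<close> is summed inside.\<close>
  have lower: "N ^ (s - 1) * (\<delta> * m) \<le> N ^ (s - 1) * (\<delta> * s ^ k) + 2 * (\<Sum>a\<in>PiE J (\<lambda>_. T). w a j)"
    if j: "j < s" for j
  proof -
    define K where "K = J - {j}"
    have K: "finite K" "j \<notin> K" "J = insert j K" "card K = s - 1" using j by (auto simp: K_def J_def)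
    have one: "\<delta> * m \<le> \<delta> * s ^ k + 2 * (\<Sum>t\<in>T. w (a(j := t)) j)" if a: "a \<in> PiE K (\<lambda>_. T)" for a
    proof -
      let ?F = "pattern P K a ` V"
      define W where "W S = {v \<in> V. pattern P K a v = S}" for S
      have F: "?F \<subseteq> Pow K" by (auto simp: pattern_def)
      have finF: "finite ?F" using fin by simp
      have vc': "vc_at_most ?F k" using vc a by (intro vc_at_most_pattern) auto
      \<comment> \<open>Sauer's bound on \<open>s - 1\<close> positions gives exactly
        \<open>s ^ k\<close>, the \<open>+ 1\<close> restoring the removed position.\<close>
      have cF: "card ?F \<le> s ^ k"
        using sauer_and_edge_bound[OF K(1) F vc'] K(4) j by simp
      have pat: "pattern P J (a(j := t)) v = (if P v t then insert j (pattern P K a v) else pattern P K a v)" for t v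
        using K by (auto simp: pattern_def)
      have jn: "j \<notin> pattern P K a v" for v using K by (auto simp: pattern_def)
      have b0: "b (a(j := t)) S = card {v \<in> W S. \<not> P v t}"
        and b1: "b (a(j := t)) (insert j S) = card {v \<in> W S. P v t}" if "S \<in> ?F" for S t
      proof -
        have "j \<notin> S" using that jn by auto
        then show "b (a(j := t)) S = card {v \<in> W S. \<not> P v t}"
          unfolding b_def W_def pat by (intro arg_cong[of _ _ card]) auto
        have "insert j (pattern P K a v) = insert j S \<longleftrightarrow> pattern P K a v = S" for v
          using jn[of v] \<open>j \<notin> S\<close> by (metis insert_ident)
        then show "b (a(j := t)) (insert j S) = card {v \<in> W S. P v t}"
          unfolding b_def W_def pat using jn by (intro arg_cong[of _ _ card]) (auto; metis insertI1)
      qed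
      have wge: "(\<Sum>S\<in>?F. min (card {v \<in> W S. \<not> P v t}) (card {v \<in> W S. P v t})) \<le> w (a(j := t)) j" for t
      proof -
        let ?b = "b (a(j := t))" and ?G = "pattern P J (a(j := t)) ` V"
        have G: "finite J" "?G \<subseteq> Pow J" by (auto simp: J_def pattern_def)
        have finG: "finite {S. (j, S) \<in> inclusion_edges ?G}"
          by (rule finite_subset[OF _ finite_imageI[OF finite_inclusion_edges[OF G], of snd]]) force
        have bpos: "S \<in> ?G" if "?b S > 0" for S
          using that unfolding b_def by (force simp: card_gt_0_iff)
        have "(\<Sum>S\<in>?F. min (card {v \<in> W S. \<not> P v t}) (card {v \<in> W S. P v t}))
            = (\<Sum>S\<in>?F. min (?b S) (?b (insert j S)))" using b0 b1 by simp
        \<comment> \<open>A nonzero \<open>min\<close> means that both traces are realised, hence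
          that they really form an edge in direction \<open>j\<close>.\<close>
        also have "\<dots> = (\<Sum>S | S \<in> ?F \<and> min (?b S) (?b (insert j S)) \<noteq> 0. min (?b S) (?b (insert j S)))"
          using finF by (intro sum.mono_neutral_right) auto
        also have "\<dots> \<le> w (a(j := t)) j" unfolding w_def
        proof (rule sum_mono2[OF finG])
          show "{S. S \<in> ?F \<and> min (?b S) (?b (insert j S)) \<noteq> 0} \<subseteq> {S. (j, S) \<in> inclusion_edges ?G}"
            using jn by (auto simp: inclusion_edges_def intro!: bpos)
        qed auto
        finally show ?thesis .
      qed
      have "\<delta> * m = (\<Sum>S\<in>?F. \<delta> * card (W S))"
        unfolding W_def m_def sum_distrib_left[symmetric]
        using fin sum.image_gen[of V "\<lambda>_. 1::nat" "pattern P K a"] by simp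
      also have "\<dots> \<le> (\<Sum>S\<in>?F. \<delta> + 2 * (\<Sum>t\<in>T. min (card {v \<in> W S. \<not> P v t}) (card {v \<in> W S. P v t})))"
        using fin sep by (intro sum_mono separated_split_bound) (auto simp: W_def)
      also have "\<dots> = \<delta> * card ?F + 2 * (\<Sum>t\<in>T. \<Sum>S\<in>?F. min (card {v \<in> W S. \<not> P v t}) (card {v \<in> W S. P v t}))"
        by (subst sum.swap) (simp add: sum.distrib sum_distrib_left)
      also have "\<dots> \<le> \<delta> * s ^ k + 2 * (\<Sum>t\<in>T. w (a(j := t)) j)"
        by (intro add_mono mult_left_mono sum_mono wge cF) auto
      finally show ?thesis .
    qed
    have "N ^ (s - 1) * (\<delta> * m) = (\<Sum>a\<in>PiE K (\<lambda>_. T). \<delta> * m)" using cardPi[OF K(1)] K(4) by simp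
    also have "\<dots> \<le> (\<Sum>a\<in>PiE K (\<lambda>_. T). \<delta> * s ^ k + 2 * (\<Sum>t\<in>T. w (a(j := t)) j))"
      by (intro sum_mono one)
    also have "\<dots> = N ^ (s - 1) * (\<delta> * s ^ k) + 2 * (\<Sum>a\<in>PiE J (\<lambda>_. T). w a j)"
      unfolding K(3) sum_PiE_insert[OF K(2)] sum.distrib sum_distrib_left[symmetric]
      using cardPi[OF K(1)] K(4) by simp
    finally show ?thesis .
  qed
  have "s * (N ^ (s - 1) * (\<delta> * m)) = (\<Sum>j<s. N ^ (s - 1) * (\<delta> * m))" by simp
  also have "\<dots> \<le> (\<Sum>j<s. N ^ (s - 1) * (\<delta> * s ^ k) + 2 * (\<Sum>a\<in>PiE J (\<lambda>_. T). w a j))"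
    using lower by (intro sum_mono) auto
  also have "\<dots> = s * (N ^ (s - 1) * (\<delta> * s ^ k)) + 2 * (\<Sum>a\<in>PiE J (\<lambda>_. T). \<Sum>j<s. w a j)"
    by (simp add: sum.distrib sum_distrib_left[symmetric] sum.swap[of w "{..<s}" "PiE J (\<lambda>_. T)"])
  also have "\<dots> \<le> s * (N ^ (s - 1) * (\<delta> * s ^ k)) + 2 * (\<Sum>a\<in>PiE J (\<lambda>_. T). k * m)"
    by (intro add_mono mult_left_mono sum_mono upper) auto
  also have "(\<Sum>a\<in>PiE J (\<lambda>_. T). k * m) = N ^ s * (k * m)"
    using cardPi[of J] by (simp add: J_def)
  also have "N ^ s = N ^ (s - 1) * N" using s(2) by (cases s) auto
  finally have "N ^ (s - 1) * (s * \<delta> * m) \<le> N ^ (s - 1) * (s * \<delta> * s ^ k + 2 * N * k * m)"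
    by (simp add: algebra_simps)
  then have "s * \<delta> * m \<le> s * \<delta> * s ^ k + 2 * N * k * m" using N by simp
  \<comment> \<open>This is where the sample size enters: it makes the edge term at most half of the
    left-hand side, so the term can be absorbed. The factor 2 in the conclusion is the
    result.\<close>
  moreover have "2 * (2 * N * k * m) \<le> s * \<delta> * m"
    using mult_right_mono[OF s(1), of m] by (simp add: N_def mult_ac)
  ultimately have "s * \<delta> * m \<le> 2 * (s * \<delta> * s ^ k)" by linarith
  then have "s * \<delta> * m \<le> s * \<delta> * (2 * s ^ k)" by (simp add: mult_ac)
  then show ?thesis using s(2) by (simp add: m_def)
qed

section \<open>Nets of half-spaces\<close>

text \<open>Dependence of an indexed family and not of its image: if \<open>p\<close> repeats a
  value, the image may be independent, but the difference of the two indices is then a nontrivial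
  relation.\<close>

lemma indexed_dependence:
  fixes p :: "'t \<Rightarrow> 'e::euclidean_space"
  assumes fin: "finite A" and sub: "p ` A \<subseteq> span B" and B: "finite B" "card B < card A"
  obtains u where "\<exists>t\<in>A. u t \<noteq> (0::real)" "(\<Sum>t\<in>A. u t *\<^sub>R p t) = 0"
proof (cases "inj_on p A")
  case True
  have "dependent (p ` A)"
  proof (rule ccontr)
    assume "\<not> dependent (p ` A)"
    then have "card (p ` A) \<le> card B" using independent_span_bound[OF B(1) _ sub] by blast
    then show False using B card_image[OF True] by simp
  qed
  then obtain w v where w: "v \<in> p ` A" "w v \<noteq> (0::real)" "(\<Sum>v\<in>p ` A. w v *\<^sub>R v) = 0"
    using dependent_finite[of "p ` A"] fin by auto
  show ?thesis
    by (rule that[of "w \<circ> p"]) (use w True in \<open>auto simp: sum.reindex\<close>)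
next
  case False
  then obtain s t where st: "s \<in> A" "t \<in> A" "p s = p t" "s \<noteq> t" by (auto simp: inj_on_def)
  define u where "u r = (if r = s then 1 else if r = t then -1 else (0::real))" for r
  have "(\<Sum>r\<in>A. u r *\<^sub>R p r) = (\<Sum>r\<in>{s, t}. u r *\<^sub>R p r)"
    using fin st by (intro sum.mono_neutral_right) (auto simp: u_def)
  also have "\<dots> = 0" using st by (simp add: u_def)
  finally show ?thesis using st by (intro that[of u]) (auto simp: u_def)
qed

text \<open>Homogeneous half-spaces have VC dimension \<open>DIM('e)\<close>; fixing one coordinate of the normal
  vector lowers it by one, which is what makes the packing exponent equal to \<open>d\<close>.\<close>

lemma vc_at_most_halfspaces:
  fixes V :: "'e::euclidean_space set" and y :: "'t \<Rightarrow> 'e"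
  assumes b: "b \<in> Basis" and V: "\<And>v. v \<in> V \<Longrightarrow> v \<bullet> b = c"
  shows "vc_at_most ((\<lambda>v. {t \<in> T. v \<bullet> y t > 0}) ` V) (DIM('e) - 1)"
  unfolding vc_at_most_def
proof (intro allI impI notI)
  fix A assume A: "card A = Suc (DIM('e) - 1)" "shatters ((\<lambda>v. {t \<in> T. v \<bullet> y t > 0}) ` V) A"
  have finA: "finite A" using A(1) by (metis card.infinite nat.distinct(1))
  have sh: "\<exists>v\<in>V. {t \<in> T. v \<bullet> y t > 0} \<inter> A = B" if "B \<subseteq> A" for B
    using A(2) that unfolding shatters_def by simp
  have AT: "A \<subseteq> T" using sh[of A] by auto
  have ex: "\<exists>v\<in>V. \<forall>t\<in>A. v \<bullet> y t > 0 \<longleftrightarrow> t \<in> B" if B: "B \<subseteq> A" for B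
  proof -
    obtain v where v: "v \<in> V" "{t \<in> T. v \<bullet> y t > 0} \<inter> A = B" using sh[OF B] by auto
    have "v \<bullet> y t > 0 \<longleftrightarrow> t \<in> B" if "t \<in> A" for t
      using that AT unfolding v(2)[symmetric] by auto
    then show ?thesis using v(1) by blast
  qed
  \<comment> \<open>On \<open>V\<close> the coordinate along \<open>b\<close> is the constant
    \<open>c\<close>, so a relation between the projections \<open>p t\<close> forces
    \<open>\<Sum>t\<in>A. u t * (v \<bullet> y t)\<close> to have the same value \<open>K\<close>
    for all \<open>v\<close> in \<open>V\<close>.\<close>
  define p where "p t = y t - (y t \<bullet> b) *\<^sub>R b" for t
  have "p ` A \<subseteq> span (Basis - {b})"
  proof clarify
    fix t
    have "p t = (\<Sum>b'\<in>Basis. (y t \<bullet> b') *\<^sub>R b') - (y t \<bullet> b) *\<^sub>R b"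
      by (simp add: p_def euclidean_representation)
    also have "\<dots> = (\<Sum>b'\<in>Basis - {b}. (y t \<bullet> b') *\<^sub>R b')"
      using b by (simp add: sum_diff1)
    also have "\<dots> \<in> span (Basis - {b})"
      by (intro span_sum span_scale span_base)
    finally show "p t \<in> span (Basis - {b})" .
  qed
  moreover have "card (Basis - {b}) < card A"
    using b A(1) by (simp add: card_Diff_singleton)
  ultimately obtain u where u: "\<exists>t\<in>A. u t \<noteq> 0" "(\<Sum>t\<in>A. u t *\<^sub>R p t) = 0"
    using indexed_dependence[OF finA, of p "Basis - {b}"] finite_Basis by blast
  define K where "K = c * (\<Sum>t\<in>A. u t * (y t \<bullet> b))"
  have lin: "(\<Sum>t\<in>A. u t * (v \<bullet> y t)) = K" if "v \<in> V" for v
  proof -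
    have "0 = v \<bullet> (\<Sum>t\<in>A. u t *\<^sub>R p t)" using u by simp
    also have "\<dots> = (\<Sum>t\<in>A. u t * (v \<bullet> y t) - c * (u t * (y t \<bullet> b)))"
      using V[OF that] by (simp add: inner_sum_right p_def inner_diff_right algebra_simps)
    also have "\<dots> = (\<Sum>t\<in>A. u t * (v \<bullet> y t)) - K"
      by (simp add: sum_subtractf K_def sum_distrib_left)
    finally show ?thesis by simp
  qed
  \<comment> \<open>The pattern that is positive exactly where \<open>w\<close> is positive makes
    every summand nonnegative and one of them positive, which a value \<open>L \<le> 0\<close>
    excludes. Applied to \<open>u\<close> or \<open>- u\<close> this covers all cases except
    coefficients of a single sign with \<open>K\<close> of that same sign; there the empty pattern
    gives a sum of the wrong sign.\<close>
  have key: False if w: "\<exists>t\<in>A. w t > 0" and L: "L \<le> 0"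
    and lin': "\<And>v. v \<in> V \<Longrightarrow> (\<Sum>t\<in>A. w t * (v \<bullet> y t)) = L" for w :: "'t \<Rightarrow> real" and L
  proof -
    obtain v where v: "v \<in> V" "\<And>t. t \<in> A \<Longrightarrow> v \<bullet> y t > 0 \<longleftrightarrow> w t > 0"
      using ex[of "{t \<in> A. w t > 0}"] by auto
    have nn: "w t * (v \<bullet> y t) \<ge> 0" if "t \<in> A" for t
      using v(2)[OF that] by (cases "w t > 0") (auto simp: mult_nonpos_nonpos)
    obtain r where r: "r \<in> A" "w r > 0" using w by blast
    then have "0 < w r * (v \<bullet> y r)" using v by simp
    also have "\<dots> \<le> (\<Sum>t\<in>A. w t * (v \<bullet> y t))"
      using r nn finA by (intro member_le_sum) auto
    finally show False using lin'[OF v(1)] L by simp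
  qed
  have neg: "(\<Sum>t\<in>A. - u t * (v \<bullet> y t)) = - K" if "v \<in> V" for v
    using lin[OF that] by (simp add: sum_negf)
  show False
  proof (cases "\<exists>t\<in>A. u t > 0")
    case True
    then show False
    proof (cases "K \<le> 0")
      case True
      then show False using key[OF \<open>\<exists>t\<in>A. u t > 0\<close> _ lin] by blast
    next
      case False
      then have K: "K > 0" by simp
      show False
      proof (cases "\<exists>t\<in>A. u t < 0")
        case True
        then show False using key[of "\<lambda>t. - u t", OF _ _ neg] K by auto
      next
        case False
        obtain v where v: "v \<in> V" "\<And>t. t \<in> A \<Longrightarrow> \<not> v \<bullet> y t > 0" using ex[of "{}"] by auto
        have "(\<Sum>t\<in>A. u t * (v \<bullet> y t)) \<le> 0"
          using False v by (intro sum_nonpos) (auto simp: mult_nonneg_nonpos not_less)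
        then show False using lin[OF v(1)] K by simp
      qed
    qed
  next
    case False
    then have n: "\<exists>t\<in>A. - u t > 0" using u by (metis neg_0_less_iff_less linorder_neqE_linordered_idom)
    show False
    proof (cases "K \<ge> 0")
      case True
      then show False using key[OF n _ neg] by auto
    next
      case False
      obtain v where v: "v \<in> V" "\<And>t. t \<in> A \<Longrightarrow> \<not> v \<bullet> y t > 0" using ex[of "{}"] by auto
      have "(\<Sum>t\<in>A. u t * (v \<bullet> y t)) \<ge> 0"
        using \<open>\<not> (\<exists>t\<in>A. u t > 0)\<close> v by (intro sum_nonneg) (auto simp: mult_nonpos_nonpos not_less)
      then show False using lin[OF v(1)] False by simp
    qed
  qed
qed

text \<open>An interval longer than the grid spacing contains a grid point. The weak inequality on
  the left and the strict one on the right match the test \<open>v \<bullet> y t > 0\<close>, so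
  that the threshold really answers differently at the two ends.\<close>

lemma grid_threshold_between:
  fixes y z :: real
  assumes "R > 0" "- 1 \<le> y" "z \<le> 1" "z - y > 2 / real R"
  obtains k where "k < R" "y \<le> 2 * real k / real R - 1" "2 * real k / real R - 1 < z"
proof -
  define k where "k = nat \<lceil>(y + 1) * real R / 2\<rceil>"
  have nn: "(y + 1) * real R / 2 \<ge> 0" using assms by simp
  have k1: "real k \<ge> (y + 1) * real R / 2" unfolding k_def by linarith
  have k2: "real k < (y + 1) * real R / 2 + 1" unfolding k_def using nn by linarith
  have a: "y \<le> 2 * real k / real R - 1" using k1 assms by (simp add: field_simps)
  have "2 * real k < (y + 1 + 2 / real R) * real R" using k2 assms by (simp add: algebra_simps add_divide_distrib)
  then have b: "2 * real k / real R < y + 1 + 2 / real R" using assms by (simp add: pos_divide_less_eq)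
  then have c: "2 * real k / real R - 1 < z" using assms by linarith
  then have "2 * real k / real R < 2" using assms by linarith
  then have "k < R" using assms by (simp add: field_simps)
  with a c show ?thesis using that by blast
qed

text \<open>The hyperplanes of a grid of mesh \<open>2 / R\<close>, each with multiplicity \<open>n\<close>, are packed together
  with the given hyperplanes, each with multiplicity \<open>R\<close>: a single packing then controls both the
  diameter of a cell and the number of given hyperplanes that cross it.\<close>

lemma chart_net:
  fixes Z :: "'e::euclidean_space set" and x :: "nat \<Rightarrow> 'e"
  assumes b: "b \<in> Basis" and c: "c * c = (1::real)" and R: "R > 0" and n: "n > 0" and Z: "finite Z"
    and chart: "\<And>z. z \<in> Z \<Longrightarrow> z \<bullet> b = c" "\<And>z b'. z \<in> Z \<Longrightarrow> b' \<in> Basis \<Longrightarrow> \<bar>z \<bullet> b'\<bar> \<le> 1"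
  shows "\<exists>J\<subseteq>Z. card J \<le> 2 * (4 * (DIM('e) + 1) * DIM('e) * R) ^ (DIM('e) - 1) \<and>
    (\<forall>z\<in>Z. \<exists>p\<in>J. R * card {i. i < n \<and> (z \<bullet> x i > 0) \<noteq> (p \<bullet> x i > 0)} \<le> n \<and>
        (\<forall>b'\<in>Basis. \<bar>(z - p) \<bullet> b'\<bar> \<le> 2 / real R))"
proof -
  define T :: "((nat \<times> nat) + ('e \<times> nat \<times> nat)) set"
    where "T = ({..<n} \<times> {..<R}) <+> (Basis \<times> {..<R} \<times> {..<n})"
  \<comment> \<open>On the chart, \<open>c * (z \<bullet> b) = 1\<close>, so subtracting a multiple
    of \<open>b\<close> from \<open>b'\<close> turns the affine threshold on the coordinate
    \<open>z \<bullet> b'\<close> into a homogeneous half-space. The last index of each summand type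
    only creates multiplicity.\<close>
  define y :: "((nat \<times> nat) + ('e \<times> nat \<times> nat)) \<Rightarrow> 'e" where
    "y t = (case t of Inl (i, _) \<Rightarrow> x i
       | Inr (b', k, _) \<Rightarrow> b' - ((2 * real k / real R - 1) * c) *\<^sub>R b)" for t
  define D where "D v w = {t \<in> T. (v \<bullet> y t > 0) \<noteq> (w \<bullet> y t > 0)}" for v w
  define sep where "sep J \<longleftrightarrow> (\<forall>v\<in>J. \<forall>w\<in>J. v \<noteq> w \<longrightarrow> n \<le> card (D v w))" for J
  have finT: "finite T" by (simp add: T_def)
  have cardT: "card T = n * R * (DIM('e) + 1)"
    by (simp add: T_def card_Plus card_cartesian_product algebra_simps)
  have Tne: "T \<noteq> {}" using R n by (auto simp: T_def)
  have finD: "finite (D v w)" for v w using finT by (simp add: D_def)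
  have D_sym: "D v w = D w v" for v w by (auto simp: D_def)
  have grid: "z \<bullet> y (Inr (b', k, l)) = z \<bullet> b' - (2 * real k / real R - 1)" if "z \<in> Z" for z b' k l
  proof -
    have "z \<bullet> y (Inr (b', k, l)) = z \<bullet> b' - (2 * real k / real R - 1) * (c * (z \<bullet> b))"
      by (simp add: y_def inner_diff_right)
    then show ?thesis using chart(1)[OF that] c by simp
  qed
  \<comment> \<open>A separated set of maximal cardinality is a net: any further point of
    \<open>Z\<close> has fewer than \<open>n\<close> tests separating it from some member.\<close>
  have "\<exists>J. (J \<subseteq> Z \<and> sep J) \<and> (\<forall>J'. J' \<subseteq> Z \<and> sep J' \<longrightarrow> card J' \<le> card J)"
  proof (rule Lattices_Big.ex_has_greatest_nat)
    show "{} \<subseteq> Z \<and> sep {}" by (simp add: sep_def)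
    show "\<forall>J. J \<subseteq> Z \<and> sep J \<longrightarrow> card J < Suc (card Z)" using Z by (auto simp: less_Suc_eq_le intro: card_mono)
  qed
  then obtain J where J: "J \<subseteq> Z" "sep J" "\<And>J'. J' \<subseteq> Z \<Longrightarrow> sep J' \<Longrightarrow> card J' \<le> card J" by blast
  have finJ: "finite J" using J Z finite_subset by blast
  have "card J \<le> 2 * (4 * (DIM('e) + 1) * DIM('e) * R) ^ (DIM('e) - 1)"
  \<comment> \<open>With \<open>card T = n * R * (DIM('e) + 1)\<close> and separation
    \<open>n\<close>, the number \<open>n\<close> cancels from the required sample size, which
    becomes a constant times \<open>R\<close>.\<close>
  proof (rule haussler_packing[where T = T and \<delta> = n and P = "\<lambda>v t. v \<bullet> y t > 0", OF finJ finT])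
    show "vc_at_most ((\<lambda>v. {t \<in> T. 0 < v \<bullet> y t}) ` J) (DIM('e) - 1)"
      using b chart(1) J(1) by (intro vc_at_most_halfspaces) auto
    show "n \<le> card {t \<in> T. (0 < v \<bullet> y t) \<noteq> (0 < w \<bullet> y t)}" if "v \<in> J" "w \<in> J" "v \<noteq> w" for v w
      using J(2) that unfolding sep_def D_def by blast
    have "4 * card T * (DIM('e) - 1) \<le> 4 * card T * DIM('e)" by (intro mult_left_mono) auto
    then show "4 * card T * (DIM('e) - 1) \<le> 4 * (DIM('e) + 1) * DIM('e) * R * n"
      by (simp add: cardT algebra_simps)
    show "0 < 4 * (DIM('e) + 1) * DIM('e) * R * n" using R n by simp
  qed (rule Tne)
  moreover have "\<exists>p\<in>J. R * card {i. i < n \<and> (z \<bullet> x i > 0) \<noteq> (p \<bullet> x i > 0)} \<le> n \<and>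
        (\<forall>b'\<in>Basis. \<bar>(z - p) \<bullet> b'\<bar> \<le> 2 / real R)" if z: "z \<in> Z" for z
  proof -
    obtain p where p: "p \<in> J" "card (D z p) < n"
    proof (cases "z \<in> J")
      case True
      moreover have "D z z = {}" by (simp add: D_def)
      ultimately show ?thesis using that[of z] n by simp
    next
      case False
      have "\<not> sep (insert z J)"
      proof
        assume "sep (insert z J)"
        then have "card (insert z J) \<le> card J" using J z by auto
        then show False using False finJ by simp
      qed
      then show ?thesis using J(2) that D_sym unfolding sep_def by (metis insert_iff not_le)
    qed
    define I where "I = {i. i < n \<and> (z \<bullet> x i > 0) \<noteq> (p \<bullet> x i > 0)}"
    have "Inl ` (I \<times> {..<R}) \<subseteq> D z p" by (auto simp: I_def D_def T_def y_def)
    then have "card (I \<times> {..<R}) \<le> card (D z p)"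
      using finD by (metis card_image card_mono inj_Inl inj_on_subset subset_UNIV)
    then have 1: "R * card I \<le> n" using p(2) by (simp add: card_cartesian_product mult.commute)
    \<comment> \<open>A single separating grid hyperplane already costs \<open>n\<close> tests, one
      for each copy, and \<open>z\<close> and \<open>p\<close> differ in fewer than
      \<open>n\<close>.\<close>
    have no: "\<not> (w \<bullet> b' \<le> 2 * real k / real R - 1 \<and> 2 * real k / real R - 1 < v \<bullet> b')"
      if "k < R" "b' \<in> Basis" "(v = z \<and> w = p) \<or> (v = p \<and> w = z)" for k b' v w
    proof
      assume "w \<bullet> b' \<le> 2 * real k / real R - 1 \<and> 2 * real k / real R - 1 < v \<bullet> b'"
      then have "(\<lambda>l. Inr (b', k, l)) ` {..<n} \<subseteq> D z p"
        using that z p(1) J(1) by (auto simp: D_def T_def grid subset_iff)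
      then have "card ((\<lambda>l. Inr (b', k, l) :: (nat \<times> nat) + ('e \<times> nat \<times> nat)) ` {..<n}) \<le> card (D z p)"
        using finD by (intro card_mono) auto
      then show False using p(2) by (subst (asm) card_image) (auto simp: inj_on_def)
    qed
    have close: "v \<bullet> b' - w \<bullet> b' \<le> 2 / real R"
      if "b' \<in> Basis" "(v = z \<and> w = p) \<or> (v = p \<and> w = z)" for v w b'
    proof (rule ccontr)
      assume "\<not> v \<bullet> b' - w \<bullet> b' \<le> 2 / real R"
      moreover have "v \<in> Z" "w \<in> Z" using that z p J by auto
      ultimately show False
        using grid_threshold_between[OF R, of "w \<bullet> b'" "v \<bullet> b'"] chart(2)[of v b'] chart(2)[of w b']
          that no[of _ b' w v] no[of _ b' v w] by (smt (verit, best))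
    qed
    have "\<bar>(z - p) \<bullet> b'\<bar> \<le> 2 / real R" if "b' \<in> Basis" for b'
      using close[OF that, of z p] close[OF that, of p z] by (simp add: inner_diff_left abs_le_iff)
    then show ?thesis using 1 p(1) by (auto simp: I_def)
  qed
  ultimately show ?thesis using J(1) by blast
qed

text \<open>Half-spaces are unchanged by positive scaling, so each nonzero vector may be normalised
  to have its largest coordinate equal to 1 or -1. This gives \<open>2 * DIM('e)\<close> charts,
  each covered by a net of one dimension less. Scaling back multiplies the error by the largest
  coordinate, which is at most the norm.\<close>

lemma halfspace_net:
  fixes Z :: "'e::euclidean_space set" and x :: "nat \<Rightarrow> 'e"
  assumes R: "R > 0" and n: "n > 0" and Z: "finite Z" "0 \<notin> Z"
  shows "\<exists>J. finite J \<and> card J \<le> 4 * DIM('e) * (4 * (DIM('e) + 1) * DIM('e) * R) ^ (DIM('e) - 1) \<and>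
    (\<forall>z\<in>Z. \<exists>p\<in>J. R * card {i. i < n \<and> (z \<bullet> x i > 0) \<noteq> (p \<bullet> x i > 0)} \<le> n \<and>
        (\<forall>i. (z \<bullet> x i > 0) \<noteq> (p \<bullet> x i > 0) \<longrightarrow>
           \<bar>z \<bullet> x i\<bar> \<le> norm z * (2 * DIM('e) / real R) * norm (x i)))"
proof -
  define N where "N = 2 * (4 * (DIM('e) + 1) * DIM('e) * R) ^ (DIM('e) - 1)"
  define Y where "Y bc = {z /\<^sub>R \<bar>z \<bullet> fst bc\<bar> | z. z \<in> Z \<and> z \<bullet> fst bc \<noteq> 0 \<and> sgn (z \<bullet> fst bc) = snd bc \<and>
      (\<forall>b'\<in>Basis. \<bar>z \<bullet> b'\<bar> \<le> \<bar>z \<bullet> fst bc\<bar>)}" for bc :: "'e \<times> real"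
  define B where "B = (Basis :: 'e set) \<times> {-1, 1::real}"
  have finB: "finite B" and cardB: "card B = 2 * DIM('e)"
    by (auto simp: B_def card_cartesian_product)
  have "\<forall>bc\<in>B. \<exists>J. J \<subseteq> Y bc \<and> card J \<le> N \<and>
    (\<forall>z\<in>Y bc. \<exists>p\<in>J. R * card {i. i < n \<and> (z \<bullet> x i > 0) \<noteq> (p \<bullet> x i > 0)} \<le> n \<and>
        (\<forall>b'\<in>Basis. \<bar>(z - p) \<bullet> b'\<bar> \<le> 2 / real R))"
  proof
    fix bc assume bc: "bc \<in> B"
    have "finite (Y bc)" unfolding Y_def using Z(1) by simp
    then show "\<exists>J. J \<subseteq> Y bc \<and> card J \<le> N \<and>
      (\<forall>z\<in>Y bc. \<exists>p\<in>J. R * card {i. i < n \<and> (z \<bullet> x i > 0) \<noteq> (p \<bullet> x i > 0)} \<le> n \<and>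
        (\<forall>b'\<in>Basis. \<bar>(z - p) \<bullet> b'\<bar> \<le> 2 / real R))"
      unfolding N_def using bc R n
      by (intro chart_net[of "fst bc" "snd bc"])
        (auto simp: B_def Y_def sgn_real_def field_simps abs_if split: if_splits)
  qed
  from bchoice[OF this] obtain J where J: "\<forall>bc\<in>B. J bc \<subseteq> Y bc \<and> card (J bc) \<le> N \<and>
    (\<forall>z\<in>Y bc. \<exists>p\<in>J bc. R * card {i. i < n \<and> (z \<bullet> x i > 0) \<noteq> (p \<bullet> x i > 0)} \<le> n \<and>
        (\<forall>b'\<in>Basis. \<bar>(z - p) \<bullet> b'\<bar> \<le> 2 / real R))" ..
  have finY: "finite (Y bc)" for bc unfolding Y_def using Z(1) by simp
  have "card (\<Union>(J ` B)) \<le> (\<Sum>bc\<in>B. card (J bc))" by (rule card_UN_le[OF finB])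
  also have "\<dots> \<le> (\<Sum>bc\<in>B. N)" using J by (intro sum_mono) blast
  also have "\<dots> = 2 * DIM('e) * N" using cardB by simp
  finally have card: "card (\<Union>(J ` B)) \<le> 2 * DIM('e) * N" .
  have fin: "finite (\<Union>(J ` B))" using finB J finY by (meson finite_UN finite_subset)
  have "\<exists>p\<in>\<Union>(J ` B). R * card {i. i < n \<and> (z \<bullet> x i > 0) \<noteq> (p \<bullet> x i > 0)} \<le> n \<and>
        (\<forall>i. (z \<bullet> x i > 0) \<noteq> (p \<bullet> x i > 0) \<longrightarrow>
           \<bar>z \<bullet> x i\<bar> \<le> norm z * (2 * DIM('e) / real R) * norm (x i))" if z: "z \<in> Z" for z
  proof -
    have z0: "z \<noteq> 0" using z Z by auto
    obtain b where b: "b \<in> Basis" "\<And>b'. b' \<in> Basis \<Longrightarrow> \<bar>z \<bullet> b'\<bar> \<le> \<bar>z \<bullet> b\<bar>"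
      using obtains_MAX[of "Basis :: 'e set" "\<lambda>b. \<bar>z \<bullet> b\<bar>"]
      by (metis Max_ge finite_Basis finite_imageI image_eqI nonempty_Basis)
    define m where "m = \<bar>z \<bullet> b\<bar>"
    have m: "m > 0"
    proof (rule ccontr)
      assume "\<not> m > 0"
      then have "\<And>b'. b' \<in> Basis \<Longrightarrow> z \<bullet> b' = 0" using b(2) by (force simp: m_def)
      then show False using z0 euclidean_all_zero_iff by blast
    qed
    have mz: "m \<le> norm z" unfolding m_def using b(1) by (rule Basis_le_norm)
    define bc where "bc = (b, sgn (z \<bullet> b))"
    have bc: "bc \<in> B" using b m by (auto simp: bc_def B_def m_def sgn_real_def)
    define y where "y = z /\<^sub>R m"
    have "y \<in> Y bc" unfolding Y_def y_def m_def using z b m by (auto simp: bc_def m_def)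
    then obtain p where p: "p \<in> J bc" "R * card {i. i < n \<and> (y \<bullet> x i > 0) \<noteq> (p \<bullet> x i > 0)} \<le> n"
        "\<And>b'. b' \<in> Basis \<Longrightarrow> \<bar>(y - p) \<bullet> b'\<bar> \<le> 2 / real R"
      using J bc by blast
    have sgn: "y \<bullet> x i > 0 \<longleftrightarrow> z \<bullet> x i > 0" for i using m by (simp add: y_def zero_less_mult_iff)
    have "norm (y - p) \<le> (\<Sum>b'\<in>Basis. \<bar>(y - p) \<bullet> b'\<bar>)" by (rule norm_le_l1)
    also have "\<dots> \<le> DIM('e) * (2 / real R)" using p(3) by (intro sum_bounded_above) auto
    finally have close: "norm (y - p) \<le> 2 * DIM('e) / real R" by (simp add: mult.commute)
    have "\<bar>z \<bullet> x i\<bar> \<le> norm z * (2 * DIM('e) / real R) * norm (x i)"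
      if "(z \<bullet> x i > 0) \<noteq> (p \<bullet> x i > 0)" for i
    proof -
      have "\<bar>z \<bullet> x i\<bar> = m * \<bar>y \<bullet> x i\<bar>" using m by (simp add: y_def abs_mult)
      \<comment> \<open>The hyperplane of \<open>x i\<close> runs between \<open>y\<close> and
        \<open>p\<close>, so the value at \<open>y\<close> is no larger in modulus than the
        difference of the two values.\<close>
      also have "\<bar>y \<bullet> x i\<bar> \<le> \<bar>(y - p) \<bullet> x i\<bar>"
        using that sgn[of i] by (auto simp: inner_diff_left)
      also have "\<dots> \<le> norm (y - p) * norm (x i)" by (rule Cauchy_Schwarz_ineq2)
      also have "\<dots> \<le> (2 * DIM('e) / real R) * norm (x i)" by (intro mult_right_mono close) auto
      finally have "\<bar>z \<bullet> x i\<bar> \<le> m * ((2 * DIM('e) / real R) * norm (x i))" using m by simp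
      also have "\<dots> \<le> norm z * ((2 * DIM('e) / real R) * norm (x i))"
        using mz R by (intro mult_right_mono) auto
      finally show ?thesis by (simp add: mult.assoc)
    qed
    then show ?thesis using p(1,2) bc sgn by (auto intro!: bexI[of _ p])
  qed
  then show ?thesis using fin card
    by (intro exI[of _ "\<Union>(J ` B)"]) (auto simp: N_def)
qed

section \<open>Approximation of finite ReLU combinations\<close>

lemma L2_set_sum_le:
  assumes "finite Z"
  shows "L2_set (\<lambda>i. \<Sum>z\<in>Z. c z * g z i) I \<le> (\<Sum>z\<in>Z. \<bar>c z\<bar> * L2_set (g z) I)"
  using assms
proof (induction Z rule: finite_induct)
  case empty
  then show ?case by (simp add: L2_set_def)
next
  case (insert a Z)
  have "L2_set (\<lambda>i. \<Sum>z\<in>insert a Z. c z * g z i) I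
      \<le> L2_set (\<lambda>i. c a * g a i) I + L2_set (\<lambda>i. \<Sum>z\<in>Z. c z * g z i) I"
    using L2_set_triangle_ineq[of "\<lambda>i. c a * g a i" "\<lambda>i. \<Sum>z\<in>Z. c z * g z i" I] insert by simp
  also have "L2_set (\<lambda>i. c a * g a i) I = \<bar>c a\<bar> * L2_set (g a) I"
    by (simp add: L2_set_def power_mult_distrib sum_distrib_left[symmetric] real_sqrt_mult)
  finally show ?case using insert by simp
qed

lemma L2_set_power2: "(L2_set f I)\<^sup>2 = (\<Sum>i\<in>I. (f i)\<^sup>2)"
  by (simp add: L2_set_def sum_nonneg)

lemma L2_set_le_uniform:
  assumes "\<And>i. i < n \<Longrightarrow> \<bar>u i\<bar> \<le> a" "a \<ge> 0"
  shows "L2_set u {..<n} \<le> sqrt (real n) * a"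
proof -
  have "(\<Sum>i<n. (u i)\<^sup>2) \<le> of_nat (card {..<n}) * a\<^sup>2"
    using assms by (intro sum_bounded_above) (metis abs_ge_zero lessThan_iff power2_abs power_mono)
  then have "L2_set u {..<n} \<le> sqrt (real n * a\<^sup>2)"
    unfolding L2_set_def by (intro real_sqrt_le_mono) simp
  then show ?thesis using assms(2) by (simp add: real_sqrt_mult)
qed

text \<open>Maurey's approximation of a convex combination by \<open>m\<close> of its terms, with the terms chosen
  greedily so that each new error makes an obtuse angle with the accumulated one.\<close>

lemma maurey:
  fixes g :: "'z \<Rightarrow> 'i \<Rightarrow> real"
  assumes Z: "finite Z" "Z \<noteq> {}" and I: "finite I"
    and g: "\<And>z. z \<in> Z \<Longrightarrow> L2_set (g z) I \<le> \<rho>" and c: "(\<Sum>z\<in>Z. \<bar>c z\<bar>) \<le> T"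
  shows "\<exists>w\<in>PiE {..<m} (\<lambda>_. Z \<times> {-1, 1}). L2_set (\<lambda>i. (\<Sum>k<m. T * (snd (w k) * g (fst (w k)) i))
      - real m * (\<Sum>z\<in>Z. c z * g z i)) I \<le> sqrt (real m) * (2 * T * \<rho>)"
proof (induction m)
  case 0
  then show ?case by (simp add: L2_set_def)
next
  case (Suc m)
  define F where "F i = (\<Sum>z\<in>Z. c z * g z i)" for i
  obtain w where w: "w \<in> PiE {..<m} (\<lambda>_. Z \<times> {-1, 1})"
    "L2_set (\<lambda>i. (\<Sum>k<m. T * (snd (w k) * g (fst (w k)) i)) - real m * F i) I \<le> sqrt (real m) * (2 * T * \<rho>)"
    using Suc unfolding F_def by blast
  \<comment> \<open>The error is kept multiplied by the number of terms, so that a step adds one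
    vector \<open>h\<close> to \<open>S\<close> and the squared norms accumulate linearly.\<close>
  define S where "S i = (\<Sum>k<m. T * (snd (w k) * g (fst (w k)) i)) - real m * F i" for i
  define ip where "ip z = (\<Sum>i\<in>I. S i * g z i)" for z
  have T0: "T \<ge> 0" by (rule order_trans[OF sum_nonneg c]) simp
  have \<rho>0: "\<rho> \<ge> 0" using Z g L2_set_nonneg order_trans by (metis ex_in_conv)
  obtain z where z: "z \<in> Z" "\<And>y. y \<in> Z \<Longrightarrow> \<bar>ip y\<bar> \<le> \<bar>ip z\<bar>"
    using obtains_MAX[of Z "\<lambda>z. \<bar>ip z\<bar>"] Z by (metis Max_ge finite_imageI image_eqI)
  \<comment> \<open>The sign makes the new term contribute \<open>- T * \<bar>ip z\<bar>\<close> to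
    the inner product with \<open>S\<close>. As \<open>z\<close> maximises
    \<open>\<bar>ip z\<bar>\<close> and the coefficients have total mass at most \<open>T\<close>,
    subtracting \<open>F\<close> adds at most \<open>T * \<bar>ip z\<bar>\<close>.\<close>
  define e :: real where "e = (if ip z > 0 then -1 else 1)"
  have e: "e \<in> {-1, 1}" "e * ip z = - \<bar>ip z\<bar>" "\<bar>e\<bar> = 1" by (auto simp: e_def)
  define h where "h i = T * (e * g z i) - F i" for i
  have "- (\<Sum>i\<in>I. S i * F i) = (\<Sum>y\<in>Z. - c y * ip y)"
    unfolding F_def ip_def sum_distrib_left sum_negf[symmetric]
    by (subst sum.swap) (simp add: mult_ac)
  also have "\<dots> \<le> (\<Sum>y\<in>Z. \<bar>c y\<bar> * \<bar>ip z\<bar>)"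
  proof (rule sum_mono)
    fix y assume y: "y \<in> Z"
    have "- c y * ip y \<le> \<bar>c y\<bar> * \<bar>ip y\<bar>" by (metis abs_ge_self abs_minus_cancel abs_mult)
    also have "\<dots> \<le> \<bar>c y\<bar> * \<bar>ip z\<bar>" using z(2)[OF y] by (intro mult_left_mono) auto
    finally show "- c y * ip y \<le> \<bar>c y\<bar> * \<bar>ip z\<bar>" .
  qed
  also have "\<dots> \<le> T * \<bar>ip z\<bar>" using c by (simp add: sum_distrib_right[symmetric] mult_right_mono)
  finally have 1: "- (\<Sum>i\<in>I. S i * F i) \<le> T * \<bar>ip z\<bar>" .
  have "(\<Sum>i\<in>I. S i * h i) = T * (e * ip z) - (\<Sum>i\<in>I. S i * F i)"
    unfolding ip_def h_def by (simp add: sum_distrib_left sum_subtractf algebra_simps)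
  with 1 have obtuse: "(\<Sum>i\<in>I. S i * h i) \<le> 0" unfolding e(2) by simp
  have "L2_set h I \<le> L2_set (\<lambda>i. T * (e * g z i)) I + L2_set (\<lambda>i. - F i) I"
    using L2_set_triangle_ineq[of "\<lambda>i. T * (e * g z i)" "\<lambda>i. - F i" I] by (simp add: h_def[abs_def])
  also have "L2_set (\<lambda>i. T * (e * g z i)) I = T * L2_set (g z) I"
    using T0 e(1) by (auto simp: L2_set_def power_mult_distrib sum_distrib_left[symmetric] real_sqrt_mult)
  also have "\<dots> \<le> T * \<rho>" using g z T0 by (intro mult_left_mono) auto
  also have "L2_set (\<lambda>i. - F i) I = L2_set F I" by (simp add: L2_set_def)
  also have "\<dots> \<le> (\<Sum>z\<in>Z. \<bar>c z\<bar> * L2_set (g z) I)"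
    unfolding F_def by (rule L2_set_sum_le[OF Z(1)])
  also have "\<dots> \<le> (\<Sum>z\<in>Z. \<bar>c z\<bar> * \<rho>)" using g by (intro sum_mono mult_left_mono) auto
  also have "\<dots> \<le> T * \<rho>" using c \<rho>0 by (simp add: sum_distrib_right[symmetric] mult_right_mono)
  finally have h: "L2_set h I \<le> 2 * T * \<rho>" by simp
  have "(\<Sum>i\<in>I. (S i + h i)\<^sup>2) = (\<Sum>i\<in>I. (S i)\<^sup>2) + 2 * (\<Sum>i\<in>I. S i * h i) + (\<Sum>i\<in>I. (h i)\<^sup>2)"
    by (simp add: power2_sum sum.distrib sum_distrib_left algebra_simps)
  also have "\<dots> \<le> (L2_set S I)\<^sup>2 + (L2_set h I)\<^sup>2" using obtuse by (simp add: L2_set_power2)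
  also have "\<dots> \<le> (sqrt (real m) * (2 * T * \<rho>))\<^sup>2 + (2 * T * \<rho>)\<^sup>2"
    using w(2) h unfolding S_def by (intro add_mono power_mono L2_set_nonneg)
  also have "\<dots> = (sqrt (real (Suc m)) * (2 * T * \<rho>))\<^sup>2"
    by (simp add: power_mult_distrib algebra_simps)
  finally have "sqrt (\<Sum>i\<in>I. (S i + h i)\<^sup>2) \<le> sqrt (real (Suc m)) * (2 * T * \<rho>)"
    using T0 \<rho>0 by (intro real_le_lsqrt) (auto intro!: sum_nonneg)
  then have fin: "L2_set (\<lambda>i. S i + h i) I \<le> sqrt (real (Suc m)) * (2 * T * \<rho>)"
    by (simp add: L2_set_def)
  define w' where "w' = w(m := (z, e))"
  have "w' \<in> PiE {..<Suc m} (\<lambda>_. Z \<times> {-1, 1})"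
    using w(1) z e unfolding w'_def by (auto simp: PiE_iff extensional_def less_Suc_eq)
  moreover have eq: "(\<Sum>k<Suc m. T * (snd (w' k) * g (fst (w' k)) i)) - real (Suc m) * F i = S i + h i" for i
    by (simp add: w'_def S_def h_def algebra_simps)
  ultimately show ?case using fin unfolding F_def[symmetric] by (intro bexI[of _ w']) (simp_all only: eq)
qed

section \<open>Rounding to a finite lattice\<close>

definition lattice_round :: "nat \<Rightarrow> 'e::euclidean_space \<Rightarrow> 'e" where
  "lattice_round q y = (\<Sum>b\<in>Basis. (of_int \<lfloor>(y \<bullet> b) * real q\<rfloor> / real q) *\<^sub>R b)"

definition lattice_box :: "nat \<Rightarrow> 'e::euclidean_space set" where
  "lattice_box q = (\<lambda>a. \<Sum>b\<in>Basis. (of_int (a b) / real q) *\<^sub>R b) ` PiE Basis (\<lambda>_. {- int q..int q})"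

lemma finite_lattice_box: "finite (lattice_box q)"
  unfolding lattice_box_def by (intro finite_imageI finite_PiE) auto

lemma card_lattice_box: "card (lattice_box q :: 'e::euclidean_space set) \<le> (2 * q + 1) ^ DIM('e)"
proof -
  have "card (lattice_box q :: 'e set) \<le> card (PiE (Basis :: 'e set) (\<lambda>_. {- int q..int q}))"
    unfolding lattice_box_def by (intro card_image_le finite_PiE) auto
  also have "\<dots> = (2 * q + 1) ^ DIM('e)" by (simp add: card_PiE nat_add_distrib nat_mult_distrib)
  finally show ?thesis .
qed

lemma lattice_round_in_box:
  assumes "norm y \<le> 1"
  shows "lattice_round q y \<in> lattice_box q"
proof -
  have "\<lfloor>(y \<bullet> b) * real q\<rfloor> \<in> {- int q..int q}" if "b \<in> Basis" for b
  proof -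
    have "\<bar>y \<bullet> b\<bar> \<le> 1" using Basis_le_norm[OF that, of y] assms by linarith
    then have "\<bar>(y \<bullet> b) * real q\<bar> \<le> 1 * real q" unfolding abs_mult by (intro mult_mono) auto
    then show ?thesis by (auto simp: floor_le_iff le_floor_iff)
  qed
  then show ?thesis unfolding lattice_round_def lattice_box_def
    by (intro image_eqI[of _ _ "restrict (\<lambda>b. \<lfloor>(y \<bullet> b) * real q\<rfloor>) Basis"]) auto
qed

lemma norm_lattice_round_diff:
  fixes y :: "'e::euclidean_space"
  assumes "q > 0"
  shows "norm (y - lattice_round q y) \<le> real DIM('e) / real q"
proof -
  have "norm (y - lattice_round q y) \<le> (\<Sum>b\<in>Basis. \<bar>(y - lattice_round q y) \<bullet> b\<bar>)" by (rule norm_le_l1)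
  also have "\<dots> \<le> of_nat DIM('e) * (1 / real q)"
  proof (rule sum_bounded_above)
    fix b :: 'e assume b: "b \<in> Basis"
    have "(y - lattice_round q y) \<bullet> b = y \<bullet> b - of_int \<lfloor>(y \<bullet> b) * real q\<rfloor> / real q"
      using b by (simp add: inner_diff_left lattice_round_def inner_sum_left inner_Basis if_distrib sum.delta cong: if_cong)
    also have "\<dots> = ((y \<bullet> b) * real q - of_int \<lfloor>(y \<bullet> b) * real q\<rfloor>) / real q"
      using assms by (simp add: field_simps)
    finally have eq: "(y - lattice_round q y) \<bullet> b = ((y \<bullet> b) * real q - of_int \<lfloor>(y \<bullet> b) * real q\<rfloor>) / real q" .
    have "\<bar>(y \<bullet> b) * real q - of_int \<lfloor>(y \<bullet> b) * real q\<rfloor>\<bar> \<le> 1" by linarith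
    then show "\<bar>(y - lattice_round q y) \<bullet> b\<bar> \<le> 1 / real q"
      unfolding eq abs_divide by (simp add: divide_right_mono)
  qed
  finally show ?thesis by simp
qed

text \<open>Each \<open>z\<close> is gated by the sign pattern of its representative. The gated
  terms are linear in \<open>z\<close>, so all \<open>z\<close> of a cell merge into one vector,
  which is rounded to the lattice at a cost of at most \<open>N\<close> lattice points. What the
  gate misses is small and rare, and is approximated by \<open>m\<close> sampled terms at a cost of
  \<open>m\<close> signed elements of \<open>Z\<close>.\<close>

lemma relu_combination_cover:
  fixes x :: "nat \<Rightarrow> 'e::euclidean_space" and Z :: "'e set"
  assumes Z: "finite Z" "Z \<noteq> {}" "0 \<notin> Z" "\<And>z. z \<in> Z \<Longrightarrow> norm z \<le> 2"
    and x: "\<And>i. i < n \<Longrightarrow> norm (x i) \<le> 2"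
    and pos: "n > 0" "R > 0" "m > 0" "q > 0" "T > 0"
    and N: "N = 4 * DIM('e) * (4 * (DIM('e) + 1) * DIM('e) * R) ^ (DIM('e) - 1)"
  shows "\<exists>C. finite C \<and> card C \<le> (2 * card Z) ^ m * ((2 * q + 1) ^ DIM('e)) ^ N \<and>
    (\<forall>c. (\<Sum>z\<in>Z. \<bar>c z\<bar>) \<le> T \<longrightarrow> (\<exists>u\<in>C. L2_set (\<lambda>i. (\<Sum>z\<in>Z. c z * relu (z \<bullet> x i)) - u i) {..<n}
       \<le> sqrt (real n) * (T * (16 * DIM('e) / (R * sqrt R * sqrt m) + 4 * DIM('e) * N / q))))"
proof -
  let ?D = "real DIM('e)"
  obtain J where J: "finite J" "card J \<le> N"
    "\<forall>z\<in>Z. \<exists>p\<in>J. R * card {i. i < n \<and> (z \<bullet> x i > 0) \<noteq> (p \<bullet> x i > 0)} \<le> n \<and>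
        (\<forall>i. (z \<bullet> x i > 0) \<noteq> (p \<bullet> x i > 0) \<longrightarrow> \<bar>z \<bullet> x i\<bar> \<le> norm z * (2 * DIM('e) / real R) * norm (x i))"
    using halfspace_net[OF pos(2,1) Z(1,3), of x] unfolding N by auto
  from bchoice[OF J(3)[unfolded Bex_def]] obtain \<pi> where \<pi>: "\<forall>z\<in>Z. \<pi> z \<in> J \<and>
      R * card {i. i < n \<and> (z \<bullet> x i > 0) \<noteq> (\<pi> z \<bullet> x i > 0)} \<le> n \<and>
      (\<forall>i. (z \<bullet> x i > 0) \<noteq> (\<pi> z \<bullet> x i > 0) \<longrightarrow> \<bar>z \<bullet> x i\<bar> \<le> norm z * (2 * DIM('e) / real R) * norm (x i))"
    by blast
  define g where "g z i = relu (z \<bullet> x i) - (if \<pi> z \<bullet> x i > 0 then z \<bullet> x i else 0)" for z i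
  \<comment> \<open>At most \<open>n / R\<close> indices are crossed, and there the residual is at
    most \<open>2 * (2 * DIM('e) / R) * 2\<close>, with both norms bounded by 2. The square root of
    the fraction \<open>1 / R\<close> gives the extra \<open>sqrt R\<close>.\<close>
  define \<rho> where "\<rho> = sqrt (real n) * (8 * ?D / (real R * sqrt (real R)))"
  have g: "L2_set (g z) {..<n} \<le> \<rho>" if z: "z \<in> Z" for z
  proof -
    define I where "I = {i. i < n \<and> (z \<bullet> x i > 0) \<noteq> (\<pi> z \<bullet> x i > 0)}"
    have g0: "g z i = 0" if "i < n" "i \<notin> I" for i
      using that by (auto simp: g_def I_def relu_def max_def)
    have gI: "(g z i)\<^sup>2 \<le> (8 * ?D / R)\<^sup>2" if i: "i \<in> I" for i
    proof -
      have "\<bar>g z i\<bar> = \<bar>z \<bullet> x i\<bar>" using i by (auto simp: g_def I_def relu_def max_def)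
      also have "\<dots> \<le> norm z * (2 * ?D / real R) * norm (x i)" using \<pi> z i by (auto simp: I_def)
      also have "\<dots> \<le> 2 * (2 * ?D / real R) * 2"
        using Z(4)[OF z] x[of i] i by (intro mult_mono) (auto simp: I_def)
      finally have "\<bar>g z i\<bar> \<le> 8 * ?D / R" by simp
      then show ?thesis by (metis abs_ge_zero power2_abs power_mono)
    qed
    have "(\<Sum>i<n. (g z i)\<^sup>2) = (\<Sum>i\<in>I. (g z i)\<^sup>2)"
      using g0 by (intro sum.mono_neutral_right) (auto simp: I_def)
    also have "\<dots> \<le> real (card I) * (8 * ?D / R)\<^sup>2" using gI by (intro sum_bounded_above) auto
    also have "real (card I) \<le> real n / real R"
    proof -
      have "R * card I \<le> n" using \<pi> z by (auto simp: I_def)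
      then have "real (R * card I) \<le> real n" by (rule of_nat_mono)
      then show ?thesis using pos by (simp add: field_simps)
    qed
    also have "real n / real R * (8 * ?D / R)\<^sup>2 = \<rho>\<^sup>2"
      using pos by (simp add: \<rho>_def power_mult_distrib power_divide field_simps power2_eq_square)
    finally have "(\<Sum>i<n. (g z i)\<^sup>2) \<le> \<rho>\<^sup>2" by (simp add: mult_right_mono)
    then show ?thesis unfolding L2_set_def by (intro real_le_lsqrt) (auto simp: \<rho>_def sum_nonneg)
  qed
  \<comment> \<open>The decoder: a code word is one lattice vector per cell together with the
    \<open>m\<close> sampled signed parameters. A cell vector has norm at most \<open>2 * T\<close>,
    so it is divided by \<open>2 * T\<close> before rounding to fit the lattice box.\<close>
  define \<Phi> where "\<Phi> yw i = (\<Sum>p\<in>J. if p \<bullet> x i > 0 then 2 * T * (fst yw p \<bullet> x i) else 0)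
      + (\<Sum>k<m. T * (snd (snd yw k) * g (fst (snd yw k)) i)) / real m"
    for yw :: "('e \<Rightarrow> 'e) \<times> (nat \<Rightarrow> 'e \<times> real)" and i
  define W where "W = PiE J (\<lambda>_. lattice_box q :: 'e set) \<times> PiE {..<m} (\<lambda>_. Z \<times> {-1, 1::real})"
  have finW: "finite W"
    unfolding W_def using J(1) Z(1) finite_lattice_box by (intro finite_cartesian_product finite_PiE) auto
  have "card (\<Phi> ` W) \<le> card W" by (rule card_image_le[OF finW])
  also have "\<dots> = card (lattice_box q :: 'e set) ^ card J * (2 * card Z) ^ m"
    using J(1) by (simp add: W_def card_cartesian_product card_PiE mult_2 power_mult_distrib[symmetric])
  also have "\<dots> \<le> ((2 * q + 1) ^ DIM('e)) ^ card J * (2 * card Z) ^ m"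
    by (intro mult_right_mono power_mono card_lattice_box) auto
  also have "\<dots> \<le> ((2 * q + 1) ^ DIM('e)) ^ N * (2 * card Z) ^ m"
    using J(2) by (intro mult_right_mono power_increasing) auto
  finally have card: "card (\<Phi> ` W) \<le> (2 * card Z) ^ m * ((2 * q + 1) ^ DIM('e)) ^ N" by (simp add: mult.commute)
  have "\<exists>u\<in>\<Phi> ` W. L2_set (\<lambda>i. (\<Sum>z\<in>Z. c z * relu (z \<bullet> x i)) - u i) {..<n}
       \<le> sqrt (real n) * (T * (16 * DIM('e) / (R * sqrt R * sqrt m) + 4 * DIM('e) * N / q))"
    if c: "(\<Sum>z\<in>Z. \<bar>c z\<bar>) \<le> T" for c
  proof -
    define Y where "Y p = (\<Sum>z | z \<in> Z \<and> \<pi> z = p. c z *\<^sub>R z)" for p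
    define F where "F i = (\<Sum>z\<in>Z. c z * g z i)" for i
    define y where "y = restrict (\<lambda>p. lattice_round q (Y p /\<^sub>R (2 * T))) J"
    obtain w where w: "w \<in> PiE {..<m} (\<lambda>_. Z \<times> {-1, 1})"
      "L2_set (\<lambda>i. (\<Sum>k<m. T * (snd (w k) * g (fst (w k)) i)) - real m * F i) {..<n} \<le> sqrt (real m) * (2 * T * \<rho>)"
      using maurey[OF Z(1,2), of "{..<n}" g \<rho> c T m] g c unfolding F_def by auto
    have Y: "norm (Y p) \<le> 2 * T" for p
    proof -
      have "norm (Y p) \<le> (\<Sum>z | z \<in> Z \<and> \<pi> z = p. \<bar>c z\<bar> * 2)"
        unfolding Y_def using Z(4) by (intro sum_norm_le) (auto intro: mult_left_mono)
      also have "\<dots> \<le> (\<Sum>z\<in>Z. \<bar>c z\<bar> * 2)" using Z(1) by (intro sum_mono2) auto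
      also have "\<dots> \<le> T * 2" using c by (simp add: sum_distrib_right[symmetric])
      finally show ?thesis by simp
    qed
    have "y \<in> PiE J (\<lambda>_. lattice_box q)"
      using Y pos unfolding y_def by (auto intro!: lattice_round_in_box simp: field_simps)
    then have yw: "(y, w) \<in> W" using w(1) by (simp add: W_def)
    define E1 where "E1 i = (\<Sum>p\<in>J. if p \<bullet> x i > 0 then (Y p - (2 * T) *\<^sub>R y p) \<bullet> x i else 0)" for i
    define E2 where "E2 i = ((\<Sum>k<m. T * (snd (w k) * g (fst (w k)) i)) - real m * F i) / real m" for i
    have split: "(\<Sum>z\<in>Z. c z * relu (z \<bullet> x i)) = (\<Sum>p\<in>J. if p \<bullet> x i > 0 then Y p \<bullet> x i else 0) + F i" for i
    proof -
      have "(\<Sum>p\<in>J. if p \<bullet> x i > 0 then Y p \<bullet> x i else 0)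
          = (\<Sum>p\<in>J. \<Sum>z | z \<in> Z \<and> \<pi> z = p. c z * (if \<pi> z \<bullet> x i > 0 then z \<bullet> x i else 0))"
        by (intro sum.cong) (auto simp: Y_def inner_sum_left)
      also have "\<dots> = (\<Sum>z\<in>Z. c z * (if \<pi> z \<bullet> x i > 0 then z \<bullet> x i else 0))"
        using \<pi> by (intro sum.group Z(1) J(1)) auto
      finally show ?thesis by (simp add: F_def g_def sum.distrib[symmetric] algebra_simps)
    qed
    have err: "(\<Sum>z\<in>Z. c z * relu (z \<bullet> x i)) - \<Phi> (y, w) i = E1 i + (- E2 i)" for i
    proof -
      have "(\<Sum>p\<in>J. if p \<bullet> x i > 0 then Y p \<bullet> x i else 0)
          - (\<Sum>p\<in>J. if p \<bullet> x i > 0 then 2 * T * (y p \<bullet> x i) else 0) = E1 i"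
        unfolding E1_def sum_subtractf[symmetric] by (intro sum.cong) (auto simp: inner_diff_left)
      then show ?thesis using pos unfolding split \<Phi>_def E2_def fst_conv snd_conv by (simp add: diff_divide_distrib)
    qed
    have E1: "\<bar>E1 i\<bar> \<le> T * (4 * ?D * N / q)" if i: "i < n" for i
    proof -
      have "\<bar>E1 i\<bar> \<le> of_nat (card J) * (2 * T * (?D / q) * 2)"
        unfolding E1_def
      proof (rule order_trans[OF sum_abs sum_bounded_above])
        fix p assume p: "p \<in> J"
        have "Y p - (2 * T) *\<^sub>R y p = (2 * T) *\<^sub>R (Y p /\<^sub>R (2 * T) - lattice_round q (Y p /\<^sub>R (2 * T)))"
          using p pos by (simp add: y_def scaleR_diff_right)
        then have "norm (Y p - (2 * T) *\<^sub>R y p) \<le> 2 * T * (?D / q)"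
          using norm_lattice_round_diff[OF pos(4), of "Y p /\<^sub>R (2 * T)"] pos
          by (simp del: scaleR_left_diff_distrib scaleR_right_diff_distrib times_divide_eq_right add: mult_left_mono)
        then have "norm (Y p - (2 * T) *\<^sub>R y p) * norm (x i) \<le> 2 * T * (?D / q) * 2"
          using x[OF i] pos by (intro mult_mono) auto
        moreover have "\<bar>(Y p - (2 * T) *\<^sub>R y p) \<bullet> x i\<bar> \<le> norm (Y p - (2 * T) *\<^sub>R y p) * norm (x i)"
          by (rule Cauchy_Schwarz_ineq2)
        ultimately show "\<bar>if p \<bullet> x i > 0 then (Y p - (2 * T) *\<^sub>R y p) \<bullet> x i else 0\<bar> \<le> 2 * T * (?D / q) * 2"
          using pos by (auto intro: order_trans)
      qed
      also have "\<dots> \<le> real N * (2 * T * (?D / q) * 2)" using J(2) pos by (intro mult_right_mono) auto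
      finally show ?thesis by (simp add: mult_ac)
    qed
    have "L2_set E1 {..<n} \<le> sqrt (real n) * (T * (4 * ?D * N / q))"
      using E1 pos by (intro L2_set_le_uniform) auto
    moreover have "L2_set (\<lambda>i. - E2 i) {..<n} \<le> sqrt (real n) * (T * (16 * ?D / (R * sqrt R * sqrt m)))"
    proof -
      have "L2_set (\<lambda>i. - E2 i) {..<n} = L2_set (\<lambda>i. (1 / real m) * ((\<Sum>k<m. T * (snd (w k) * g (fst (w k)) i)) - real m * F i)) {..<n}"
        by (simp add: L2_set_def E2_def)
      also have "\<dots> = (1 / real m) * L2_set (\<lambda>i. (\<Sum>k<m. T * (snd (w k) * g (fst (w k)) i)) - real m * F i) {..<n}"
        by (rule L2_set_right_distrib[symmetric]) simp
      also have "\<dots> \<le> (1 / real m) * (sqrt (real m) * (2 * T * \<rho>))" by (intro mult_left_mono w(2)) simp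
      also have "\<dots> = 2 * T * \<rho> / sqrt m" using pos by (simp add: field_simps)
      finally show ?thesis by (simp add: \<rho>_def mult_ac)
    qed
    ultimately have "L2_set (\<lambda>i. E1 i + (- E2 i)) {..<n}
        \<le> sqrt (real n) * (T * (4 * ?D * N / q)) + sqrt (real n) * (T * (16 * ?D / (R * sqrt R * sqrt m)))"
      using L2_set_triangle_ineq[of E1 "\<lambda>i. - E2 i" "{..<n}"] by linarith
    then show ?thesis unfolding err[symmetric] using yw
      by (intro bexI[of _ "\<Phi> (y, w)"]) (simp_all add: algebra_simps)
  qed
  then show ?thesis using card finW by (intro exI[of _ "\<Phi> ` W"]) auto
qed

section \<open>Metric entropy of the variation space\<close>

lemma relu_lipschitz: "\<bar>relu s - relu t\<bar> \<le> \<bar>s - t\<bar>"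
  by (auto simp: relu_def max_def)

lemma relu_le_abs: "\<bar>relu s\<bar> \<le> \<bar>s\<bar>"
  by (auto simp: relu_def max_def)

lemma measurable_lattice_round [measurable]: "lattice_round q \<in> borel_measurable borel"
  unfolding lattice_round_def[abs_def] by measurable

lemma space_sphere_fin_measure: "sphere_fin_measure \<mu> \<Longrightarrow> space \<mu> = sphere 0 1"
  using sets_eq_imp_space_eq[of \<mu> "restrict_space borel (sphere 0 1)"]
  by (simp add: sphere_fin_measure_def space_restrict_space)

lemma borel_measurable_sphere:
  assumes "sphere_fin_measure \<mu>" "f \<in> borel_measurable borel"
  shows "f \<in> borel_measurable \<mu>"
  using assms unfolding sphere_fin_measure_def
  by (metis measurable_cong_sets measurable_restrict_space1)

lemma norm_Pair_one_le:
  assumes "norm (x::'a::euclidean_space) \<le> 1"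
  shows "norm (x, 1::real) \<le> 2"
  using norm_Pair_le[of x "1::real"] assms by simp

text \<open>The weights \<open>c\<close> are the masses of the push-forward of \<open>\<mu>\<close>
  under \<open>lattice_round q\<close>, so the total mass is preserved. The error is the rounding
  distance times \<open>norm (x, 1) \<le> 2\<close>, as \<open>relu\<close> is 1-Lipschitz.\<close>

lemma relu_net_discretisation:
  fixes \<mu> :: "('a::euclidean_space \<times> real) measure"
  assumes \<mu>: "sphere_fin_measure \<mu>" and q: "q > 0"
    and Z: "finite (Z :: ('a \<times> real) set)" "\<And>v. v \<in> sphere 0 1 \<Longrightarrow> lattice_round q v \<in> Z"
  obtains c where "\<And>z. c z \<ge> 0" "(\<Sum>z\<in>Z. c z) = measure \<mu> (space \<mu>)"
    "\<And>x. norm x \<le> 1 \<Longrightarrow> \<bar>relu_net \<mu> x - (\<Sum>z\<in>Z. c z * relu (z \<bullet> (x, 1)))\<bar>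
       \<le> measure \<mu> (space \<mu>) * (2 * DIM('a \<times> real) / q)"
proof -
  interpret finite_measure \<mu> using \<mu> by (simp add: sphere_fin_measure_def)
  have sp: "space \<mu> = sphere 0 1" using \<mu> by (rule space_sphere_fin_measure)
  let ?r = "lattice_round q :: 'a \<times> real \<Rightarrow> _"
  define A where "A z = {v \<in> space \<mu>. ?r v = z}" for z
  have [measurable]: "?r \<in> borel_measurable \<mu>" by (rule borel_measurable_sphere[OF \<mu>]) measurable
  have A: "A z \<in> sets \<mu>" for z unfolding A_def by measurable
  define c where "c z = measure \<mu> (A z)" for z
  have int: "(\<integral>v. h (?r v) \<partial>\<mu>) = (\<Sum>z\<in>Z. c z * h z)" and intg: "integrable \<mu> (\<lambda>v. h (?r v))"
    for h :: "'a \<times> real \<Rightarrow> real"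
  proof -
    have eq: "h (?r v) = (\<Sum>z\<in>Z. h z * indicator (A z) v)" if "v \<in> space \<mu>" for v
    proof -
      have "(\<Sum>z\<in>Z. h z * indicator (A z) v) = (\<Sum>z\<in>Z. if ?r v = z then h z else 0)"
        using that by (intro sum.cong) (auto simp: A_def)
      also have "\<dots> = h (?r v)" using Z that sp by (simp add: sum.delta')
      finally show ?thesis by simp
    qed
    have i: "integrable \<mu> (\<lambda>v. \<Sum>z\<in>Z. h z * indicator (A z) v)"
      using A by (intro Bochner_Integration.integrable_sum integrable_mult_right)
        (auto simp: emeasure_eq_measure)
    show "integrable \<mu> (\<lambda>v. h (?r v))"
      using i by (subst Bochner_Integration.integrable_cong[OF refl eq]) auto
    have "(\<integral>v. h (?r v) \<partial>\<mu>) = (\<integral>v. (\<Sum>z\<in>Z. h z * indicator (A z) v) \<partial>\<mu>)"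
      by (rule Bochner_Integration.integral_cong[OF refl eq])
    also have "\<dots> = (\<Sum>z\<in>Z. c z * h z)"
      using A by (subst Bochner_Integration.integral_sum)
        (auto simp: emeasure_eq_measure c_def mult.commute intro!: integrable_mult_right)
    finally show "(\<integral>v. h (?r v) \<partial>\<mu>) = (\<Sum>z\<in>Z. c z * h z)" .
  qed
  have "(\<Sum>z\<in>Z. c z) = measure \<mu> (space \<mu>)" using int[of "\<lambda>_. 1"] by simp
  moreover have "\<bar>relu_net \<mu> x - (\<Sum>z\<in>Z. c z * relu (z \<bullet> (x, 1)))\<bar>
       \<le> measure \<mu> (space \<mu>) * (2 * DIM('a \<times> real) / q)" if x: "norm x \<le> 1" for x
  proof -
    define y where "y = (x, 1::real)"
    have y: "norm y \<le> 2" unfolding y_def using x by (rule norm_Pair_one_le)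
    have net: "relu_net \<mu> x = (\<integral>v. relu (v \<bullet> y) \<partial>\<mu>)"
      by (simp add: relu_net_def y_def inner_prod_def)
    have "(\<lambda>v. relu (v \<bullet> y)) \<in> borel_measurable \<mu>"
      by (rule borel_measurable_sphere[OF \<mu>]) (simp add: relu_def)
    then have i1: "integrable \<mu> (\<lambda>v. relu (v \<bullet> y))"
    proof (rule integrable_const_bound[where B = 2, rotated], intro AE_I2)
      fix v assume "v \<in> space \<mu>"
      then have "\<bar>v \<bullet> y\<bar> \<le> 1 * norm y" using Cauchy_Schwarz_ineq2[of v y] sp by simp
      then show "norm (relu (v \<bullet> y)) \<le> 2" using y relu_le_abs[of "v \<bullet> y"] by simp
    qed
    have "\<bar>relu_net \<mu> x - (\<Sum>z\<in>Z. c z * relu (z \<bullet> y))\<bar>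
        = \<bar>\<integral>v. relu (v \<bullet> y) - relu (?r v \<bullet> y) \<partial>\<mu>\<bar>"
      using int[of "\<lambda>z. relu (z \<bullet> y)"] intg[of "\<lambda>z. relu (z \<bullet> y)"] i1 net by simp
    also have "\<dots> \<le> (\<integral>v. \<bar>relu (v \<bullet> y) - relu (?r v \<bullet> y)\<bar> \<partial>\<mu>)" by (rule integral_abs_bound)
    also have "\<dots> \<le> (\<integral>v. 2 * DIM('a \<times> real) / q \<partial>\<mu>)"
    proof (rule integral_mono)
      show "integrable \<mu> (\<lambda>v. \<bar>relu (v \<bullet> y) - relu (?r v \<bullet> y)\<bar>)"
        using i1 intg[of "\<lambda>z. relu (z \<bullet> y)"] by simp
      fix v
      have "\<bar>relu (v \<bullet> y) - relu (?r v \<bullet> y)\<bar> \<le> \<bar>(v - ?r v) \<bullet> y\<bar>"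
        using relu_lipschitz by (simp add: inner_diff_left)
      also have "\<dots> \<le> norm (v - ?r v) * norm y" by (rule Cauchy_Schwarz_ineq2)
      also have "\<dots> \<le> (real DIM('a \<times> real) / real q) * 2"
        using norm_lattice_round_diff[OF q, of v] y by (intro mult_mono) auto
      finally show "\<bar>relu (v \<bullet> y) - relu (?r v \<bullet> y)\<bar> \<le> 2 * DIM('a \<times> real) / q" by (simp add: mult.commute)
    qed simp
    also have "\<dots> = measure \<mu> (space \<mu>) * (2 * DIM('a \<times> real) / q)" by simp
    finally show ?thesis by (simp add: y_def)
  qed
  moreover have "c z \<ge> 0" for z by (simp add: c_def)
  ultimately show ?thesis by (intro that[of c])
qed

text \<open>Doubling the mass avoids any appeal to attainment of the infimum: since
  \<open>M > 0\<close>, \<open>2 * M\<close> lies strictly above it.\<close>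

lemma F_sigma_M_representation:
  assumes f: "f \<in> F_sigma_M M" and M: "M > 0"
  obtains \<mu>p \<mu>n where "represents \<mu>p \<mu>n f" "measure \<mu>p (space \<mu>p) + measure \<mu>n (space \<mu>n) \<le> 2 * M"
proof -
  let ?S = "{measure \<mu>p (space \<mu>p) + measure \<mu>n (space \<mu>n) | \<mu>p \<mu>n. represents \<mu>p \<mu>n f}"
  have "?S \<noteq> {}" using f by (auto simp: F_sigma_M_def F_sigma_def)
  moreover have "Inf ?S < 2 * M" using f M by (simp add: F_sigma_M_def gamma_def)
  ultimately have "\<exists>t\<in>?S. t < 2 * M" by (rule cInf_lessD)
  then obtain \<mu>p \<mu>n where "represents \<mu>p \<mu>n f"
    "measure \<mu>p (space \<mu>p) + measure \<mu>n (space \<mu>n) < 2 * M" by blast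
  then show ?thesis by (intro that[of \<mu>p \<mu>n]) auto
qed

lemma relu_net_bound:
  assumes \<mu>: "sphere_fin_measure \<mu>" and x: "norm x \<le> 1"
  shows "\<bar>relu_net \<mu> x\<bar> \<le> 2 * measure \<mu> (space \<mu>)"
proof -
  interpret finite_measure \<mu> using \<mu> by (simp add: sphere_fin_measure_def)
  have sp: "space \<mu> = sphere 0 1" using \<mu> by (rule space_sphere_fin_measure)
  have net: "relu_net \<mu> x = (\<integral>v. relu (v \<bullet> (x, 1)) \<partial>\<mu>)"
    by (simp add: relu_net_def inner_prod_def)
  have b: "norm (relu (v \<bullet> (x, 1))) \<le> 2" if "v \<in> space \<mu>" for v
  proof -
    have "\<bar>v \<bullet> (x, 1)\<bar> \<le> 1 * norm (x, 1::real)" using Cauchy_Schwarz_ineq2[of v "(x, 1)"] sp that by simp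
    then show ?thesis using norm_Pair_one_le[OF x] relu_le_abs[of "v \<bullet> (x, 1)"] by simp
  qed
  have "(\<lambda>v. relu (v \<bullet> (x, 1))) \<in> borel_measurable \<mu>"
    by (rule borel_measurable_sphere[OF \<mu>]) (simp add: relu_def)
  then have i1: "integrable \<mu> (\<lambda>v. relu (v \<bullet> (x, 1)))"
    using b by (intro integrable_const_bound[where B = 2] AE_I2)
  have "\<bar>relu_net \<mu> x\<bar> \<le> (\<integral>v. \<bar>relu (v \<bullet> (x, 1))\<bar> \<partial>\<mu>)" unfolding net by (rule integral_abs_bound)
  also have "\<dots> \<le> (\<integral>v. 2 \<partial>\<mu>)" using i1 b by (intro integral_mono) auto
  finally show ?thesis by simp
qed

lemma F_sigma_M_bound:
  assumes "f \<in> F_sigma_M M" "M > 0" "norm x \<le> 1"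
  shows "\<bar>f x\<bar> \<le> 4 * M"
proof -
  obtain \<mu>p \<mu>n where \<mu>: "represents \<mu>p \<mu>n f" "measure \<mu>p (space \<mu>p) + measure \<mu>n (space \<mu>n) \<le> 2 * M"
    using F_sigma_M_representation[OF assms(1,2)] .
  then have "f x = relu_net \<mu>p x - relu_net \<mu>n x" "\<bar>relu_net \<mu>p x\<bar> \<le> 2 * measure \<mu>p (space \<mu>p)"
      "\<bar>relu_net \<mu>n x\<bar> \<le> 2 * measure \<mu>n (space \<mu>n)"
    using assms(3) by (auto simp: represents_def dist_norm intro: relu_net_bound)
  then show ?thesis using \<mu>(2) by linarith
qed

text \<open>\<open>R\<close> plays the role of the inverse mesh size: the metric entropy of \<open>S\<close> at radius of order
  \<open>M R powr (-(d+3)/2)\<close> in the empirical norm is of order \<open>R ^ d\<close> up to a logarithm.\<close>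

definition has_entropy :: "real \<Rightarrow> nat \<Rightarrow> nat \<Rightarrow> real \<Rightarrow> (nat \<Rightarrow> real) set \<Rightarrow> bool" where
  "has_entropy A d n M S \<longleftrightarrow> (\<forall>R>0. \<exists>C. finite C \<and> real (card C) \<le> exp (A * real R ^ d * (1 + ln (real R))) \<and>
     (\<forall>f\<in>S. \<exists>u\<in>C. L2_set (\<lambda>i. f i - u i) {..<n} \<le> sqrt (real n) * (A * M / real R powr ((real d + 3) / 2))))"

text \<open>Since \<open>q\<close> is polynomial in \<open>R\<close>, \<open>ln (2 * q + 1)\<close>
  is of order \<open>1 + ln R\<close>. Each of the \<open>R ^ d\<close> sampled terms and each of
  the \<open>N\<close> cells costs about \<open>D\<close> times this logarithm.\<close>

lemma cover_count_bound:
  fixes d D c q N R :: nat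
  assumes "R > 0" "D > 0" "c > 0" and N: "N = c * R ^ d" and q: "q = D * (N + 1) * R ^ (d + 3)"
  shows "real ((2 * (2 * q + 1) ^ D) ^ (R ^ d) * ((2 * q + 1) ^ D) ^ N)
    \<le> exp ((1 + D) * (1 + c) * (ln (6 * D * c) + 2 * d + 3) * real R ^ d * (1 + ln R))"
proof -
  define L where "L = ln (real (2 * q + 1))"
  have R1: "real R \<ge> 1" using assms by simp
  have lnR: "ln R \<ge> 0" using R1 by simp
  have Rd: "R ^ d \<ge> 1" using assms by simp
  have N1: "N + 1 \<le> 2 * (c * R ^ d)" using assms Rd by (simp add: N)
  have q1: "q \<ge> 1" using assms by (simp add: q)
  have "2 * q + 1 \<le> 3 * q" using q1 by simp
  also have "\<dots> \<le> 3 * (D * (2 * (c * R ^ d)) * R ^ (d + 3))"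
    unfolding q by (intro mult_left_mono mult_right_mono N1) auto
  also have "\<dots> = 6 * D * c * R ^ (2 * d + 3)" by (simp add: power_add power_mult power2_eq_square power_mult_distrib)
  finally have "real (2 * q + 1) \<le> real (6 * D * c * R ^ (2 * d + 3))" by (rule of_nat_mono)
  then have "L \<le> ln (real (6 * D * c * R ^ (2 * d + 3)))"
    unfolding L_def by (intro ln_mono) simp_all
  also have "\<dots> = ln (6 * D * c) + (2 * d + 3) * ln R"
    using assms by (simp add: ln_mult ln_realpow)
  also have "\<dots> \<le> (ln (6 * D * c) + 2 * d + 3) * (1 + ln R)"
  proof -
    have "ln (6 * real D * real c) \<ge> 0" using assms by (intro ln_ge_zero) (simp add: Suc_leI less_1_mult' mult_ge1_I)
    then show ?thesis using lnR by (simp add: algebra_simps)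
  qed
  finally have L: "L \<le> (ln (6 * D * c) + 2 * d + 3) * (1 + ln R)" .
  have L0: "L \<ge> ln 3" unfolding L_def using q1 by (subst ln_le_cancel_iff) auto
  moreover have ln23: "ln 2 \<le> ln (3::real)" by simp
  ultimately have L2: "ln 2 \<le> L" by linarith
  have L0': "L \<ge> 0" unfolding L_def by simp
  have "real ((2 * (2 * q + 1) ^ D) ^ (R ^ d) * ((2 * q + 1) ^ D) ^ N)
      = exp (ln (real ((2 * (2 * q + 1) ^ D) ^ (R ^ d) * ((2 * q + 1) ^ D) ^ N)))"
    by (subst exp_ln) auto
  also have "ln (real ((2 * (2 * q + 1) ^ D) ^ (R ^ d) * ((2 * q + 1) ^ D) ^ N))
     = R ^ d * (ln 2 + D * L) + N * (D * L)"
  proof -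
    define Q where "Q = real (2 * q + 1)"
    have Q: "Q > 0" by (simp add: Q_def)
    have "real ((2 * (2 * q + 1) ^ D) ^ (R ^ d) * ((2 * q + 1) ^ D) ^ N) = (2 * Q ^ D) ^ (R ^ d) * (Q ^ D) ^ N"
      unfolding Q_def by (simp del: of_nat_add of_nat_Suc)
    also have "ln \<dots> = R ^ d * (ln 2 + D * ln Q) + N * (D * ln Q)"
      using Q by (simp add: ln_mult ln_realpow distrib_left)
    finally show ?thesis by (simp add: L_def Q_def)
  qed
  also have "\<dots> \<le> R ^ d * (L + D * L) + N * (L + D * L)"
    using L2 L0' by (intro add_mono mult_left_mono) auto
  also have "\<dots> = (1 + D) * (1 + c) * real R ^ d * L" by (simp add: N algebra_simps)
  also have "\<dots> \<le> (1 + D) * (1 + c) * real R ^ d * ((ln (6 * D * c) + 2 * d + 3) * (1 + ln R))"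
    by (intro mult_left_mono L) auto
  finally show ?thesis by (simp add: mult_ac)
qed

text \<open>The factor \<open>R * sqrt R\<close> is the gain in the residuals and
  \<open>sqrt (R ^ d)\<close> the gain from averaging \<open>R ^ d\<close> sampled terms.\<close>

lemma powr_half_exponent:
  assumes "R > 0"
  shows "real R powr ((real d + 3) / 2) = real R * sqrt (real R) * sqrt (real (R ^ d))"
proof -
  have "(real d + 3) / 2 = 1 + 1 / 2 + real d / 2" by (simp add: field_simps)
  then have "real R powr ((real d + 3) / 2) = real R powr (1 + 1 / 2 + real d * (1 / 2))"
    by (intro arg_cong[of _ _ "\<lambda>t. real R powr t"]) simp
  also have "\<dots> = real R powr 1 * real R powr (1/2) * real R powr (real d * (1/2))"
    by (simp only: powr_add)
  also have "real R powr (real d * (1/2)) = sqrt (real (R ^ d))"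
    using assms unfolding powr_powr[symmetric] by (simp add: powr_realpow powr_half_sqrt)
  finally show ?thesis using assms by (simp add: powr_half_sqrt)
qed

lemma F_sigma_M_has_entropy:
  "\<exists>A\<ge>1. \<forall>n (X::nat \<Rightarrow> 'a::euclidean_space) M. n > 0 \<longrightarrow> M > 0 \<longrightarrow> (\<forall>i<n. norm (X i) \<le> 1) \<longrightarrow>
     has_entropy A DIM('a) n M ((\<lambda>f i. f (X i)) ` F_sigma_M M)"
proof -
  define d where "d = DIM('a)"
  define D where "D = DIM('a \<times> real)"
  have D: "D = d + 1" "D > 0" by (simp_all add: D_def d_def)
  define c where "c = 4 * D * (4 * (D + 1) * D) ^ d"
  have c: "c > 0" using D by (simp add: c_def)
  define A1 where "A1 = (1 + D) * (1 + c) * (ln (6 * D * c) + 2 * d + 3)"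
  \<comment> \<open>The outer 2 is the doubled mass, \<open>16 * D\<close> comes from the sampled
    residuals and 4 from all rounding errors together.\<close>
  define A2 where "A2 = 2 * (16 * real D + 4)"
  define A where "A = max A1 A2"
  have A1: "A \<ge> 1" by (simp add: A_def A2_def)
  have main: "\<exists>C. finite C \<and> real (card C) \<le> exp (A * real R ^ d * (1 + ln (real R))) \<and>
     (\<forall>f\<in>(\<lambda>f i. f (X i)) ` F_sigma_M M. \<exists>u\<in>C.
        L2_set (\<lambda>i. f i - u i) {..<n} \<le> sqrt (real n) * (A * M / real R powr ((real d + 3) / 2)))"
    if n: "n > 0" and M: "M > 0" and X: "\<forall>i<n. norm (X i) \<le> 1" and R: "R > 0"
    for n R :: nat and X :: "nat \<Rightarrow> 'a" and M
  proof -
    define N where "N = c * R ^ d"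
    \<comment> \<open>This makes \<open>D * (N + 1) / q\<close> equal to
      \<open>R ^ -(d + 3)\<close>, so the rounding errors of all \<open>N\<close> cells and of the
      parameters stay below the target radius. Such a fine mesh is affordable because it enters the
      entropy only through its logarithm.\<close>
    define q where "q = D * (N + 1) * R ^ (d + 3)"
    have N: "N = 4 * DIM('a \<times> real) * (4 * (DIM('a \<times> real) + 1) * DIM('a \<times> real) * R) ^ (DIM('a \<times> real) - 1)"
      unfolding N_def c_def D_def[symmetric] using D by (simp add: power_mult_distrib)
    have N1: "N \<ge> 1" using c R by (simp add: N_def Suc_le_eq)
    have q: "q > 0" using D R by (simp add: q_def)
    have Dq: "real D / real q \<le> 1 / (2 * real (R ^ (d + 3)))"
    proof -
      have "2 * (D * R ^ (d + 3)) \<le> q" unfolding q_def using N1 by (simp add: algebra_simps)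
      then have "real (2 * (D * R ^ (d + 3))) \<le> real q" by (rule of_nat_mono)
      then show ?thesis using q R by (simp add: field_simps)
    qed
    have "real (R ^ (d + 3)) \<ge> 1" using R by simp
    then have "1 / (2 * real (R ^ (d + 3))) \<le> 1 / (2 * 1)" using R by (intro divide_left_mono mult_left_mono) auto
    with Dq have Dq2: "real D / real q \<le> 1 / 2" by linarith
    \<comment> \<open>The origin has no half-space and is excluded. No rounded unit vector is lost,
      because a rounding error of at most \<open>1 / 2\<close> keeps its norm at least
      \<open>1 / 2\<close>.\<close>
    define Z where "Z = {z \<in> lattice_box q :: ('a \<times> real) set. z \<noteq> 0 \<and> norm z \<le> 2}"
    have Zin: "lattice_round q v \<in> Z" if "v \<in> sphere 0 1" for v
    proof -
      have v: "norm v = 1" using that by simp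
      have "norm (v - lattice_round q v) \<le> 1 / 2"
        using norm_lattice_round_diff[OF q, of v] Dq2 unfolding D_def by (rule order_trans)
      then have "norm (lattice_round q v) \<ge> 1 / 2 \<and> norm (lattice_round q v) \<le> 2"
        using v norm_triangle_ineq2[of v "lattice_round q v"] norm_triangle_ineq3[of v "lattice_round q v"] by linarith
      then show ?thesis using lattice_round_in_box[of v q] v by (auto simp: Z_def)
    qed
    have finZ: "finite Z" unfolding Z_def by (rule finite_subset[OF _ finite_lattice_box[of q]]) auto
    have Zne: "Z \<noteq> {}"
    proof -
      have "(0, 1) \<in> (sphere 0 1 :: ('a \<times> real) set)" by (simp add: norm_Pair)
      then show ?thesis using Zin by blast
    qed
    have "card Z \<le> card (lattice_box q :: ('a \<times> real) set)"
      by (rule card_mono[OF finite_lattice_box]) (auto simp: Z_def)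
    also have "\<dots> \<le> (2 * q + 1) ^ D" unfolding D_def by (rule card_lattice_box)
    finally have cardZ: "card Z \<le> (2 * q + 1) ^ D" .
    obtain C where C: "finite C" "card C \<le> (2 * card Z) ^ (R ^ d) * ((2 * q + 1) ^ D) ^ N"
      "\<And>c. (\<Sum>z\<in>Z. \<bar>c z\<bar>) \<le> 2 * M \<Longrightarrow> \<exists>u\<in>C. L2_set (\<lambda>i. (\<Sum>z\<in>Z. c z * relu (z \<bullet> (X i, 1))) - u i) {..<n}
         \<le> sqrt (real n) * (2 * M * (16 * D / (R * sqrt R * sqrt (R ^ d)) + 4 * D * N / q))"
    proof -
      have "0 \<notin> Z" "\<And>z. z \<in> Z \<Longrightarrow> norm z \<le> 2" by (auto simp: Z_def)
      moreover have "\<And>i. i < n \<Longrightarrow> norm (X i, 1::real) \<le> 2" using X norm_Pair_one_le by blast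
      moreover have "R ^ d > 0" "2 * M > 0" using R M by auto
      ultimately show ?thesis
        using relu_combination_cover[OF finZ Zne _ _ _ n R _ q _ N, of "\<lambda>i. (X i, 1)" "R ^ d" "2 * M"] that
        unfolding D_def[symmetric] by blast
    qed
    have "real (card C) \<le> real ((2 * card Z) ^ (R ^ d) * ((2 * q + 1) ^ D) ^ N)"
      using C(2) by (rule of_nat_mono)
    also have "\<dots> \<le> real ((2 * (2 * q + 1) ^ D) ^ (R ^ d) * ((2 * q + 1) ^ D) ^ N)"
      using cardZ by (intro of_nat_mono mult_right_mono power_mono mult_left_mono) auto
    also have "\<dots> \<le> exp (A1 * real R ^ d * (1 + ln R))"
      unfolding A1_def by (rule cover_count_bound[OF R D(2) c N_def q_def])
    also have "\<dots> \<le> exp (A * real R ^ d * (1 + ln R))"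
      using R by (simp add: A_def mult_right_mono)
    finally have card: "real (card C) \<le> exp (A * real R ^ d * (1 + ln R))" .
    have "\<exists>u\<in>C. L2_set (\<lambda>i. f (X i) - u i) {..<n} \<le> sqrt (real n) * (A * M / real R powr ((real d + 3) / 2))"
      if f: "f \<in> F_sigma_M M" for f
    proof -
      obtain \<mu>p \<mu>n where \<mu>: "represents \<mu>p \<mu>n f" "measure \<mu>p (space \<mu>p) + measure \<mu>n (space \<mu>n) \<le> 2 * M"
        using F_sigma_M_representation[OF f M] .
      have sp: "sphere_fin_measure \<mu>p" and sn: "sphere_fin_measure \<mu>n" using \<mu>(1) by (auto simp: represents_def)
      obtain cp where cp: "\<And>z. cp z \<ge> 0" "(\<Sum>z\<in>Z. cp z) = measure \<mu>p (space \<mu>p)"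
        "\<And>x. norm x \<le> 1 \<Longrightarrow> \<bar>relu_net \<mu>p x - (\<Sum>z\<in>Z. cp z * relu (z \<bullet> (x, 1)))\<bar>
           \<le> measure \<mu>p (space \<mu>p) * (2 * D / q)"
        using relu_net_discretisation[OF sp q finZ Zin] unfolding D_def by blast
      obtain cn where cn: "\<And>z. cn z \<ge> 0" "(\<Sum>z\<in>Z. cn z) = measure \<mu>n (space \<mu>n)"
        "\<And>x. norm x \<le> 1 \<Longrightarrow> \<bar>relu_net \<mu>n x - (\<Sum>z\<in>Z. cn z * relu (z \<bullet> (x, 1)))\<bar>
           \<le> measure \<mu>n (space \<mu>n) * (2 * D / q)"
        using relu_net_discretisation[OF sn q finZ Zin] unfolding D_def by blast
      define e where "e z = cp z - cn z" for z
      have "(\<Sum>z\<in>Z. \<bar>e z\<bar>) \<le> (\<Sum>z\<in>Z. cp z + cn z)"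
      proof (rule sum_mono)
        fix z
        show "\<bar>e z\<bar> \<le> cp z + cn z" using cp(1)[of z] cn(1)[of z] unfolding e_def by linarith
      qed
      then have "(\<Sum>z\<in>Z. \<bar>e z\<bar>) \<le> 2 * M" using \<mu>(2) cp(2) cn(2) by (simp add: sum.distrib)
      from C(3)[OF this] obtain u where u: "u \<in> C" "L2_set (\<lambda>i. (\<Sum>z\<in>Z. e z * relu (z \<bullet> (X i, 1))) - u i) {..<n}
         \<le> sqrt (real n) * (2 * M * (16 * D / (R * sqrt R * sqrt (R ^ d)) + 4 * D * N / q))" by blast
      define h where "h i = f (X i) - (\<Sum>z\<in>Z. e z * relu (z \<bullet> (X i, 1)))" for i
      have "\<bar>h i\<bar> \<le> 2 * M * (4 * D / q)" if i: "i < n" for i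
      proof -
        have Xi: "norm (X i) \<le> 1" using X i by simp
        then have "f (X i) = relu_net \<mu>p (X i) - relu_net \<mu>n (X i)"
          using \<mu>(1) by (auto simp: represents_def)
        then have "h i = (relu_net \<mu>p (X i) - (\<Sum>z\<in>Z. cp z * relu (z \<bullet> (X i, 1))))
            - (relu_net \<mu>n (X i) - (\<Sum>z\<in>Z. cn z * relu (z \<bullet> (X i, 1))))"
          by (simp add: h_def e_def left_diff_distrib sum_subtractf)
        then have "\<bar>h i\<bar> \<le> (measure \<mu>p (space \<mu>p) + measure \<mu>n (space \<mu>n)) * (2 * D / q)"
          using cp(3)[OF Xi] cn(3)[OF Xi] unfolding distrib_right by linarith
        also have "\<dots> \<le> 2 * M * (2 * D / q)" using \<mu>(2) by (intro mult_right_mono) auto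
        \<comment> \<open>Enlarging 2 to 4 lets this error merge with \<open>4 * D * N / q\<close>
          into a multiple of \<open>D * (N + 1) / q\<close>.\<close>
        also have "\<dots> \<le> 2 * M * (4 * D / q)" using M by (intro mult_left_mono divide_right_mono) auto
        finally show ?thesis .
      qed
      then have h: "L2_set h {..<n} \<le> sqrt (real n) * (2 * M * (4 * D / q))"
        using M by (intro L2_set_le_uniform) auto
      define H where "H = real R * sqrt R * sqrt (R ^ d)"
      have H: "H = real R powr ((real d + 3) / 2)" unfolding H_def using powr_half_exponent[OF R, of d] by simp
      have R1: "real R \<ge> 1" using R by simp
      have H0: "H > 0" using R by (simp add: H_def)
      have "H \<le> real R powr (real d + 3)" unfolding H using R1 by (intro powr_mono) auto
      also have "\<dots> = real R ^ (d + 3)" using R by (simp add: powr_realpow[symmetric])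
      finally have HR: "1 / real R ^ (d + 3) \<le> 1 / H" using H0 R by (intro divide_left_mono) auto
      have "L2_set (\<lambda>i. f (X i) - u i) {..<n}
          \<le> L2_set h {..<n} + L2_set (\<lambda>i. (\<Sum>z\<in>Z. e z * relu (z \<bullet> (X i, 1))) - u i) {..<n}"
        using L2_set_triangle_ineq[of h "\<lambda>i. (\<Sum>z\<in>Z. e z * relu (z \<bullet> (X i, 1))) - u i" "{..<n}"]
        by (simp add: h_def)
      also have "\<dots> \<le> sqrt (real n) * (2 * M * (4 * D / q))
          + sqrt (real n) * (2 * M * (16 * D / H + 4 * D * N / q))"
        using h u(2) unfolding H_def by (intro add_mono) auto
      also have "\<dots> = sqrt (real n) * (2 * M * (16 * D / H + 4 * (D * (N + 1) / q)))"
        using q by (simp add: field_simps)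
      also have "real (D * (N + 1)) / real q = 1 / real R ^ (d + 3)"
      proof -
        define k where "k = D * (N + 1)"
        have "k > 0" "real q = real k * real R ^ (d + 3)" using D(2) by (simp_all add: q_def k_def)
        then show ?thesis unfolding k_def[symmetric] by simp
      qed
      also have "sqrt (real n) * (2 * M * (16 * D / H + 4 * (1 / real R ^ (d + 3))))
          \<le> sqrt (real n) * (2 * M * (16 * D / H + 4 * (1 / H)))"
        using HR M by (intro mult_left_mono add_left_mono) auto
      also have "\<dots> = sqrt (real n) * (A2 * M / H)" by (simp add: A2_def algebra_simps add_divide_distrib)
      also have "\<dots> \<le> sqrt (real n) * (A * M / H)"
        using M H0 by (intro mult_left_mono divide_right_mono mult_right_mono) (auto simp: A_def)
      finally show ?thesis using u(1) unfolding H by blast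
    qed
    then show ?thesis using C(1) card by blast
  qed
  then show ?thesis unfolding has_entropy_def d_def[symmetric] using A1 by (intro exI[of _ A]) blast
qed

lemma truncation_lipschitz:
  fixes s t B :: real
  assumes "B > 0"
  shows "\<bar>(if \<bar>s\<bar> \<le> B then s else sgn s * B) - (if \<bar>t\<bar> \<le> B then t else sgn t * B)\<bar> \<le> \<bar>s - t\<bar>"
  using assms by (auto simp: sgn_real_def abs_if split: if_splits)

text \<open>Truncation and multiplication by a fixed factor in \<open>[0, 1]\<close> do not increase
  distances, so the old centres can be reused after truncation; only the factor itself has to be
  discretised. Steps of \<open>1 / R ^ (d + 3)\<close> suffice and add a logarithm to the entropy.
  The error of the factor is measured against \<open>4 * M\<close> and not against \<open>B\<close>,
  so the constant does not involve \<open>B\<close>.\<close>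

lemma star_trunc_has_entropy:
  assumes S: "has_entropy A d n M ((\<lambda>f i. f (X i)) ` F)" and M: "M > 0" and B: "B > 0"
    and bound: "\<And>f i. f \<in> F \<Longrightarrow> i < n \<Longrightarrow> \<bar>f (X i)\<bar> \<le> 4 * M"
  shows "has_entropy (A + d + 4) d n M ((\<lambda>f i. f (X i)) ` star (trunc_class B F))"
  unfolding has_entropy_def
proof (intro allI impI)
  fix R :: nat assume R: "R > 0"
  let ?r = "real R powr ((real d + 3) / 2)"
  define tr :: "real \<Rightarrow> real" where "tr t = (if \<bar>t\<bar> \<le> B then t else sgn t * B)" for t
  have tr_lip: "\<bar>tr s - tr t\<bar> \<le> \<bar>s - t\<bar>" for s t
    unfolding tr_def by (rule truncation_lipschitz[OF B])
  have tr_le: "\<bar>tr t\<bar> \<le> \<bar>t\<bar>" for t using tr_lip[of t 0] B by (simp add: tr_def)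
  obtain C where C: "finite C" "real (card C) \<le> exp (A * real R ^ d * (1 + ln (real R)))"
    and C_cover: "\<forall>f\<in>(\<lambda>f i. f (X i)) ` F. \<exists>u\<in>C. L2_set (\<lambda>i. f i - u i) {..<n} \<le> sqrt (real n) * (A * M / ?r)"
    using S[unfolded has_entropy_def, rule_format, OF R] by (elim exE conjE)
  define G where "G = R ^ (d + 3)"
  have G: "G > 0" using R by (simp add: G_def)
  define C' where "C' = (\<lambda>(k, u) i. (real k / real G) * tr (u i)) ` ({..G} \<times> C)"
  have fin: "finite C'" using C(1) by (simp add: C'_def)
  have R1: "real R \<ge> 1" using R by simp
  have lnR: "ln (real R) \<ge> 0" using R1 by simp
  have "card C' \<le> card ({..G} \<times> C)" unfolding C'_def using C(1) by (intro card_image_le) auto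
  also have "\<dots> = (G + 1) * card C" by (simp add: card_cartesian_product)
  finally have "real (card C') \<le> real ((G + 1) * card C)" by (rule of_nat_mono)
  also have "\<dots> = real (G + 1) * real (card C)" by (rule of_nat_mult)
  also have "\<dots> \<le> exp ((d + 4) * real R ^ d * (1 + ln R)) * exp (A * real R ^ d * (1 + ln (real R)))"
  proof (intro mult_mono C(2))
    have "real (G + 1) \<le> 2 * real G" using G by simp
    also have "\<dots> = exp (ln (2 * real G))" using G by (subst exp_ln) auto
    also have "ln (2 * real G) = ln 2 + (d + 3) * ln R" using R by (simp add: G_def ln_mult ln_realpow)
    also have "\<dots> \<le> (d + 4) * 1 * (1 + ln R)"
    proof -
      have "ln 2 \<le> (1::real)" using ln_le_minus_one[of 2] by simp
      moreover have "(d + 4) * 1 * (1 + ln R) = real d + 4 + (d + 3) * ln R + ln R" by (simp add: algebra_simps)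
      ultimately show ?thesis using lnR by linarith
    qed
    also have "\<dots> \<le> (d + 4) * real R ^ d * (1 + ln R)"
      using lnR R1 by (intro mult_right_mono mult_left_mono) auto
    finally show "real (G + 1) \<le> exp ((d + 4) * real R ^ d * (1 + ln R))" by simp
  qed auto
  also have "\<dots> = exp ((A + d + 4) * real R ^ d * (1 + ln R))"
    by (simp add: exp_add[symmetric] algebra_simps)
  finally have card: "real (card C') \<le> exp ((A + d + 4) * real R ^ d * (1 + ln R))" .
  have "\<exists>u\<in>C'. L2_set (\<lambda>i. h i - u i) {..<n} \<le> sqrt (real n) * ((A + d + 4) * M / ?r)"
    if "h \<in> (\<lambda>f i. f (X i)) ` star (trunc_class B F)" for h
  proof -
    from that obtain a f where af: "a \<in> {0..1}" "f \<in> F" and h: "\<And>i. h i = a * tr (f (X i))"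
      by (auto simp: star_def trunc_class_def truncB_def tr_def)
    obtain u where u: "u \<in> C" "L2_set (\<lambda>i. f (X i) - u i) {..<n} \<le> sqrt (real n) * (A * M / ?r)"
      using bspec[OF C_cover imageI[OF af(2)]] by (elim bexE)
    define k where "k = nat \<lfloor>a * real G\<rfloor>"
    have aG: "0 \<le> a * real G" "a * real G \<le> real G" using af(1) by (auto simp: mult_left_le_one_le)
    have k: "real k \<le> a * real G" "a * real G \<le> real k + 1" using aG unfolding k_def by linarith+
    have kG: "k \<le> G" using k(1) aG by linarith
    have ka: "0 \<le> real k / real G" "real k / real G \<le> 1" using kG G by auto
    have "a - real k / real G = (a * real G - real k) / real G" using G by (simp add: field_simps)
    moreover have "\<bar>a * real G - real k\<bar> \<le> 1" using k by linarith
    ultimately have ka3: "\<bar>a - real k / real G\<bar> \<le> 1 / real G" by (simp add: divide_right_mono)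
    define v where "v i = (real k / real G) * tr (u i)" for i
    have v: "v \<in> C'" unfolding C'_def v_def[abs_def] using kG u(1) by (intro image_eqI[of _ _ "(k, u)"]) auto
    define e1 where "e1 i = (a - real k / real G) * tr (f (X i))" for i
    define e2 where "e2 i = (real k / real G) * (tr (f (X i)) - tr (u i))" for i
    have eq: "h i - v i = e1 i + e2 i" for i by (simp add: h v_def e1_def e2_def algebra_simps)
    have "L2_set e1 {..<n} \<le> sqrt (real n) * (1 / real G * (4 * M))"
    proof (rule L2_set_le_uniform)
      fix i assume "i < n"
      then have "\<bar>tr (f (X i))\<bar> \<le> 4 * M" using tr_le bound[OF af(2)] order_trans by blast
      then show "\<bar>e1 i\<bar> \<le> 1 / real G * (4 * M)" unfolding e1_def abs_mult using ka3 by (intro mult_mono) auto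
    qed (use M in auto)
    also have "1 / real G \<le> 1 / ?r"
    proof -
      have "?r \<le> real R powr (real d + 3)" using R1 by (intro powr_mono) auto
      also have "\<dots> = real G" using R by (simp add: G_def powr_realpow[symmetric])
      finally show ?thesis using R G by (intro divide_left_mono) auto
    qed
    finally have e1: "L2_set e1 {..<n} \<le> sqrt (real n) * (1 / ?r * (4 * M))"
      using M by (simp add: mult_left_mono mult_right_mono)
    have "L2_set e2 {..<n} = L2_set (\<lambda>i. \<bar>e2 i\<bar>) {..<n}" by (simp add: L2_set_def)
    also have "\<dots> \<le> L2_set (\<lambda>i. \<bar>f (X i) - u i\<bar>) {..<n}"
    proof (rule L2_set_mono)
      fix i
      have "\<bar>e2 i\<bar> \<le> 1 * \<bar>tr (f (X i)) - tr (u i)\<bar>"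
        unfolding e2_def abs_mult using ka by (intro mult_right_mono) auto
      also have "\<dots> \<le> \<bar>f (X i) - u i\<bar>" unfolding mult_1 by (rule tr_lip)
      finally show "\<bar>e2 i\<bar> \<le> \<bar>f (X i) - u i\<bar>" .
    qed auto
    also have "\<dots> = L2_set (\<lambda>i. f (X i) - u i) {..<n}" by (simp add: L2_set_def)
    finally have e2: "L2_set e2 {..<n} \<le> sqrt (real n) * (A * M / ?r)" using u(2) by linarith
    have "L2_set (\<lambda>i. h i - v i) {..<n} \<le> sqrt (real n) * (1 / ?r * (4 * M)) + sqrt (real n) * (A * M / ?r)"
      unfolding eq using L2_set_triangle_ineq[of e1 e2 "{..<n}"] e1 e2 by linarith
    also have "\<dots> = sqrt (real n) * ((A + 4) * M / ?r)" by (simp add: algebra_simps add_divide_distrib)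
    also have "\<dots> \<le> sqrt (real n) * ((A + d + 4) * M / ?r)"
      using M by (intro mult_left_mono divide_right_mono mult_right_mono) auto
    finally show ?thesis using v by blast
  qed
  then show "\<exists>C. finite C \<and> real (card C) \<le> exp ((A + d + 4) * real R ^ d * (1 + ln (real R))) \<and>
     (\<forall>f\<in>(\<lambda>f i. f (X i)) ` star (trunc_class B F). \<exists>u\<in>C.
        L2_set (\<lambda>i. f i - u i) {..<n} \<le> sqrt (real n) * ((A + d + 4) * M / ?r))"
    using fin card by blast
qed

section \<open>Chaining\<close>

lemma PiM_coordinate_measurable:
  assumes "\<forall>i<n. subgaussian_law s (Q i)" "i < (n::nat)"
  shows "(\<lambda>\<omega>. \<omega> i) \<in> borel_measurable (PiM {..<n} Q)"
proof -
  have "(\<lambda>\<omega>. \<omega> i) \<in> measurable (PiM {..<n} Q) (Q i)"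
    using assms by (intro measurable_component_singleton) auto
  moreover have "sets (Q i) = sets borel" using assms by (auto simp: subgaussian_law_def)
  ultimately show ?thesis by (simp cong: measurable_cong_sets)
qed

lemma PiM_linear_form_measurable:
  fixes n :: nat
  assumes "\<forall>i<n. subgaussian_law s (Q i)"
  shows "(\<lambda>\<omega>. \<Sum>i<n. \<omega> i * a i :: real) \<in> borel_measurable (PiM {..<n} Q)"
  using PiM_coordinate_measurable[OF assms]
  by (intro borel_measurable_sum borel_measurable_times) auto

lemma prob_space_PiM_subgaussian:
  fixes n :: nat
  assumes "\<forall>i<n. subgaussian_law s (Q i)"
  shows "prob_space (PiM {..<n} Q)"
  using assms by (intro prob_space_PiM) (auto simp: subgaussian_law_def)

lemma subgaussian_linear_form_mgf:
  fixes n :: nat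
  assumes Q: "\<forall>i<n. subgaussian_law s (Q i)"
  shows "(\<integral>\<^sup>+ \<omega>. ennreal (exp (\<Sum>i<n. \<omega> i * a i)) \<partial>PiM {..<n} Q)
    \<le> ennreal (exp (s\<^sup>2 / 2 * (\<Sum>i<n. (a i)\<^sup>2)))"
proof -
  \<comment> \<open>The locale of product probability spaces wants a probability measure at every
    index, so \<open>Q\<close> is replaced outside \<open>{..<n}\<close> by a point mass.\<close>
  define Q' where "Q' i = (if i < n then Q i else return borel 0)" for i
  have prob: "prob_space (Q' i)" for i
    using Q by (auto simp: Q'_def subgaussian_law_def prob_space_return)
  have setsQ: "sets (Q' i) = sets borel" for i
    using Q by (auto simp: Q'_def subgaussian_law_def)
  interpret product_prob_space Q' "{..<n}"
    using prob by (auto simp: product_prob_space_def product_prob_space_axioms_def product_sigma_finite_def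
        intro: prob_space_imp_sigma_finite)
  have "PiM {..<n} Q = PiM {..<n} Q'" by (intro PiM_cong) (auto simp: Q'_def)
  then have "(\<integral>\<^sup>+ \<omega>. ennreal (exp (\<Sum>i<n. \<omega> i * a i)) \<partial>PiM {..<n} Q)
      = (\<integral>\<^sup>+ \<omega>. (\<Prod>i<n. ennreal (exp (\<omega> i * a i))) \<partial>PiM {..<n} Q')"
    by (simp only: exp_sum finite_lessThan prod_ennreal exp_ge_zero)
  also have "\<dots> = (\<Prod>i<n. \<integral>\<^sup>+ t. ennreal (exp (t * a i)) \<partial>Q' i)"
    by (intro product_nn_integral_prod) (auto simp: measurable_cong_sets[OF setsQ refl])
  also have "\<dots> \<le> (\<Prod>i<n. ennreal (exp (s\<^sup>2 * (a i)\<^sup>2 / 2)))"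
  proof (intro prod_mono_ennreal)
    fix i assume "i \<in> {..<n}"
    then have q: "subgaussian_law s (Q i)" "Q' i = Q i" using Q by (auto simp: Q'_def)
    then have "(\<integral>\<^sup>+ t. ennreal (exp (t * a i)) \<partial>Q' i) = ennreal (\<integral>t. exp (a i * t) \<partial>Q i)"
      by (subst nn_integral_eq_integral) (auto simp: subgaussian_law_def mult.commute)
    also have "\<dots> \<le> ennreal (exp (s\<^sup>2 * (a i)\<^sup>2 / 2))"
      using q by (intro ennreal_leI) (auto simp: subgaussian_law_def)
    finally show "(\<integral>\<^sup>+ t. ennreal (exp (t * a i)) \<partial>Q' i) \<le> ennreal (exp (s\<^sup>2 * (a i)\<^sup>2 / 2))" .
  qed
  also have "\<dots> = ennreal (exp (s\<^sup>2 / 2 * (\<Sum>i<n. (a i)\<^sup>2)))"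
    by (simp add: prod_ennreal exp_sum[symmetric] sum_distrib_left)
  finally show ?thesis .
qed

lemma exp_abs_le: "exp \<bar>y::real\<bar> \<le> exp y + exp (- y)"
  by (cases "y \<ge> 0") auto

text \<open>The elementary bound \<open>y \<le> ln K + exp y / K\<close> replaces Jensen's inequality.\<close>

lemma subgaussian_maximal_inequality:
  fixes n :: nat
  assumes Q: "\<forall>i<n. subgaussian_law s (Q i)" and s: "s > 0" and r: "r > 0"
    and A: "finite A" "\<And>a. a \<in> A \<Longrightarrow> L2_set a {..<n} \<le> r"
    and l: "l \<ge> 1" "2 * real (card A) \<le> exp l"
  shows "(\<integral>\<^sup>+ \<omega>. (SUP a\<in>A. ennreal \<bar>\<Sum>i<n. \<omega> i * a i\<bar>) \<partial>PiM {..<n} Q) \<le> ennreal (3 * s * r * sqrt l)"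
proof -
  let ?P = "PiM {..<n} Q"
  interpret prob_space ?P by (rule prob_space_PiM_subgaussian[OF Q])
  define \<theta> where "\<theta> = sqrt l / (s * r)"
  have \<theta>: "\<theta> > 0" using s r l by (simp add: \<theta>_def)
  have \<theta>sr: "(\<theta> * s * r)\<^sup>2 = l" using s r l by (simp add: \<theta>_def)
  \<comment> \<open>The part \<open>exp l\<close> pays for the \<open>2 * card A\<close>
    exponentials of the union and \<open>exp (l / 2)\<close> for the moment bound of each, which
    \<open>\<theta>\<close> is tuned to produce.\<close>
  define K where "K = exp (l + l / 2)"
  define Y where "Y a \<omega> = (\<Sum>i<n. \<omega> i * a i)" for a \<omega> :: "nat \<Rightarrow> real"
  have mY: "Y a \<in> borel_measurable ?P" for a
    unfolding Y_def[abs_def] by (rule PiM_linear_form_measurable[OF Q])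
  define E where "E a \<omega> = ennreal (exp (\<theta> * Y a \<omega>)) + ennreal (exp (- (\<theta> * Y a \<omega>)))" for a \<omega>
  have mE: "E a \<in> borel_measurable ?P" for a unfolding E_def[abs_def] using mY by measurable
  have pt: "(SUP a\<in>A. ennreal \<bar>Y a \<omega>\<bar>) \<le> ennreal (3 / 2 * l / \<theta>) + ennreal (1 / (K * \<theta>)) * (\<Sum>a\<in>A. E a \<omega>)" for \<omega>
  proof (rule SUP_least)
    fix a assume a: "a \<in> A"
    let ?y = "\<theta> * \<bar>Y a \<omega>\<bar>"
    have "1 + (?y - (l + l / 2)) \<le> exp (?y - (l + l / 2))" by (rule exp_ge_add_one_self)
    then have "?y \<le> 3 / 2 * l + exp ?y / K" by (simp add: K_def exp_diff)
    also have "exp ?y \<le> exp (\<theta> * Y a \<omega>) + exp (- (\<theta> * Y a \<omega>))"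
      using exp_abs_le[of "\<theta> * Y a \<omega>"] \<theta> by (simp add: abs_mult)
    finally have "?y \<le> 3 / 2 * l + (exp (\<theta> * Y a \<omega>) + exp (- (\<theta> * Y a \<omega>))) / K"
      by (simp add: K_def divide_right_mono)
    then have "\<bar>Y a \<omega>\<bar> \<le> (3 / 2 * l + (exp (\<theta> * Y a \<omega>) + exp (- (\<theta> * Y a \<omega>))) / K) / \<theta>"
      using \<theta> by (simp add: pos_le_divide_eq mult.commute)
    also have "\<dots> = 3 / 2 * l / \<theta> + 1 / (K * \<theta>) * (exp (\<theta> * Y a \<omega>) + exp (- (\<theta> * Y a \<omega>)))"
      by (simp add: add_divide_distrib)
    finally have "ennreal \<bar>Y a \<omega>\<bar> \<le> ennreal (3 / 2 * l / \<theta> + 1 / (K * \<theta>) * (exp (\<theta> * Y a \<omega>) + exp (- (\<theta> * Y a \<omega>))))"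
      by (rule ennreal_leI)
    also have "\<dots> = ennreal (3 / 2 * l / \<theta>) + ennreal (1 / (K * \<theta>) * (exp (\<theta> * Y a \<omega>) + exp (- (\<theta> * Y a \<omega>))))"
      using \<theta> l by (intro ennreal_plus) (auto simp: K_def)
    also have "ennreal (1 / (K * \<theta>) * (exp (\<theta> * Y a \<omega>) + exp (- (\<theta> * Y a \<omega>)))) = ennreal (1 / (K * \<theta>)) * E a \<omega>"
      unfolding E_def using \<theta> by (subst ennreal_mult) (auto simp: K_def)
    also have "ennreal (3 / 2 * l / \<theta>) + ennreal (1 / (K * \<theta>)) * E a \<omega>
        \<le> ennreal (3 / 2 * l / \<theta>) + ennreal (1 / (K * \<theta>)) * (\<Sum>a\<in>A. E a \<omega>)"
      using A(1) a by (intro add_left_mono mult_left_mono member_le_sum) auto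
    finally show "ennreal \<bar>Y a \<omega>\<bar> \<le> ennreal (3 / 2 * l / \<theta>) + ennreal (1 / (K * \<theta>)) * (\<Sum>a\<in>A. E a \<omega>)" .
  qed
  have EE: "(\<integral>\<^sup>+ \<omega>. E a \<omega> \<partial>?P) \<le> ennreal (2 * exp (l / 2))" if a: "a \<in> A" for a
  proof -
    have half: "(\<integral>\<^sup>+ \<omega>. ennreal (exp (t * Y a \<omega>)) \<partial>?P) \<le> ennreal (exp (l / 2))" if "t\<^sup>2 = \<theta>\<^sup>2" for t
    proof -
      have "(\<integral>\<^sup>+ \<omega>. ennreal (exp (t * Y a \<omega>)) \<partial>?P) = (\<integral>\<^sup>+ \<omega>. ennreal (exp (\<Sum>i<n. \<omega> i * (t * a i))) \<partial>?P)"
        by (simp add: Y_def sum_distrib_left mult_ac)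
      also have "\<dots> \<le> ennreal (exp (s\<^sup>2 / 2 * (\<Sum>i<n. (t * a i)\<^sup>2)))" by (rule subgaussian_linear_form_mgf[OF Q])
      also have "\<dots> \<le> ennreal (exp (l / 2))"
      proof -
        have "(\<Sum>i<n. (t * a i)\<^sup>2) = \<theta>\<^sup>2 * (L2_set a {..<n})\<^sup>2"
          by (simp add: power_mult_distrib sum_distrib_left[symmetric] L2_set_power2 that)
        also have "\<dots> \<le> \<theta>\<^sup>2 * r\<^sup>2" using A(2)[OF a] by (intro mult_left_mono power_mono) auto
        finally have "s\<^sup>2 / 2 * (\<Sum>i<n. (t * a i)\<^sup>2) \<le> s\<^sup>2 / 2 * (\<theta>\<^sup>2 * r\<^sup>2)" by (intro mult_left_mono) auto
        also have "\<dots> = l / 2" unfolding \<theta>sr[symmetric] by (simp add: power_mult_distrib)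
        finally show ?thesis by (intro ennreal_leI) simp
      qed
      finally show ?thesis .
    qed
    have "(\<integral>\<^sup>+ \<omega>. E a \<omega> \<partial>?P) = (\<integral>\<^sup>+ \<omega>. ennreal (exp (\<theta> * Y a \<omega>)) \<partial>?P) + (\<integral>\<^sup>+ \<omega>. ennreal (exp ((- \<theta>) * Y a \<omega>)) \<partial>?P)"
      unfolding E_def using mY by (subst nn_integral_add) auto
    also have "\<dots> \<le> ennreal (exp (l / 2)) + ennreal (exp (l / 2))" by (intro add_mono half) auto
    also have "\<dots> = ennreal (2 * exp (l / 2))" by (simp add: ennreal_plus[symmetric] del: ennreal_plus)
    finally show ?thesis .
  qed
  have "(\<integral>\<^sup>+ \<omega>. (SUP a\<in>A. ennreal \<bar>Y a \<omega>\<bar>) \<partial>?P)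
      \<le> (\<integral>\<^sup>+ \<omega>. ennreal (3 / 2 * l / \<theta>) + ennreal (1 / (K * \<theta>)) * (\<Sum>a\<in>A. E a \<omega>) \<partial>?P)"
    by (intro nn_integral_mono pt)
  also have "\<dots> = ennreal (3 / 2 * l / \<theta>) + ennreal (1 / (K * \<theta>)) * (\<Sum>a\<in>A. \<integral>\<^sup>+ \<omega>. E a \<omega> \<partial>?P)"
    using mE by (simp add: nn_integral_add nn_integral_cmult nn_integral_sum emeasure_space_1)
  also have "\<dots> \<le> ennreal (3 / 2 * l / \<theta>) + ennreal (1 / (K * \<theta>)) * (\<Sum>a\<in>A. ennreal (2 * exp (l / 2)))"
    by (intro add_left_mono mult_left_mono sum_mono EE) auto
  also have "(\<Sum>a\<in>A. ennreal (2 * exp (l / 2))) = ennreal (real (card A) * (2 * exp (l / 2)))"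
    by (simp add: ennreal_of_nat_eq_real_of_nat ennreal_mult)
  also have "ennreal (3 / 2 * l / \<theta>) + ennreal (1 / (K * \<theta>)) * ennreal (real (card A) * (2 * exp (l / 2)))
      = ennreal (3 / 2 * l / \<theta> + 1 / (K * \<theta>) * (real (card A) * (2 * exp (l / 2))))"
    using \<theta> l by (simp add: ennreal_plus[symmetric] ennreal_mult[symmetric] K_def del: ennreal_plus)
  also have "\<dots> \<le> ennreal (3 * s * r * sqrt l)"
  proof (rule ennreal_leI)
    have "real (card A) * (2 * exp (l / 2)) = 2 * real (card A) * exp (l / 2)" by simp
    also have "\<dots> \<le> exp l * exp (l / 2)" by (intro mult_right_mono l) auto
    also have "\<dots> = K" by (simp only: K_def exp_add)
    finally have "1 / (K * \<theta>) * (real (card A) * (2 * exp (l / 2))) \<le> 1 / (K * \<theta>) * K"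
      using \<theta> by (intro mult_left_mono) (auto simp: K_def)
    also have "\<dots> = 1 / \<theta>" by (simp add: K_def)
    also have "\<dots> \<le> l / \<theta>" using l \<theta> by (intro divide_right_mono) auto
    finally have "3 / 2 * l / \<theta> + 1 / (K * \<theta>) * (real (card A) * (2 * exp (l / 2))) \<le> 5 / 2 * (l / \<theta>)" by simp
    also have "\<dots> \<le> 3 * (l / \<theta>)" using l \<theta> by (intro mult_right_mono) auto
    also have "l / \<theta> = s * r * (l / sqrt l)" by (simp add: \<theta>_def)
    also have "l / sqrt l = sqrt l" using l by (intro real_div_sqrt) simp
    finally show "3 / 2 * l / \<theta> + 1 / (K * \<theta>) * (real (card A) * (2 * exp (l / 2))) \<le> 3 * s * r * sqrt l" by simp
  qed
  finally show ?thesis by (simp add: Y_def)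
qed

lemma L2_set_PiM_measurable:
  fixes n :: nat
  assumes "\<forall>i<n. subgaussian_law s (Q i)"
  shows "(\<lambda>\<omega>. L2_set \<omega> {..<n}) \<in> borel_measurable (PiM {..<n} Q)"
  unfolding L2_set_def using PiM_coordinate_measurable[OF assms] by auto

text \<open>Second moments are read off the exponential moments at \<open>1 / s\<close> and
  \<open>- 1 / s\<close> through \<open>y\<^sup>2 / 2 \<le> exp \<bar>y\<bar>\<close>. The square
  root is avoided by \<open>2 * t * y \<le> t\<^sup>2 + y\<^sup>2\<close> with
  \<open>t = s * sqrt n\<close>, the expected order of the norm; this gives
  \<open>t / 2 + 4 * t\<close>.\<close>

lemma subgaussian_expected_norm:
  fixes n :: nat
  assumes Q: "\<forall>i<n. subgaussian_law s (Q i)" and s: "s > 0" and n: "n > 0"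
  shows "(\<integral>\<^sup>+ \<omega>. ennreal (L2_set \<omega> {..<n}) \<partial>PiM {..<n} Q) \<le> ennreal (5 * s * sqrt (real n))"
proof -
  let ?P = "PiM {..<n} Q"
  interpret prob_space ?P by (rule prob_space_PiM_subgaussian[OF Q])
  define E where "E i \<omega> = ennreal (exp (\<omega> i / s)) + ennreal (exp (- (\<omega> i / s)))" for i and \<omega> :: "nat \<Rightarrow> real"
  have mE: "E i \<in> borel_measurable ?P" if "i < n" for i
    unfolding E_def[abs_def] using PiM_coordinate_measurable[OF Q that] by measurable
  define t where "t = s * sqrt (real n)"
  have t: "t > 0" using s n by (simp add: t_def)
  have pt: "ennreal (L2_set \<omega> {..<n}) \<le> ennreal (t / 2) + ennreal (s\<^sup>2 / t) * (\<Sum>i<n. E i \<omega>)" for \<omega>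
  proof -
    have sq: "(\<omega> i)\<^sup>2 \<le> 2 * s\<^sup>2 * (exp (\<omega> i / s) + exp (- (\<omega> i / s)))" for i
    proof -
      have "1 + \<bar>\<omega> i / s\<bar> + \<bar>\<omega> i / s\<bar>\<^sup>2 / 2 \<le> exp \<bar>\<omega> i / s\<bar>" by (rule exp_lower_Taylor_quadratic) simp
      then have "(\<omega> i / s)\<^sup>2 \<le> 2 * exp \<bar>\<omega> i / s\<bar>" using abs_ge_zero[of "\<omega> i / s"] by (simp only: power2_abs)
      also have "\<dots> \<le> 2 * (exp (\<omega> i / s) + exp (- (\<omega> i / s)))" using exp_abs_le[of "\<omega> i / s"] by simp
      finally show ?thesis using s by (simp add: power_divide pos_divide_le_eq algebra_simps)
    qed
    have "0 \<le> (L2_set \<omega> {..<n} - t)\<^sup>2" by simp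
    then have "2 * t * L2_set \<omega> {..<n} \<le> t\<^sup>2 + (L2_set \<omega> {..<n})\<^sup>2" by (simp add: power2_diff mult_ac)
    also have "\<dots> \<le> t\<^sup>2 + (\<Sum>i<n. 2 * s\<^sup>2 * (exp (\<omega> i / s) + exp (- (\<omega> i / s))))"
      unfolding L2_set_power2 by (intro add_left_mono sum_mono sq)
    also have "\<dots> = 2 * t * (t / 2 + s\<^sup>2 / t * (\<Sum>i<n. exp (\<omega> i / s) + exp (- (\<omega> i / s))))"
      unfolding sum_distrib_left[symmetric] using t by (simp add: distrib_left power2_eq_square)
    finally have "L2_set \<omega> {..<n} \<le> t / 2 + s\<^sup>2 / t * (\<Sum>i<n. exp (\<omega> i / s) + exp (- (\<omega> i / s)))"
      using t by simp
    then have "ennreal (L2_set \<omega> {..<n}) \<le> ennreal (t / 2 + s\<^sup>2 / t * (\<Sum>i<n. exp (\<omega> i / s) + exp (- (\<omega> i / s))))"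
      by (rule ennreal_leI)
    also have "\<dots> = ennreal (t / 2) + ennreal (s\<^sup>2 / t) * (\<Sum>i<n. E i \<omega>)"
    proof -
      have "(\<Sum>i<n. E i \<omega>) = ennreal (\<Sum>i<n. exp (\<omega> i / s) + exp (- (\<omega> i / s)))"
        unfolding E_def by (subst sum_ennreal[symmetric]) (auto simp: ennreal_plus[symmetric] add_nonneg_nonneg simp del: ennreal_plus)
      then show ?thesis using t
        by (simp add: ennreal_plus[symmetric] ennreal_mult[symmetric] sum_nonneg del: ennreal_plus)
    qed
    finally show ?thesis .
  qed
  have EE: "(\<integral>\<^sup>+ \<omega>. E j \<omega> \<partial>?P) \<le> ennreal 4" if j: "j < n" for j
  proof -
    have half: "(\<integral>\<^sup>+ \<omega>. ennreal (exp (\<omega> j * c)) \<partial>?P) \<le> ennreal 2" if c: "c\<^sup>2 = 1 / s\<^sup>2" for c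
    proof -
      have "(\<integral>\<^sup>+ \<omega>. ennreal (exp (\<omega> j * c)) \<partial>?P)
          = (\<integral>\<^sup>+ \<omega>. ennreal (exp (\<Sum>i<n. \<omega> i * (if i = j then c else 0))) \<partial>?P)"
        using j by (simp add: if_distrib[of "\<lambda>t. _ * t"] sum.delta cong: if_cong)
      also have "\<dots> \<le> ennreal (exp (s\<^sup>2 / 2 * (\<Sum>i<n. (if i = j then c else 0)\<^sup>2)))"
        by (rule subgaussian_linear_form_mgf[OF Q])
      also have "(\<Sum>i<n. (if i = j then c else 0)\<^sup>2) = c\<^sup>2"
        using j by (simp add: if_distrib[of "\<lambda>t. t\<^sup>2"] sum.delta cong: if_cong)
      also have "s\<^sup>2 / 2 * c\<^sup>2 = 1 / 2" using s by (simp add: c)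
      also have "exp (1 / 2 :: real) \<le> 2"
        using exp_bound_half[of "1/2::real"] by simp
      finally show ?thesis by (simp add: ennreal_leI)
    qed
    have m: "(\<lambda>\<omega>. \<omega> j) \<in> borel_measurable ?P" by (rule PiM_coordinate_measurable[OF Q j])
    have "(\<integral>\<^sup>+ \<omega>. E j \<omega> \<partial>?P) = (\<integral>\<^sup>+ \<omega>. ennreal (exp (\<omega> j * (1 / s))) \<partial>?P) + (\<integral>\<^sup>+ \<omega>. ennreal (exp (\<omega> j * (- 1 / s))) \<partial>?P)"
      unfolding E_def using m by (subst nn_integral_add) auto
    also have "\<dots> \<le> ennreal 2 + ennreal 2" by (intro add_mono half) (auto simp: power_divide)
    finally show ?thesis by (simp add: ennreal_plus[symmetric] del: ennreal_plus)
  qed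
  have "(\<integral>\<^sup>+ \<omega>. ennreal (L2_set \<omega> {..<n}) \<partial>?P)
      \<le> (\<integral>\<^sup>+ \<omega>. ennreal (t / 2) + ennreal (s\<^sup>2 / t) * (\<Sum>i<n. E i \<omega>) \<partial>?P)"
    by (intro nn_integral_mono pt)
  also have "\<dots> = ennreal (t / 2) + ennreal (s\<^sup>2 / t) * (\<Sum>i<n. \<integral>\<^sup>+ \<omega>. E i \<omega> \<partial>?P)"
  proof -
    have "(\<integral>\<^sup>+ \<omega>. (\<Sum>i<n. E i \<omega>) \<partial>?P) = (\<Sum>i<n. \<integral>\<^sup>+ \<omega>. E i \<omega> \<partial>?P)"
      using mE by (intro nn_integral_sum) auto
    then show ?thesis using mE by (simp add: nn_integral_add nn_integral_cmult emeasure_space_1)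
  qed
  also have "\<dots> \<le> ennreal (t / 2) + ennreal (s\<^sup>2 / t) * (\<Sum>i<n. ennreal 4)"
    using EE by (intro add_left_mono mult_left_mono sum_mono) auto
  also have "(\<Sum>i<n. ennreal 4) = ennreal (real n * 4)"
    by (simp add: ennreal_of_nat_eq_real_of_nat ennreal_mult)
  also have "ennreal (t / 2) + ennreal (s\<^sup>2 / t) * ennreal (real n * 4) = ennreal (t / 2 + s\<^sup>2 / t * (real n * 4))"
    using t by (simp add: ennreal_plus[symmetric] ennreal_mult[symmetric] del: ennreal_plus)
  also have "s\<^sup>2 / t * (real n * 4) = 4 * t"
    using s n by (simp add: t_def field_simps power2_eq_square)
  also have "t / 2 + 4 * t \<le> 5 * s * sqrt (real n)" using t by (simp add: t_def)
  finally show ?thesis by (simp add: ennreal_leI)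
qed

text \<open>The starting scale of the chain. \<open>W\<close> is the claimed rate without noise
  level, sample size and logarithm; both the initial term \<open>\<delta> * sqrt (R ^ d)\<close> and
  the first link \<open>M / (R * sqrt R)\<close> are of this order once the covering radius at
  \<open>R\<close> has dropped to about \<open>\<delta>\<close>.\<close>

lemma chaining_constants:
  fixes A M \<delta> :: real and d :: nat
  assumes A: "A \<ge> 1" and \<delta>: "0 < \<delta>" "\<delta> \<le> M"
  defines "W \<equiv> \<delta> powr (3 / (real d + 3)) * M powr (real d / (real d + 3))"
  obtains R where "R > 0" "A * M / real R powr ((real d + 3) / 2) \<le> \<delta>"
    "\<delta> * sqrt (real (R ^ d)) \<le> sqrt (2 ^ d) * A * W"
    "A * M / (real R * sqrt (real R)) \<le> A * W" "\<delta> \<le> W"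
    "real R \<le> 2 * A * (M / \<delta>)"
proof -
  define x where "x = A * M / \<delta>"
  have M: "M > 0" using \<delta> by simp
  have Md: "M / \<delta> \<ge> 1" using \<delta> by simp
  have x1: "x \<ge> 1" using mult_mono[OF A Md] A \<delta> by (simp add: x_def)
  \<comment> \<open>The real solution of \<open>A * M / t powr ((d + 3) / 2) = \<delta>\<close>. It
    is at least 1, so rounding it up at most doubles it, whence the factor
    \<open>sqrt (2 ^ d)\<close>.\<close>
  define t where "t = x powr (2 / (real d + 3))"
  have t1: "t \<ge> 1" using x1 by (simp add: t_def ge_one_powr_ge_zero)
  define R where "R = nat \<lceil>t\<rceil>"
  have Rt: "real R \<ge> t" "real R \<le> 2 * t" using t1 unfolding R_def by linarith+
  have R: "R > 0" using Rt t1 by linarith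
  have tx: "t powr ((real d + 3) / 2) = x"
  proof -
    have eq: "2 / (real d + 3) * ((real d + 3) / 2) = 1" by (simp add: divide_simps)
    show ?thesis using x1 by (simp only: t_def powr_powr eq) simp
  qed
  have "x \<le> real R powr ((real d + 3) / 2)"
    unfolding tx[symmetric] using Rt t1 by (intro powr_mono2) auto
  then have 1: "A * M / real R powr ((real d + 3) / 2) \<le> \<delta>"
    using \<delta> R by (simp add: x_def field_simps)
  have W: "W = \<delta> * (M / \<delta>) powr (real d / (real d + 3))"
  proof -
    have "\<delta> * (M / \<delta>) powr (real d / (real d + 3)) = \<delta> powr 1 * (M powr (real d / (real d + 3)) / \<delta> powr (real d / (real d + 3)))"
      using \<delta> by (simp add: powr_divide)
    also have "\<dots> = \<delta> powr (1 - real d / (real d + 3)) * M powr (real d / (real d + 3))"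
      by (simp add: powr_diff)
    also have "1 - real d / (real d + 3) = 3 / (real d + 3)" by (simp add: field_simps)
    finally show ?thesis by (simp add: W_def)
  qed
  have W': "W = M * (M / \<delta>) powr (- 3 / (real d + 3))"
  proof -
    have "M * (M / \<delta>) powr (- 3 / (real d + 3)) = \<delta> * ((M / \<delta>) powr 1 * (M / \<delta>) powr (- 3 / (real d + 3)))"
      using \<delta> by simp
    also have "\<dots> = \<delta> * (M / \<delta>) powr (1 + (- 3 / (real d + 3)))" by (simp only: powr_add)
    also have "1 + (- 3 / (real d + 3)) = real d / (real d + 3)" by (simp add: field_simps)
    finally show ?thesis by (simp add: W)
  qed
  have 5: "\<delta> \<le> W" unfolding W using \<delta> ge_one_powr_ge_zero[OF Md, of "real d / (real d + 3)"] by simp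
  have 3: "\<delta> * sqrt (real (R ^ d)) \<le> sqrt (2 ^ d) * A * W"
  proof -
    have "real (R ^ d) \<le> (2 * t) ^ d" unfolding of_nat_power using Rt by (intro power_mono) auto
    then have "sqrt (real (R ^ d)) \<le> sqrt ((2 * t) ^ d)" by (rule real_sqrt_le_mono)
    also have "\<dots> = sqrt (2 ^ d) * sqrt (t ^ d)" by (simp add: power_mult_distrib real_sqrt_mult)
    also have "sqrt (t ^ d) = x powr (real d / (real d + 3))"
    proof -
      have "sqrt (t ^ d) = (t powr real d) powr (1 / 2)" using t1 by (simp add: powr_realpow powr_half_sqrt)
      also have "\<dots> = x powr (2 / (real d + 3) * real d * (1 / 2))" by (simp only: t_def powr_powr)
      also have "2 / (real d + 3) * real d * (1 / 2) = real d / (real d + 3)" by (simp add: divide_simps)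
      finally show ?thesis .
    qed
    also have "\<dots> = A powr (real d / (real d + 3)) * (M / \<delta>) powr (real d / (real d + 3))"
      using A \<delta> by (simp add: x_def powr_mult[symmetric])
    also have "\<dots> \<le> A powr 1 * (M / \<delta>) powr (real d / (real d + 3))"
      using A by (intro mult_right_mono powr_mono) auto
    finally have "sqrt (real (R ^ d)) \<le> sqrt (2 ^ d) * (A * (M / \<delta>) powr (real d / (real d + 3)))"
      using A by (simp add: mult_left_mono)
    then have "\<delta> * sqrt (real (R ^ d)) \<le> \<delta> * (sqrt (2 ^ d) * (A * (M / \<delta>) powr (real d / (real d + 3))))"
      using \<delta> by (intro mult_left_mono) auto
    then show ?thesis by (simp add: W mult_ac)
  qed
  have 4: "A * M / (real R * sqrt (real R)) \<le> A * W"
  proof -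
    have "3 / (real d + 3) = 2 / (real d + 3) * (1 + 1 / 2)" by (simp add: divide_simps)
    then have "x powr (3 / (real d + 3)) = t powr (1 + 1 / 2)" by (simp only: t_def powr_powr)
    also have "\<dots> = t powr 1 * t powr (1 / 2)" by (rule powr_add)
    also have "\<dots> = t * sqrt t" using t1 by (simp add: powr_half_sqrt)
    also have "\<dots> \<le> real R * sqrt (real R)" using Rt t1 by (intro mult_mono) auto
    finally have a: "x powr (3 / (real d + 3)) \<le> real R * sqrt (real R)" .
    have "M / \<delta> \<le> x" using A Md \<delta> by (simp add: x_def divide_right_mono)
    then have "(M / \<delta>) powr (3 / (real d + 3)) \<le> x powr (3 / (real d + 3))"
      using Md by (intro powr_mono2) auto
    with a have "(M / \<delta>) powr (3 / (real d + 3)) \<le> real R * sqrt (real R)" by linarith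
    then have "A * M / (real R * sqrt (real R)) \<le> A * M / (M / \<delta>) powr (3 / (real d + 3))"
      using A \<delta> R by (intro divide_left_mono mult_pos_pos) auto
    also have "\<dots> = A * W" unfolding W' by (simp add: powr_minus_divide)
    finally show ?thesis .
  qed
  have 6: "real R \<le> 2 * A * (M / \<delta>)"
  proof -
    have "t \<le> x powr 1" unfolding t_def using x1 by (intro powr_mono) auto
    then show ?thesis using Rt x1 by (simp add: x_def)
  qed
  show ?thesis by (rule that[OF R 1 3 4 5 6])
qed

text \<open>Along the dyadic scales \<open>R k\<close>, a link has norm of order \<open>r k\<close>
  and root entropy of order \<open>sqrt (R k ^ d)\<close> up to the logarithm. The product is of
  order \<open>R k\<close> to the power \<open>-3/2\<close>, so the links sum geometrically and the
  logarithm is bounded uniformly over the finitely many scales.\<close>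

lemma chaining_bound:
  fixes A M \<delta> s :: real and n d :: nat
  assumes A: "A \<ge> 1" and \<delta>: "0 < \<delta>" "\<delta> \<le> M" and n: "n \<ge> 2" and s: "s > 0"
    and Q: "\<forall>i<n. subgaussian_law s (Q i)" and S: "has_entropy A d n M S"
  defines "B \<equiv> 2 + 2 * A * ((1 + ln 4 + ln A) / ln 2 + 1)"
  shows "(\<integral>\<^sup>+ \<omega>. (SUP f\<in>{f \<in> S. L2_set f {..<n} \<le> sqrt (real n) * \<delta>}.
            ennreal \<bar>(1 / real n) * (\<Sum>i<n. \<omega> i * f i)\<bar>) \<partial>PiM {..<n} Q)
     \<le> ennreal ((18 * sqrt (2 ^ d) * A * sqrt B + 10) * rate d n s \<delta> M)"
proof -
  let ?P = "PiM {..<n} Q"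
  define W where "W = \<delta> powr (3 / (real d + 3)) * M powr (real d / (real d + 3))"
  define L where "L = ln (real n * M / \<delta>)"
  have M: "M > 0" using \<delta> by simp
  have Md: "M / \<delta> \<ge> 1" using \<delta> by simp
  have "real n * (M / \<delta>) \<ge> 2 * 1" using n Md by (intro mult_mono) auto
  then have nM: "real n * M / \<delta> \<ge> 2" by simp
  then have L: "L \<ge> ln 2" unfolding L_def by (subst ln_le_cancel_iff) auto
  have ln2: "ln 2 \<ge> (1 / 2 :: real)" using ln2_ge_two_thirds by simp
  obtain R0 where R0: "R0 > 0" "A * M / real R0 powr ((real d + 3) / 2) \<le> \<delta>"
    "\<delta> * sqrt (real (R0 ^ d)) \<le> sqrt (2 ^ d) * A * W"
    "A * M / (real R0 * sqrt (real R0)) \<le> A * W" "\<delta> \<le> W" "real R0 \<le> 2 * A * (M / \<delta>)"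
    using chaining_constants[OF A \<delta>, of d] unfolding W_def by blast
  \<comment> \<open>The lower bound \<open>n\<close> makes the final radius so small that
    Cauchy-Schwarz controls the remainder; the upper bound \<open>2 * n\<close> keeps
    \<open>ln (R k)\<close> of order \<open>ln (n * M / \<delta>)\<close>.\<close>
  obtain K where K: "n \<le> 2 ^ K" "2 ^ K \<le> 2 * n"
  proof -
    obtain k where k: "2 ^ k \<le> n" "n < 2 ^ (k + 1)" using ex_power_ivl1[of 2 n] n by auto
    then show ?thesis by (intro that[of "k + 1"]) auto
  qed
  define R where "R k = R0 * 2 ^ k" for k :: nat
  define r where "r k = A * M / real (R k) powr ((real d + 3) / 2)" for k
  have Rpos: "R k > 0" for k using R0 by (simp add: R_def)
  have rpos: "r k > 0" for k using A M Rpos[of k] by (simp add: r_def)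
  have r_dec: "r (Suc k) \<le> r k" for k
    unfolding r_def using A M Rpos[of k] Rpos[of "Suc k"]
    by (intro divide_left_mono powr_mono2) (auto simp: R_def)
  have r0: "r 0 \<le> \<delta>" using R0(2) by (simp add: r_def R_def)
  have "\<forall>k. \<exists>C. finite C \<and> real (card C) \<le> exp (A * real (R k) ^ d * (1 + ln (real (R k)))) \<and>
     (\<forall>f\<in>S. \<exists>u\<in>C. L2_set (\<lambda>i. f i - u i) {..<n} \<le> sqrt (real n) * r k)"
    using S Rpos unfolding has_entropy_def r_def by simp
  from choice[OF this] obtain C where C: "\<forall>k. finite (C k) \<and>
     real (card (C k)) \<le> exp (A * real (R k) ^ d * (1 + ln (real (R k)))) \<and>
     (\<forall>f\<in>S. \<exists>u\<in>C k. L2_set (\<lambda>i. f i - u i) {..<n} \<le> sqrt (real n) * r k)" ..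
  have finC: "finite (C k)" for k using C by blast
  define b where "b = (1 + ln 4 + ln A) / ln 2 + 1"
  have B_eq: "B = 2 + 2 * A * b" by (simp add: B_def b_def)
  have lnA: "ln A \<ge> 0" using A by simp
  have b1: "b \<ge> 1" using lnA by (simp add: b_def)
  have lnR: "1 + ln (real (R k)) \<le> b * L" if k: "k \<le> K" for k
  proof -
    have "(2::nat) ^ k \<le> 2 ^ K" using k by (intro power_increasing) auto
    then have "real (2 ^ k) \<le> real (2 * n)" using K(2) by (intro of_nat_mono) linarith
    then have "real (R k) \<le> 2 * A * (M / \<delta>) * real (2 * n)"
      unfolding R_def of_nat_mult using R0(6) A M \<delta> by (intro mult_mono) auto
    also have "\<dots> = 4 * A * (real n * M / \<delta>)" by simp
    finally have "ln (real (R k)) \<le> ln (4 * A * (real n * M / \<delta>))" using Rpos by (intro ln_mono) auto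
    also have "\<dots> = ln 4 + ln A + L" unfolding L_def using A nM by (subst ln_mult) (auto simp: ln_mult)
    finally have "1 + ln (real (R k)) \<le> (1 + ln 4 + ln A) + L" by simp
    also have "\<dots> \<le> (1 + ln 4 + ln A) / ln 2 * L + L"
    proof -
      have "(1 + ln 4 + ln A) / ln 2 * ln 2 \<le> (1 + ln 4 + ln A) / ln 2 * L"
        using L lnA by (intro mult_left_mono) auto
      then show ?thesis by simp
    qed
    finally show ?thesis by (simp add: b_def algebra_simps)
  qed
  \<comment> \<open>The summand 2 in \<open>B\<close> covers the constant 1 of
    \<open>l_split\<close>, as \<open>L \<ge> 1 / 2\<close>; the summand \<open>2 * A * b\<close>
    covers two entropies, since a link is determined by one centre from each of two consecutive
    covers.\<close>
  define l where "l k = B * real (R k) ^ d * L" for k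
  have Lpos: "L > 0" using L ln2 by linarith
  have Rd1: "real (R k) ^ d \<ge> 1" for k using Rpos[of k] by (simp add: Suc_le_eq)
  have l_split: "1 + 2 * (A * real (R k) ^ d * (1 + ln (real (R k)))) \<le> l k" if "k \<le> K" for k
  proof -
    have "A * real (R k) ^ d * (1 + ln (real (R k))) \<le> A * real (R k) ^ d * (b * L)"
      using A lnR[OF that] by (intro mult_left_mono) auto
    moreover have "1 \<le> 2 * real (R k) ^ d * L"
    proof -
      have "1 * (1 / 2) \<le> real (R k) ^ d * L" using Rd1[of k] L ln2 by (intro mult_mono) auto
      then show ?thesis by simp
    qed
    moreover have "l k = 2 * real (R k) ^ d * L + 2 * (A * real (R k) ^ d * (b * L))"
      unfolding l_def B_eq by (simp add: algebra_simps)
    ultimately show ?thesis by linarith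
  qed
  have ln_nonneg: "0 \<le> A * real (R k) ^ d * (1 + ln (real (R k)))" for k
    using A Rpos[of k] by (intro mult_nonneg_nonneg add_nonneg_nonneg ln_ge_zero) auto
  have l1: "l k \<ge> 1" if "k \<le> K" for k using l_split[OF that] ln_nonneg[of k] by linarith
  have exp2: "2 * exp x \<le> exp (1 + x)" for x :: real
    using exp_ge_add_one_self[of 1] by (simp add: exp_add)
  \<comment> \<open>Localisation enters here: since \<open>r 0 \<le> \<delta>\<close>, the first
    centre of a function of norm at most \<open>\<delta>\<close> has norm at most
    \<open>2 * \<delta>\<close>.\<close>
  define V0 where "V0 = {u \<in> C 0. L2_set u {..<n} \<le> sqrt (real n) * (2 * \<delta>)}"
  define V where "V k = {(\<lambda>i. u i - w i) | u w. u \<in> C (Suc k) \<and> w \<in> C k \<and>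
      L2_set (\<lambda>i. u i - w i) {..<n} \<le> sqrt (real n) * (2 * r k)}" for k
  define D0 where "D0 \<omega> = (SUP a\<in>V0. ennreal \<bar>\<Sum>i<n. \<omega> i * a i\<bar>)" for \<omega> :: "nat \<Rightarrow> real"
  define D where "D k \<omega> = (SUP a\<in>V k. ennreal \<bar>\<Sum>i<n. \<omega> i * a i\<bar>)" for k and \<omega> :: "nat \<Rightarrow> real"
  have V_sub: "V k \<subseteq> (\<lambda>(u, w) i. u i - w i) ` (C (Suc k) \<times> C k)" for k
    by (force simp: V_def)
  have finV0: "finite V0" using finC by (simp add: V0_def)
  have finV: "finite (V k)" for k by (rule finite_subset[OF V_sub]) (simp add: finC)
  have mD0: "D0 \<in> borel_measurable ?P"
    unfolding D0_def[abs_def] using finV0 PiM_linear_form_measurable[OF Q]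
    by (intro borel_measurable_SUP measurable_compose[OF _ measurable_ennreal] borel_measurable_abs)
      (auto intro: countable_finite)
  have mD: "D k \<in> borel_measurable ?P" for k
    unfolding D_def[abs_def] using finV PiM_linear_form_measurable[OF Q]
    by (intro borel_measurable_SUP measurable_compose[OF _ measurable_ennreal] borel_measurable_abs)
      (auto intro: countable_finite)
  define N where "N \<omega> = ennreal (sqrt (real n) * r K) * ennreal (L2_set \<omega> {..<n})" for \<omega>
  have mL2: "(\<lambda>\<omega>. ennreal (L2_set \<omega> {..<n})) \<in> borel_measurable ?P"
    using L2_set_PiM_measurable[OF Q] by simp
  have mN: "N \<in> borel_measurable ?P" unfolding N_def[abs_def] using mL2 by simp
  \<comment> \<open>Measurability of the supremum over \<open>S\<close> is never claimed: the
    nonnegative integral is monotone without it, and additivity is applied only to the measurable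
    majorant on the right.\<close>
  have pt: "(SUP f\<in>{f \<in> S. L2_set f {..<n} \<le> sqrt (real n) * \<delta>}.
      ennreal \<bar>(1 / real n) * (\<Sum>i<n. \<omega> i * f i)\<bar>)
      \<le> ennreal (1 / real n) * (D0 \<omega> + (\<Sum>k<K. D k \<omega>) + N \<omega>)" for \<omega>
  proof (rule SUP_least)
    fix f assume "f \<in> {f \<in> S. L2_set f {..<n} \<le> sqrt (real n) * \<delta>}"
    then have f: "f \<in> S" "L2_set f {..<n} \<le> sqrt (real n) * \<delta>" by auto
    have "\<forall>k. \<exists>u. u \<in> C k \<and> L2_set (\<lambda>i. f i - u i) {..<n} \<le> sqrt (real n) * r k"
      using C f(1) by blast
    from choice[OF this] obtain u where u: "\<And>k. u k \<in> C k"
      "\<And>k. L2_set (\<lambda>i. f i - u k i) {..<n} \<le> sqrt (real n) * r k" by blast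
    have L2_swap: "L2_set (\<lambda>i. u k i - f i) {..<n} = L2_set (\<lambda>i. f i - u k i) {..<n}" for k
      by (simp add: L2_set_def power2_commute)
    define ip where "ip a = (\<Sum>i<n. \<omega> i * a i)" for a
    have ip_diff: "ip (\<lambda>i. a i - c i) = ip a - ip c" for a c
      by (simp add: ip_def right_diff_distrib sum_subtractf)
    have "L2_set (u 0) {..<n} \<le> L2_set (\<lambda>i. u 0 i - f i) {..<n} + L2_set f {..<n}"
      using L2_set_triangle_ineq[of "\<lambda>i. u 0 i - f i" f "{..<n}"] by simp
    also have "\<dots> \<le> sqrt (real n) * \<delta> + sqrt (real n) * \<delta>"
      unfolding L2_swap using r0 by (intro add_mono f(2) order_trans[OF u(2)] mult_left_mono) auto
    also have "\<dots> = sqrt (real n) * (2 * \<delta>)" by simp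
    finally have "u 0 \<in> V0" using u(1)[of 0] by (simp only: V0_def mem_Collect_eq simp_thms)
    then have d0: "ennreal \<bar>ip (u 0)\<bar> \<le> D0 \<omega>" unfolding D0_def ip_def by (rule SUP_upper)
    have dk: "ennreal \<bar>ip (u (Suc k)) - ip (u k)\<bar> \<le> D k \<omega>" for k
    proof -
      have "L2_set (\<lambda>i. u (Suc k) i - u k i) {..<n}
          \<le> L2_set (\<lambda>i. u (Suc k) i - f i) {..<n} + L2_set (\<lambda>i. f i - u k i) {..<n}"
        using L2_set_triangle_ineq[of "\<lambda>i. u (Suc k) i - f i" "\<lambda>i. f i - u k i" "{..<n}"] by simp
      also have "\<dots> \<le> sqrt (real n) * r k + sqrt (real n) * r k"
        unfolding L2_swap by (intro add_mono u(2) order_trans[OF u(2)] mult_left_mono r_dec) auto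
      also have "\<dots> = sqrt (real n) * (2 * r k)" by simp
      finally have "(\<lambda>i. u (Suc k) i - u k i) \<in> V k"
        unfolding V_def using u(1)[of k] u(1)[of "Suc k"] by auto
      then have "ennreal \<bar>ip (\<lambda>i. u (Suc k) i - u k i)\<bar> \<le> D k \<omega>"
        unfolding D_def ip_def by (rule SUP_upper)
      then show ?thesis by (simp only: ip_diff)
    qed
    have dN: "ennreal \<bar>ip (\<lambda>i. f i - u K i)\<bar> \<le> N \<omega>"
    proof -
      have "\<bar>ip (\<lambda>i. f i - u K i)\<bar> \<le> (\<Sum>i<n. \<bar>\<omega> i\<bar> * \<bar>f i - u K i\<bar>)"
        unfolding ip_def abs_mult[symmetric] by (rule sum_abs)
      also have "\<dots> \<le> L2_set \<omega> {..<n} * L2_set (\<lambda>i. f i - u K i) {..<n}" by (rule L2_set_mult_ineq)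
      also have "\<dots> \<le> L2_set \<omega> {..<n} * (sqrt (real n) * r K)" by (intro mult_left_mono u(2)) simp
      finally have "ennreal \<bar>ip (\<lambda>i. f i - u K i)\<bar> \<le> ennreal ((sqrt (real n) * r K) * L2_set \<omega> {..<n})"
        by (intro ennreal_leI) (simp add: mult.commute)
      also have "\<dots> = N \<omega>" unfolding N_def using rpos[of K] by (intro ennreal_mult) auto
      finally show ?thesis .
    qed
    have "ip f = ip (u 0) + (\<Sum>k<K. ip (u (Suc k)) - ip (u k)) + ip (\<lambda>i. f i - u K i)"
      unfolding ip_diff using sum_lessThan_telescope[of "\<lambda>k. ip (u k)" K] by simp
    then have "\<bar>ip f\<bar> \<le> \<bar>ip (u 0)\<bar> + (\<Sum>k<K. \<bar>ip (u (Suc k)) - ip (u k)\<bar>) + \<bar>ip (\<lambda>i. f i - u K i)\<bar>"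
      using sum_abs[of "\<lambda>k. ip (u (Suc k)) - ip (u k)" "{..<K}"] by linarith
    then have "ennreal \<bar>ip f\<bar> \<le> ennreal (\<bar>ip (u 0)\<bar> + (\<Sum>k<K. \<bar>ip (u (Suc k)) - ip (u k)\<bar>) + \<bar>ip (\<lambda>i. f i - u K i)\<bar>)"
      by (rule ennreal_leI)
    also have "\<dots> = ennreal \<bar>ip (u 0)\<bar> + (\<Sum>k<K. ennreal \<bar>ip (u (Suc k)) - ip (u k)\<bar>) + ennreal \<bar>ip (\<lambda>i. f i - u K i)\<bar>"
      by (simp add: ennreal_plus sum_nonneg)
    also have "\<dots> \<le> D0 \<omega> + (\<Sum>k<K. D k \<omega>) + N \<omega>"
      by (intro add_mono sum_mono d0 dk dN)
    finally have "ennreal (1 / real n) * ennreal \<bar>ip f\<bar> \<le> ennreal (1 / real n) * (D0 \<omega> + (\<Sum>k<K. D k \<omega>) + N \<omega>)"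
      by (intro mult_left_mono) auto
    moreover have "ennreal \<bar>(1 / real n) * (\<Sum>i<n. \<omega> i * f i)\<bar> = ennreal (1 / real n) * ennreal \<bar>ip f\<bar>"
      unfolding ip_def abs_mult by (subst ennreal_mult) auto
    ultimately show "ennreal \<bar>(1 / real n) * (\<Sum>i<n. \<omega> i * f i)\<bar>
        \<le> ennreal (1 / real n) * (D0 \<omega> + (\<Sum>k<K. D k \<omega>) + N \<omega>)" by simp
  qed
  define E where "E = 6 * s * sqrt (real n) * sqrt (2 ^ d) * A * W * sqrt B * sqrt L"
  have B0: "B \<ge> 0" using A b1 by (simp add: B_eq)
  have W0: "W \<ge> 0" by (simp add: W_def)
  have sqrt_l: "sqrt (l k) = sqrt (real (R k ^ d)) * (sqrt B * sqrt L)" for k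
    by (simp add: l_def real_sqrt_mult mult_ac)
  have iD0: "(\<integral>\<^sup>+ \<omega>. D0 \<omega> \<partial>?P) \<le> ennreal E"
  proof -
    have "2 * real (card V0) \<le> 2 * real (card (C 0))"
      using card_mono[OF finC, of V0 0] by (simp add: V0_def)
    also have "\<dots> \<le> 2 * exp (A * real (R 0) ^ d * (1 + ln (real (R 0))))" using C by simp
    also have "\<dots> \<le> exp (1 + A * real (R 0) ^ d * (1 + ln (real (R 0))))" by (rule exp2)
    also have "\<dots> \<le> exp (l 0)" using l_split[of 0] ln_nonneg[of 0] by simp
    finally have "(\<integral>\<^sup>+ \<omega>. D0 \<omega> \<partial>?P) \<le> ennreal (3 * s * (sqrt (real n) * (2 * \<delta>)) * sqrt (l 0))"
      unfolding D0_def using Q s n \<delta> finV0 l1[of 0]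
      by (intro subgaussian_maximal_inequality) (auto simp: V0_def)
    also have "\<dots> \<le> ennreal E"
    proof (rule ennreal_leI)
      have "3 * s * (sqrt (real n) * (2 * \<delta>)) * sqrt (l 0)
          = 6 * s * sqrt (real n) * (sqrt B * sqrt L) * (\<delta> * sqrt (real (R0 ^ d)))"
        unfolding sqrt_l by (simp add: R_def)
      also have "\<dots> \<le> 6 * s * sqrt (real n) * (sqrt B * sqrt L) * (sqrt (2 ^ d) * A * W)"
        using s B0 Lpos by (intro mult_left_mono R0(3)) auto
      also have "\<dots> = E" by (simp add: E_def mult_ac)
      finally show "3 * s * (sqrt (real n) * (2 * \<delta>)) * sqrt (l 0) \<le> E" .
    qed
    finally show ?thesis .
  qed
  have iD: "(\<integral>\<^sup>+ \<omega>. D k \<omega> \<partial>?P) \<le> ennreal (E * (1 / 2) ^ k)" if k: "k < K" for k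
  proof -
    have "card (V k) \<le> card (C (Suc k) \<times> C k)"
      using card_mono[OF _ V_sub[of k]] card_image_le[of "C (Suc k) \<times> C k" "\<lambda>(u, w) i. u i - w i"] finC
      by (meson finite_SigmaI finite_imageI order_trans)
    then have "2 * real (card (V k)) \<le> 2 * (real (card (C (Suc k))) * real (card (C k)))"
      by (simp add: card_cartesian_product of_nat_mult[symmetric] del: of_nat_mult)
    also have "\<dots> \<le> 2 * (exp (A * real (R (Suc k)) ^ d * (1 + ln (real (R (Suc k)))))
        * exp (A * real (R (Suc k)) ^ d * (1 + ln (real (R (Suc k))))))"
    proof (intro mult_left_mono mult_mono)
      have "real (R k) \<le> real (R (Suc k))" by (simp add: R_def)
      then have "A * real (R k) ^ d * (1 + ln (real (R k))) \<le> A * real (R (Suc k)) ^ d * (1 + ln (real (R (Suc k))))"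
        using A Rpos[of k] by (intro mult_mono power_mono add_left_mono ln_mono mult_nonneg_nonneg add_nonneg_nonneg ln_ge_zero) auto
      moreover have "real (card (C k)) \<le> exp (A * real (R k) ^ d * (1 + ln (real (R k))))" using C by blast
      ultimately show "real (card (C k)) \<le> exp (A * real (R (Suc k)) ^ d * (1 + ln (real (R (Suc k)))))"
        by (meson exp_le_cancel_iff order_trans)
    qed (use C in auto)
    also have "\<dots> = 2 * exp (2 * (A * real (R (Suc k)) ^ d * (1 + ln (real (R (Suc k))))))"
      by (simp only: exp_add[symmetric] mult_2)
    also have "\<dots> \<le> exp (1 + 2 * (A * real (R (Suc k)) ^ d * (1 + ln (real (R (Suc k))))))" by (rule exp2)
    also have "\<dots> \<le> exp (l (Suc k))" using l_split[of "Suc k"] k by simp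
    finally have "(\<integral>\<^sup>+ \<omega>. D k \<omega> \<partial>?P) \<le> ennreal (3 * s * (sqrt (real n) * (2 * r k)) * sqrt (l (Suc k)))"
      unfolding D_def using Q s n rpos[of k] finV l1[of "Suc k"] k
      by (intro subgaussian_maximal_inequality) (auto simp: V_def)
    also have "\<dots> \<le> ennreal (E * (1 / 2) ^ k)"
    proof (rule ennreal_leI)
      have RS: "sqrt (real (R (Suc k) ^ d)) = sqrt (2 ^ d) * sqrt (real (R k ^ d))"
        by (simp add: R_def power_mult_distrib real_sqrt_mult)
      \<comment> \<open>Of the decay \<open>R k\<close> to the power \<open>-3/2\<close> only the
        factor \<open>(1 / 2) ^ k\<close> is kept, which is enough for a convergent sum.\<close>
      have "r k * sqrt (real (R k ^ d)) = A * M / (real (R k) * sqrt (real (R k)))"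
        unfolding r_def powr_half_exponent[OF Rpos[of k]] using Rpos[of k] by simp
      also have "\<dots> \<le> A * M / (real R0 * sqrt (real R0) * 2 ^ k)"
      proof (rule divide_left_mono)
        have "real R0 * 1 \<le> real (R k)" unfolding R_def of_nat_mult by (intro mult_left_mono) auto
        then have "real R0 * 2 ^ k * sqrt (real R0) \<le> real (R k) * sqrt (real (R k))"
          by (intro mult_mono real_sqrt_le_mono) (auto simp: R_def)
        then show "real R0 * sqrt (real R0) * 2 ^ k \<le> real (R k) * sqrt (real (R k))" by (simp add: mult_ac)
      qed (use A M R0(1) Rpos[of k] in auto)
      also have "\<dots> = A * M / (real R0 * sqrt (real R0)) * (1 / 2) ^ k" by (simp add: power_one_over)
      also have "\<dots> \<le> A * W * (1 / 2) ^ k" by (intro mult_right_mono R0(4)) auto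
      finally have rk: "r k * sqrt (real (R k ^ d)) \<le> A * W * (1 / 2) ^ k" .
      have "3 * s * (sqrt (real n) * (2 * r k)) * sqrt (l (Suc k))
          = 6 * s * sqrt (real n) * (sqrt B * sqrt L) * sqrt (2 ^ d) * (r k * sqrt (real (R k ^ d)))"
        unfolding sqrt_l RS by simp
      also have "\<dots> \<le> 6 * s * sqrt (real n) * (sqrt B * sqrt L) * sqrt (2 ^ d) * (A * W * (1 / 2) ^ k)"
        using s B0 Lpos by (intro mult_left_mono rk) auto
      also have "\<dots> = E * (1 / 2) ^ k" by (simp add: E_def mult_ac)
      finally show "3 * s * (sqrt (real n) * (2 * r k)) * sqrt (l (Suc k)) \<le> E * (1 / 2) ^ k" .
    qed
    finally show ?thesis .
  qed
  have iN: "(\<integral>\<^sup>+ \<omega>. N \<omega> \<partial>?P) \<le> ennreal (5 * s * \<delta>)"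
  proof -
    have "(\<integral>\<^sup>+ \<omega>. N \<omega> \<partial>?P) = ennreal (sqrt (real n) * r K) * (\<integral>\<^sup>+ \<omega>. ennreal (L2_set \<omega> {..<n}) \<partial>?P)"
      unfolding N_def using mL2 by (rule nn_integral_cmult)
    also have "\<dots> \<le> ennreal (sqrt (real n) * r K) * ennreal (5 * s * sqrt (real n))"
      using n by (intro mult_left_mono subgaussian_expected_norm[OF Q s]) auto
    also have "\<dots> = ennreal (5 * s * (real n * r K))"
      using rpos[of K] s by (subst ennreal_mult[symmetric]) (auto simp: mult_ac)
    also have "\<dots> \<le> ennreal (5 * s * \<delta>)"
    proof (intro ennreal_leI mult_left_mono)
      \<comment> \<open>The exponent is at least 1 and \<open>2 ^ K \<ge> n\<close>, so the last
        radius is at most \<open>\<delta> / n\<close>. This beats the factor \<open>n\<close> formed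
        by the scaling of the radius and the expected norm of the noise.\<close>
      have "real (R K) powr ((real d + 3) / 2) = real R0 powr ((real d + 3) / 2) * (2 ^ K) powr ((real d + 3) / 2)"
        by (simp add: R_def powr_mult)
      moreover have "real n \<le> (2 ^ K) powr ((real d + 3) / 2)"
      proof -
        have "real n \<le> real (2 ^ K)" by (rule of_nat_mono[OF K(1)])
        also have "\<dots> = (2 ^ K) powr 1" by simp
        also have "\<dots> \<le> (2 ^ K) powr ((real d + 3) / 2)" by (intro powr_mono) auto
        finally show ?thesis .
      qed
      ultimately have "real R0 powr ((real d + 3) / 2) * real n \<le> real (R K) powr ((real d + 3) / 2)"
        by (simp add: mult_left_mono)
      then have "r K \<le> A * M / (real R0 powr ((real d + 3) / 2) * real n)"
        unfolding r_def using A M R0(1) Rpos[of K] n by (intro divide_left_mono) auto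
      then have "real n * r K \<le> real n * (A * M / (real R0 powr ((real d + 3) / 2) * real n))"
        by (intro mult_left_mono) auto
      also have "\<dots> = A * M / real R0 powr ((real d + 3) / 2)" using n by simp
      finally show "real n * r K \<le> \<delta>" using R0(2) by linarith
    qed (use s in auto)
    finally show ?thesis .
  qed
  have E0: "E \<ge> 0" using s A W0 B0 Lpos by (simp add: E_def)
  have "(\<integral>\<^sup>+ \<omega>. (SUP f\<in>{f \<in> S. L2_set f {..<n} \<le> sqrt (real n) * \<delta>}.
            ennreal \<bar>(1 / real n) * (\<Sum>i<n. \<omega> i * f i)\<bar>) \<partial>?P)
      \<le> (\<integral>\<^sup>+ \<omega>. ennreal (1 / real n) * (D0 \<omega> + (\<Sum>k<K. D k \<omega>) + N \<omega>) \<partial>?P)"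
    by (intro nn_integral_mono pt)
  also have "\<dots> = ennreal (1 / real n) * ((\<integral>\<^sup>+ \<omega>. D0 \<omega> \<partial>?P) + (\<Sum>k<K. \<integral>\<^sup>+ \<omega>. D k \<omega> \<partial>?P) + (\<integral>\<^sup>+ \<omega>. N \<omega> \<partial>?P))"
    using mD0 mD mN by (simp add: nn_integral_cmult nn_integral_add nn_integral_sum)
  also have "\<dots> \<le> ennreal (1 / real n) * (ennreal E + (\<Sum>k<K. ennreal (E * (1 / 2) ^ k)) + ennreal (5 * s * \<delta>))"
    using iD by (intro mult_left_mono add_mono sum_mono iD0 iN) auto
  also have "\<dots> = ennreal (1 / real n * (E + (\<Sum>k<K. E * (1 / 2) ^ k) + 5 * s * \<delta>))"
    using E0 s \<delta> by (simp add: ennreal_plus[symmetric] ennreal_mult[symmetric] sum_nonneg del: ennreal_plus)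
  also have "\<dots> \<le> ennreal ((18 * sqrt (2 ^ d) * A * sqrt B + 10) * rate d n s \<delta> M)"
  proof (rule ennreal_leI)
    \<comment> \<open>The first term and the links together give \<open>3 * E\<close>, and
      \<open>E\<close> carries a factor 6, hence 18. The remainder is absorbed by means of
      \<open>\<delta> \<le> W\<close> and \<open>sqrt L * sqrt n \<ge> 1 / 2\<close>, which turns 5
      into 10.\<close>
    have "(\<Sum>k<K. (1 / 2 :: real) ^ k) \<le> 2" by (simp add: geometric_sum)
    then have sum: "(\<Sum>k<K. E * (1 / 2) ^ k) \<le> E * 2"
      unfolding sum_distrib_left[symmetric] using E0 by (intro mult_left_mono)
    have "sqrt L \<ge> 1 / 2"
    proof (rule real_le_rsqrt)
      show "(1 / 2)\<^sup>2 \<le> L" using L ln2 by (simp add: power2_eq_square)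
    qed
    moreover have "sqrt (real n) \<ge> 1" using n by simp
    ultimately have "1 / 2 * 1 \<le> sqrt L * sqrt (real n)" using Lpos by (intro mult_mono) auto
    then have "W * (1 / 2) \<le> W * (sqrt L * sqrt (real n))" using W0 by (intro mult_left_mono) auto
    then have "5 * s * \<delta> \<le> 5 * s * (2 * (W * (sqrt L * sqrt (real n))))"
      using R0(5) s by (intro mult_left_mono) auto
    also have "\<dots> = 10 * s * (W * (sqrt L * sqrt (real n)))" by simp
    finally have "E + (\<Sum>k<K. E * (1 / 2) ^ k) + 5 * s * \<delta> \<le> 3 * E + 10 * s * (W * (sqrt L * sqrt (real n)))"
      using sum by linarith
    also have "\<dots> = (18 * sqrt (2 ^ d) * A * sqrt B + 10) * (s * W * sqrt L * sqrt (real n))"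
      by (simp add: E_def algebra_simps)
    finally have "1 / real n * (E + (\<Sum>k<K. E * (1 / 2) ^ k) + 5 * s * \<delta>)
        \<le> 1 / real n * ((18 * sqrt (2 ^ d) * A * sqrt B + 10) * (s * W * sqrt L * sqrt (real n)))"
      by (intro mult_left_mono) auto
    also have "\<dots> = (18 * sqrt (2 ^ d) * A * sqrt B + 10) * (s * W * sqrt L * (sqrt (real n) / real n))" by simp
    also have "sqrt (real n) / real n = 1 / sqrt (real n)" using n by (simp add: real_div_sqrt field_simps)
    finally show "1 / real n * (E + (\<Sum>k<K. E * (1 / 2) ^ k) + 5 * s * \<delta>)
        \<le> (18 * sqrt (2 ^ d) * A * sqrt B + 10) * rate d n s \<delta> M"
      by (simp add: rate_def W_def L_def mult_ac)
  qed
  finally show ?thesis .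
qed

section \<open>From vectors of values back to function classes\<close>

lemma local_complexity_bound:
  fixes F :: "('a \<Rightarrow> real) set" and n d :: nat
  assumes "A \<ge> 1" "0 < \<delta>" "\<delta> \<le> M" "n \<ge> 2" "s > 0" "\<forall>i<n. subgaussian_law s (Q i)"
    and "has_entropy A d n M ((\<lambda>f i. f (X i)) ` F)"
  shows "local_complexity n X F \<delta> Q \<le> ennreal ((18 * sqrt (2 ^ d) * A
      * sqrt (2 + 2 * A * ((1 + ln 4 + ln A) / ln 2 + 1)) + 10) * rate d n s \<delta> M)"
proof -
  have emp: "emp_norm n X f \<le> \<delta> \<longleftrightarrow> L2_set (\<lambda>i. f (X i)) {..<n} \<le> sqrt (real n) * \<delta>" for f
  proof -
    have "emp_norm n X f = L2_set (\<lambda>i. f (X i)) {..<n} / sqrt (real n)"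
      by (simp add: emp_norm_def L2_set_def real_sqrt_divide)
    then show ?thesis using assms(4) by (simp add: pos_divide_le_eq mult.commute)
  qed
  have "local_complexity n X F \<delta> Q
      \<le> (\<integral>\<^sup>+ \<omega>. (SUP g\<in>{g \<in> (\<lambda>f i. f (X i)) ` F. L2_set g {..<n} \<le> sqrt (real n) * \<delta>}.
            ennreal \<bar>(1 / real n) * (\<Sum>i<n. \<omega> i * g i)\<bar>) \<partial>PiM {..<n} Q)"
    unfolding local_complexity_def emp
  proof (intro nn_integral_mono SUP_least)
    fix \<omega> f assume "f \<in> {f \<in> F. L2_set (\<lambda>i. f (X i)) {..<n} \<le> sqrt (real n) * \<delta>}"
    then show "ennreal \<bar>(1 / real n) * (\<Sum>i<n. \<omega> i * f (X i))\<bar>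
        \<le> (SUP g\<in>{g \<in> (\<lambda>f i. f (X i)) ` F. L2_set g {..<n} \<le> sqrt (real n) * \<delta>}.
            ennreal \<bar>(1 / real n) * (\<Sum>i<n. \<omega> i * g i)\<bar>)"
      by (intro SUP_upper2[of "\<lambda>i. f (X i)"]) auto
  qed
  also have "\<dots> \<le> ennreal ((18 * sqrt (2 ^ d) * A
      * sqrt (2 + 2 * A * ((1 + ln 4 + ln A) / ln 2 + 1)) + 10) * rate d n s \<delta> M)"
    using assms by (intro chaining_bound) auto
  finally show ?thesis .
qed

theorem theorem5:
  shows "(\<exists>C>0. \<forall>(n::nat) (X::nat \<Rightarrow> 'a::euclidean_space) Q s M \<delta>.
            n \<ge> 2 \<longrightarrow> (\<forall>i<n. norm (X i) \<le> 1) \<longrightarrow> s > 0 \<longrightarrow>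
            (\<forall>i<n. subgaussian_law s (Q i)) \<longrightarrow> 0 < \<delta> \<longrightarrow> \<delta> \<le> M \<longrightarrow>
            local_complexity n X (F_sigma_M M) \<delta> Q \<le> ennreal (C * rate DIM('a) n s \<delta> M))
       \<and> (\<forall>B>0. \<exists>C>0. \<forall>(n::nat) (X::nat \<Rightarrow> 'a) Q s M \<delta>.
            n \<ge> 2 \<longrightarrow> (\<forall>i<n. norm (X i) \<le> 1) \<longrightarrow> s > 0 \<longrightarrow>
            (\<forall>i<n. subgaussian_law s (Q i)) \<longrightarrow> 0 < \<delta> \<longrightarrow> \<delta> \<le> M \<longrightarrow>
            local_complexity n X (star (trunc_class B (F_sigma_M M))) \<delta> Q
              \<le> ennreal (C * rate DIM('a) n s \<delta> M))"
proof -
  define k where "k A = 18 * sqrt (2 ^ DIM('a)) * A * sqrt (2 + 2 * A * ((1 + ln 4 + ln A) / ln 2 + 1)) + 10" for A :: real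
  have k: "k A > 0" if "A \<ge> 1" for A
    unfolding k_def using that by (intro add_nonneg_pos mult_nonneg_nonneg) auto
  obtain A where A: "A \<ge> 1" "\<And>n (X::nat \<Rightarrow> 'a) M. n > 0 \<Longrightarrow> M > 0 \<Longrightarrow> \<forall>i<n. norm (X i) \<le> 1 \<Longrightarrow>
     has_entropy A DIM('a) n M ((\<lambda>f i. f (X i)) ` F_sigma_M M)"
    using F_sigma_M_has_entropy[where 'a = 'a] by blast
  define A' where "A' = A + DIM('a) + 4"
  have A': "A' \<ge> 1" using A by (simp add: A'_def)
  show ?thesis
  proof (intro conjI allI impI)
    show "\<exists>C>0. \<forall>(n::nat) (X::nat \<Rightarrow> 'a::euclidean_space) Q s M \<delta>.
            n \<ge> 2 \<longrightarrow> (\<forall>i<n. norm (X i) \<le> 1) \<longrightarrow> s > 0 \<longrightarrow>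
            (\<forall>i<n. subgaussian_law s (Q i)) \<longrightarrow> 0 < \<delta> \<longrightarrow> \<delta> \<le> M \<longrightarrow>
            local_complexity n X (F_sigma_M M) \<delta> Q \<le> ennreal (C * rate DIM('a) n s \<delta> M)"
    proof (intro exI[of _ "k A"] conjI allI impI k A(1))
      fix n :: nat and X :: "nat \<Rightarrow> 'a" and Q and s M \<delta> :: real
      assume "n \<ge> 2" "\<forall>i<n. norm (X i) \<le> 1" "s > 0" "\<forall>i<n. subgaussian_law s (Q i)" "0 < \<delta>" "\<delta> \<le> M"
      then show "local_complexity n X (F_sigma_M M) \<delta> Q \<le> ennreal (k A * rate DIM('a) n s \<delta> M)"
        unfolding k_def using A by (intro local_complexity_bound A(2)) auto
    qed
  next
    fix B :: real assume B: "B > 0"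
    show "\<exists>C>0. \<forall>(n::nat) (X::nat \<Rightarrow> 'a) Q s M \<delta>.
            n \<ge> 2 \<longrightarrow> (\<forall>i<n. norm (X i) \<le> 1) \<longrightarrow> s > 0 \<longrightarrow>
            (\<forall>i<n. subgaussian_law s (Q i)) \<longrightarrow> 0 < \<delta> \<longrightarrow> \<delta> \<le> M \<longrightarrow>
            local_complexity n X (star (trunc_class B (F_sigma_M M))) \<delta> Q
              \<le> ennreal (C * rate DIM('a) n s \<delta> M)"
    proof (intro exI[of _ "k A'"] conjI allI impI k A')
      fix n :: nat and X :: "nat \<Rightarrow> 'a" and Q and s M \<delta> :: real
      assume as: "n \<ge> 2" "\<forall>i<n. norm (X i) \<le> 1" "s > 0" "\<forall>i<n. subgaussian_law s (Q i)" "0 < \<delta>" "\<delta> \<le> M"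
      then have "has_entropy A' DIM('a) n M ((\<lambda>f i. f (X i)) ` star (trunc_class B (F_sigma_M M)))"
        unfolding A'_def using A B by (intro star_trunc_has_entropy A(2) F_sigma_M_bound) auto
      then show "local_complexity n X (star (trunc_class B (F_sigma_M M))) \<delta> Q \<le> ennreal (k A' * rate DIM('a) n s \<delta> M)"
        unfolding k_def using as A' by (intro local_complexity_bound) auto
    qed
  qed
qed

end
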